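(* Let $\nabla$ be a torsion-free connection on a smooth manifold $M$. For $X,Y\in\mathfrak{X}(M)$, $$[L^s_X,L^s_Y]=L^s_{[X,Y]}+\iota^s_{2(\nabla_{\nabla X}Y-\nabla_{\nabla Y}X-R_\nabla(X,Y))}$$ as operators on $\Upsilon^\bullet(M)$, where $R_\nabla$ is the Riemann curvature tensor of $\nabla$.
   Context: $M$ is a smooth manifold of positive dimension; a connection on $M$ is an affine connection on $TM$, extended to tensor fields. $\Upsilon^r(M)=\Gamma(\mathrm{Sym}^rT^*M)$ is the space of totally symmetric covariant $r$-tensor fields, $\Upsilon^0(M)=C^\infty(M)$, $\Upsilon^\bullet(M)=\bigoplus_r\Upsilon^r(M)$, with symmetric product $\varphi\odot\psi=\frac{(r+l)!}{r!\,l!}\mathrm{sym}(\varphi\otimes\psi)$ ($\mathrm{sym}$ = average over permutations). Derivations are with respect to $\odot$, without signs, and $[D,D']=D\circ D'-D'\circ D$. The symmetric derivative is $\nabla^sf=df$ and $(\nabla^s\varphi)(X_1,\dots,X_{r+1})=\sum_j(\nabla_{X_j}\varphi)(X_1,\dots,\hat X_j,\dots,X_{r+1})$ for $\varphi\in\Upsilon^r(M)$. The symmetric Lie derivative is $L^s_X=[\iota_X,\nabla^s]$, where $\iota_X$ is the contraction in the first argument (zero on functions). For $\sigma\in\Gamma(\mathrm{Sym}^kT^*M\otimes TM)$, the symmetric contraction $\iota^s_\sigma$ is the unique degree-$(k-1)$ derivation of $\Upsilon^\bullet(M)$ with $\iota^s_\sigma f=0$ for functions and $(\iota^s_\sigma\alpha)(X_1,\dots,X_k)=\alpha(\sigma(X_1,\dots,X_k))$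 for $1$-forms $\alpha$. $R_\nabla(X,Y)Z=\nabla_X\nabla_YZ-\nabla_Y\nabla_XZ-\nabla_{[X,Y]}Z$, so $R_\nabla(X,Y)\in\Gamma(\mathrm{End}\,TM)$; $\nabla_{\nabla X}Y\in\Gamma(\mathrm{End}\,TM)$ denotes the endomorphism $Z\mapsto\nabla_{\nabla_ZX}Y$. $[X,Y]$ is the Lie bracket of vector fields. *)

theory Defs
  imports
    "HOL-Analysis.Analysis"
    "HOL-Combinatorics.Permutations"
    "HOL-Library.Multiset"
    "HOL-Library.FuncSet"
    "HOL-Library.Function_Algebras"
begin

section \<open>Smooth manifolds, tangent vectors, vector fields\<close>

text \<open>
  On an open set \<open>S\<close>, \<open>higher_differentiable_on S f n\<close> says that all iterated directional
  derivatives of \<open>f\<close> up to order \<open>n\<close> exist and are continuous.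
\<close>

primrec higher_differentiable_on ::
    "'a::real_normed_vector set \<Rightarrow> ('a \<Rightarrow> 'b::real_normed_vector) \<Rightarrow> nat \<Rightarrow> bool" where
  "higher_differentiable_on S f 0 \<longleftrightarrow> continuous_on S f"
| "higher_differentiable_on S f (Suc n) \<longleftrightarrow>
     (\<forall>x\<in>S. f differentiable (at x)) \<and>
     (\<forall>v. higher_differentiable_on S (\<lambda>x. frechet_derivative f (at x) v) n)"

definition smooth_on ::
    "'a::real_normed_vector set \<Rightarrow> ('a \<Rightarrow> 'b::real_normed_vector) \<Rightarrow> bool" where
  "smooth_on S f \<longleftrightarrow> (\<forall>n. higher_differentiable_on S f n)"

text \<open>A chart is its domain together with the coordinate map (whose values off the domain
  are irrelevant).\<close>

type_synonym ('m, 'e) chart = "'m set \<times> ('m \<Rightarrow> 'e)"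

definition chart_inv :: "('m, 'e) chart \<Rightarrow> 'e \<Rightarrow> 'm" where
  "chart_inv = (\<lambda>(U, c). inv_into U c)"

text \<open>
  The underlying set of the manifold is the whole type \<open>'m\<close>; its topology is Hausdorff and second
  countable. The dimension is that of the Euclidean space \<open>'e\<close>, hence arbitrary but positive.
  The atlas is not required to be maximal.
\<close>

locale smooth_manifold =
  fixes A :: "('m::{t2_space, second_countable_topology}, 'e::euclidean_space) chart set"
  assumes charts: "(U, c) \<in> A \<Longrightarrow>
      open U \<and> open (c ` U) \<and> homeomorphism U (c ` U) c (chart_inv (U, c))"
    and cover: "(\<Union>(U, c)\<in>A. U) = UNIV"
    and compatible: "(U, c) \<in> A \<Longrightarrow> (V, d) \<in> A \<Longrightarrow>
      smooth_on (c ` (U \<inter> V)) (d \<circ> chart_inv (U, c))"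

definition smooth_functions :: "('m, 'e::euclidean_space) chart set \<Rightarrow> ('m \<Rightarrow> real) set" where
  "smooth_functions A = {f. \<forall>(U, c)\<in>A. smooth_on (c ` U) (f \<circ> chart_inv (U, c))}"

text \<open>
  A tangent vector at \<open>p\<close> is a directional derivative operator \<open>\<Sum>\<^sub>i u\<^sub>i \<partial>\<^sub>i\<close> at \<open>p\<close> on smooth
  functions, taken with respect to some chart around \<open>p\<close> (by the chain rule, the chart does not
  matter). So that tangent vectors are determined by their values on smooth functions, they are
  set to \<open>0\<close> on all other functions. The vector space structure is the pointwise one.
\<close>

type_synonym 'm tvec = "('m \<Rightarrow> real) \<Rightarrow> real"
type_synonym 'm vfield = "'m \<Rightarrow> 'm tvec"

definition coord_vector ::
    "('m, 'e::euclidean_space) chart set \<Rightarrow> ('m, 'e) chart \<Rightarrow> 'm \<Rightarrow> 'e \<Rightarrow> 'm tvec" where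
  "coord_vector A C p u = (\<lambda>f.
     if f \<in> smooth_functions A
     then frechet_derivative (f \<circ> chart_inv C) (at (snd C p)) u else 0)"

definition tangent_space :: "('m, 'e::euclidean_space) chart set \<Rightarrow> 'm \<Rightarrow> 'm tvec set" where
  "tangent_space A p = {coord_vector A (U, c) p u | U c u. (U, c) \<in> A \<and> p \<in> U}"

definition vector_fields :: "('m, 'e::euclidean_space) chart set \<Rightarrow> 'm vfield set" where
  "vector_fields A = {X. \<forall>(U, c)\<in>A. \<exists>u. smooth_on (c ` U) u \<and>
     (\<forall>p\<in>U. X p = coord_vector A (U, c) p (u (c p)))}"

definition vf_apply :: "'m vfield \<Rightarrow> ('m \<Rightarrow> real) \<Rightarrow> 'm \<Rightarrow> real" where
  "vf_apply X f = (\<lambda>p. X p f)"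

definition vf_scale :: "('m \<Rightarrow> real) \<Rightarrow> 'm vfield \<Rightarrow> 'm vfield" where
  "vf_scale f X = (\<lambda>p g. f p * X p g)"

definition lie_bracket ::
    "('m, 'e::euclidean_space) chart set \<Rightarrow> 'm vfield \<Rightarrow> 'm vfield \<Rightarrow> 'm vfield" where
  "lie_bracket A X Y = (\<lambda>p f.
     if f \<in> smooth_functions A then X p (vf_apply Y f) - Y p (vf_apply X f) else 0)"

section \<open>Symmetric tensor fields\<close>

definition multilinear_on :: "'m tvec set \<Rightarrow> ('m tvec list \<Rightarrow> real) \<Rightarrow> bool" where
  "multilinear_on V F \<longleftrightarrow>
     (\<forall>xs ys v w a b. set xs \<subseteq> V \<and> set ys \<subseteq> V \<and> v \<in> V \<and> w \<in> V \<longrightarrow>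
        F (xs @ (\<lambda>f. a * v f + b * w f) # ys) = a * F (xs @ v # ys) + b * F (xs @ w # ys))"

definition symmetric_on :: "'m tvec set \<Rightarrow> ('m tvec list \<Rightarrow> 'b) \<Rightarrow> bool" where
  "symmetric_on V F \<longleftrightarrow>
     (\<forall>vs ws. set vs \<subseteq> V \<and> mset ws = mset vs \<longrightarrow> F ws = F vs)"

text \<open>
  An element of \<open>\<Upsilon>\<^sup>\<bullet>(M) = \<Oplus>\<^sub>r \<Upsilon>\<^sup>r(M)\<close> is encoded as a single function on lists of tangent vectors
  at a point: its restriction to lists of length \<open>r\<close> is the component in \<open>\<Upsilon>\<^sup>r(M)\<close>. In
  particular the value on the empty list is the component in \<open>\<Upsilon>\<^sup>0(M)\<close>, a smooth function.
  Only finitely many components are nonzero, and a tensor is \<open>0\<close> on lists that are not made of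
  tangent vectors, so that equality of sections is equality of functions.
\<close>

type_synonym 'm tensor = "'m \<Rightarrow> 'm tvec list \<Rightarrow> real"

definition sym_tensors :: "('m, 'e::euclidean_space) chart set \<Rightarrow> 'm tensor set" where
  "sym_tensors A = {\<Phi>.
     (\<forall>p. multilinear_on (tangent_space A p) (\<Phi> p) \<and> symmetric_on (tangent_space A p) (\<Phi> p)) \<and>
     (\<forall>(U, c)\<in>A. \<forall>us\<in>lists Basis.
        smooth_on (c ` U) (\<lambda>x. let p = chart_inv (U, c) x
                                in \<Phi> p (map (coord_vector A (U, c) p) us))) \<and>
     (\<exists>n. \<forall>p vs. length vs > n \<longrightarrow> \<Phi> p vs = 0) \<and>
     (\<forall>p vs. \<not> set vs \<subseteq> tangent_space A p \<longrightarrow> \<Phi> p vs = 0)}"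

text \<open>\<open>\<Upsilon>\<^sup>r(M)\<close>, which is zero for negative \<open>r\<close>.\<close>

definition sym_tensors_deg ::
    "('m, 'e::euclidean_space) chart set \<Rightarrow> int \<Rightarrow> 'm tensor set" where
  "sym_tensors_deg A r = {\<Phi> \<in> sym_tensors A. \<forall>p vs. int (length vs) \<noteq> r \<longrightarrow> \<Phi> p vs = 0}"

text \<open>\<open>\<Phi>(X\<^sub>1, \<dots>, X\<^sub>r)\<close> for vector fields \<open>X\<^sub>1, \<dots>, X\<^sub>r\<close>.\<close>

definition tensor_eval :: "('m \<Rightarrow> 'm tvec list \<Rightarrow> 'b) \<Rightarrow> 'm vfield list \<Rightarrow> 'm \<Rightarrow> 'b" where
  "tensor_eval \<Phi> Xs = (\<lambda>p. \<Phi> p (map (\<lambda>X. X p) Xs))"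

text \<open>The tensor field with prescribed values on vector fields. It exists when the prescription
  is symmetric, multilinear over the smooth functions, smooth and of bounded degree.\<close>

definition tensor_of ::
    "('m, 'e::euclidean_space) chart set \<Rightarrow> ('m vfield list \<Rightarrow> 'm \<Rightarrow> real) \<Rightarrow> 'm tensor" where
  "tensor_of A T = (THE \<Phi>. \<Phi> \<in> sym_tensors A \<and>
     (\<forall>Xs\<in>lists (vector_fields A). tensor_eval \<Phi> Xs = T Xs))"

definition symmetrize :: "('v list \<Rightarrow> real) \<Rightarrow> 'v list \<Rightarrow> real" where
  "symmetrize F vs =
     (\<Sum>\<pi> | \<pi> permutes {..<length vs}. F (map (\<lambda>i. vs ! \<pi> i) [0..<length vs]))
       / fact (length vs)"

text \<open>In the summand, \<open>r\<close> and \<open>l = n - r\<close> are the degrees of the components of \<open>\<Phi>\<close> and \<open>\<Psi>\<close>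
  that contribute to the component of degree \<open>n = r + l\<close> of the product.\<close>

definition sym_product :: "'m tensor \<Rightarrow> 'm tensor \<Rightarrow> 'm tensor" (infixl "\<odot>" 70) where
  "\<Phi> \<odot> \<Psi> = (\<lambda>p vs. let n = length vs in
     \<Sum>r\<le>n. fact n / (fact r * fact (n - r)) *
       symmetrize (\<lambda>ws. \<Phi> p (take r ws) * \<Psi> p (drop r ws)) vs)"

text \<open>Sections of \<open>Sym\<^sup>k T*M \<otimes> TM\<close>; for \<open>k = 1\<close> these are the sections of \<open>End TM\<close>.\<close>

type_synonym 'm vtensor = "'m \<Rightarrow> 'm tvec list \<Rightarrow> 'm tvec"

definition sym_vtensors ::
    "('m, 'e::euclidean_space) chart set \<Rightarrow> nat \<Rightarrow> 'm vtensor set" where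
  "sym_vtensors A k = {\<sigma>.
     (\<forall>p. (\<forall>f. multilinear_on (tangent_space A p) (\<lambda>vs. \<sigma> p vs f)) \<and>
          symmetric_on (tangent_space A p) (\<sigma> p)) \<and>
     (\<forall>p. \<forall>vs\<in>lists (tangent_space A p). \<sigma> p vs \<in> tangent_space A p) \<and>
     (\<forall>(U, c)\<in>A. \<forall>us\<in>lists Basis. \<exists>w. smooth_on (c ` U) w \<and>
        (\<forall>p\<in>U. \<sigma> p (map (coord_vector A (U, c) p) us) = coord_vector A (U, c) p (w (c p)))) \<and>
     (\<forall>p vs. length vs \<noteq> k \<or> \<not> set vs \<subseteq> tangent_space A p \<longrightarrow> \<sigma> p vs = 0)}"

text \<open>The section \<open>\<sigma>\<close> of \<open>End TM\<close> with \<open>\<sigma>(Z) = S(Z)\<close> for all vector fields \<open>Z\<close>; it exists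
  when \<open>S\<close> is linear over the smooth functions.\<close>

definition endo_of ::
    "('m, 'e::euclidean_space) chart set \<Rightarrow> ('m vfield \<Rightarrow> 'm vfield) \<Rightarrow> 'm vtensor" where
  "endo_of A S = (THE \<sigma>. \<sigma> \<in> sym_vtensors A 1 \<and>
     (\<forall>Z\<in>vector_fields A. tensor_eval \<sigma> [Z] = S Z))"

section \<open>Connections\<close>

type_synonym 'm connection = "'m vfield \<Rightarrow> 'm vfield \<Rightarrow> 'm vfield"

definition is_connection ::
    "('m, 'e::euclidean_space) chart set \<Rightarrow> 'm connection \<Rightarrow> bool" where
  "is_connection A D \<longleftrightarrow>
     (\<forall>X\<in>vector_fields A. \<forall>Y\<in>vector_fields A. D X Y \<in> vector_fields A) \<and>
     (\<forall>X\<in>vector_fields A. \<forall>Y\<in>vector_fields A. \<forall>Z\<in>vector_fields A.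
        D (X + Y) Z = D X Z + D Y Z \<and> D X (Y + Z) = D X Y + D X Z) \<and>
     (\<forall>f\<in>smooth_functions A. \<forall>X\<in>vector_fields A. \<forall>Y\<in>vector_fields A.
        D (vf_scale f X) Y = vf_scale f (D X Y) \<and>
        D X (vf_scale f Y) = vf_scale (vf_apply X f) Y + vf_scale f (D X Y))"

definition torsion_free ::
    "('m, 'e::euclidean_space) chart set \<Rightarrow> 'm connection \<Rightarrow> bool" where
  "torsion_free A D \<longleftrightarrow>
     (\<forall>X\<in>vector_fields A. \<forall>Y\<in>vector_fields A. D X Y - D Y X - lie_bracket A X Y = 0)"

definition curvature ::
    "('m, 'e::euclidean_space) chart set \<Rightarrow> 'm connection \<Rightarrow> 'm vfield \<Rightarrow> 'm vfield \<Rightarrow> 'm vtensor"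
  where "curvature A D X Y =
     endo_of A (\<lambda>Z. D X (D Y Z) - D Y (D X Z) - D (lie_bracket A X Y) Z)"

text \<open>\<open>nabla_nabla A D X Y\<close> is the endomorphism \<open>\<nabla>\<^bsub>\<nabla>X\<^esub>Y\<close>.\<close>

definition nabla_nabla ::
    "('m, 'e::euclidean_space) chart set \<Rightarrow> 'm connection \<Rightarrow> 'm vfield \<Rightarrow> 'm vfield \<Rightarrow> 'm vtensor"
  where "nabla_nabla A D X Y = endo_of A (\<lambda>Z. D (D Z X) Y)"

text \<open>The extension of a connection to symmetric tensor fields:
  \<open>(\<nabla>\<^sub>X\<Phi>)(Y\<^sub>1, \<dots>, Y\<^sub>r) = X(\<Phi>(Y\<^sub>1, \<dots>, Y\<^sub>r)) - \<Sum>\<^sub>j \<Phi>(Y\<^sub>1, \<dots>, \<nabla>\<^sub>XY\<^sub>j, \<dots>, Y\<^sub>r)\<close>.\<close>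

definition cov_deriv ::
    "('m, 'e::euclidean_space) chart set \<Rightarrow> 'm connection \<Rightarrow> 'm vfield \<Rightarrow> 'm tensor \<Rightarrow> 'm tensor"
  where "cov_deriv A D X \<Phi> = tensor_of A (\<lambda>Ys.
     vf_apply X (tensor_eval \<Phi> Ys) -
     (\<Sum>j<length Ys. tensor_eval \<Phi> (Ys[j := D X (Ys ! j)])))"

section \<open>Operators on symmetric tensor fields\<close>

text \<open>On functions, i.e. in degree \<open>0\<close>, the formula below gives
  \<open>(\<nabla>\<^sup>s f)(X) = \<nabla>\<^sub>X f = X(f) = df(X)\<close>.\<close>

definition sym_deriv ::
    "('m, 'e::euclidean_space) chart set \<Rightarrow> 'm connection \<Rightarrow> 'm tensor \<Rightarrow> 'm tensor" where
  "sym_deriv A D \<Phi> = tensor_of A (\<lambda>Xs.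
     \<Sum>j<length Xs. tensor_eval (cov_deriv A D (Xs ! j) \<Phi>) (take j Xs @ drop (Suc j) Xs))"

definition contraction :: "'m vfield \<Rightarrow> 'm tensor \<Rightarrow> 'm tensor" where
  "contraction X \<Phi> = (\<lambda>p vs. \<Phi> p (X p # vs))"

definition commutator ::
    "('m tensor \<Rightarrow> 'm tensor) \<Rightarrow> ('m tensor \<Rightarrow> 'm tensor) \<Rightarrow> 'm tensor \<Rightarrow> 'm tensor" where
  "commutator P Q = (\<lambda>\<Phi>. P (Q \<Phi>) - Q (P \<Phi>))"

definition sym_lie ::
    "('m, 'e::euclidean_space) chart set \<Rightarrow> 'm connection \<Rightarrow> 'm vfield \<Rightarrow> 'm tensor \<Rightarrow> 'm tensor"
  where "sym_lie A D X = commutator (contraction X) (sym_deriv A D)"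

definition is_derivation ::
    "('m, 'e::euclidean_space) chart set \<Rightarrow> int \<Rightarrow> ('m tensor \<Rightarrow> 'm tensor) \<Rightarrow> bool" where
  "is_derivation A d P \<longleftrightarrow>
     (\<forall>r. \<forall>\<Phi>\<in>sym_tensors_deg A r. P \<Phi> \<in> sym_tensors_deg A (r + d)) \<and>
     (\<forall>\<Phi>\<in>sym_tensors A. \<forall>\<Psi>\<in>sym_tensors A. \<forall>a b.
        P (\<lambda>p vs. a * \<Phi> p vs + b * \<Psi> p vs) = (\<lambda>p vs. a * P \<Phi> p vs + b * P \<Psi> p vs)) \<and>
     (\<forall>\<Phi>\<in>sym_tensors A. \<forall>\<Psi>\<in>sym_tensors A. P (\<Phi> \<odot> \<Psi>) = P \<Phi> \<odot> \<Psi> + \<Phi> \<odot> P \<Psi>)"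

text \<open>The symmetric contraction with a section \<open>\<sigma>\<close> of \<open>Sym\<^sup>k T*M \<otimes> TM\<close>. Operators on \<open>\<Upsilon>\<^sup>\<bullet>(M)\<close>
  are taken to be \<^const>\<open>undefined\<close> outside it, which makes the derivation unique as a function.\<close>

definition sym_contraction ::
    "('m, 'e::euclidean_space) chart set \<Rightarrow> nat \<Rightarrow> 'm vtensor \<Rightarrow> 'm tensor \<Rightarrow> 'm tensor" where
  "sym_contraction A k \<sigma> = (THE P.
     P \<in> extensional (sym_tensors A) \<and>
     is_derivation A (int k - 1) P \<and>
     (\<forall>f\<in>sym_tensors_deg A 0. P f = 0) \<and>
     (\<forall>\<alpha>\<in>sym_tensors_deg A 1. \<forall>p. \<forall>vs\<in>lists (tangent_space A p).
        length vs = k \<longrightarrow> P \<alpha> p vs = \<alpha> p [\<sigma> p vs]))"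

end

theory Submission
  imports Defs
begin

text \<open>
  Write \<open>S\<^sub>X Z = \<nabla>\<^sub>XZ + \<nabla>\<^sub>ZX\<close> for the symmetric bracket. Evaluated on vector fields, the symmetric
  Lie derivative is
  \<open>(L\<^sup>s\<^sub>X\<Phi>)(Z\<^sub>1, \<dots>, Z\<^sub>r) = X(\<Phi>(Z\<^sub>1, \<dots>, Z\<^sub>r)) - \<Sum>\<^sub>j \<Phi>(Z\<^sub>1, \<dots>, S\<^sub>XZ\<^sub>j, \<dots>, Z\<^sub>r)\<close>
  (\<open>sym_lie\<close>). In the commutator of two such operators the terms in which \<open>S\<^sub>X\<close> and \<open>S\<^sub>Y\<close> act on
  different arguments cancel, and \<open>[X, Y](\<Phi>(Z\<^sub>1, \<dots>)) - \<Sum>\<^sub>j \<Phi>(\<dots>, [S\<^sub>X, S\<^sub>Y]Z\<^sub>j, \<dots>)\<close> remains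
  (\<open>induced_derivation_commutator\<close>). It differs from \<open>L\<^sup>s\<^bsub>[X, Y]\<^esub>\<Phi>\<close> by the insertion of
  \<open>S\<^bsub>[X, Y]\<^esub> - [S\<^sub>X, S\<^sub>Y]\<close> into the arguments. As \<open>[X, Y] = \<nabla>\<^sub>XY - \<nabla>\<^sub>YX\<close>, the Jacobi identity turns
  this into \<open>2(\<nabla>\<^bsub>\<nabla>X\<^esub>Y - \<nabla>\<^bsub>\<nabla>Y\<^esub>X - R(X, Y))\<close> (\<open>symmetric_bracket_commutator\<close>).

  The larger part of the work concerns the objects in this computation, which are given by
  descriptions: a tensor field or an endomorphism field by its values on vector fields, the
  symmetric contraction as a derivation with prescribed values on functions and one-forms. Bump
  functions and local frames show that a map which is linear over the smooth functions depends at
  a point only on the values of its arguments there (\<open>function_linear_pointwise\<close>); hence it comes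
  from a unique tensor field (\<open>tensor_of\<close>) or endomorphism field (\<open>endo_of\<close>). The insertion of an
  endomorphism into the arguments obeys the Leibniz rule (\<open>insertion_sym_product\<close>). It is the only
  derivation with its values on functions and one-forms (\<open>derivation_unique\<close>), because locally
  a tensor of degree \<open>N > 0\<close> is \<open>1/N\<close> times a sum of products of differentials with tensors of
  degree \<open>N - 1\<close> (\<open>euler_identity\<close>). So the insertion is the symmetric contraction
  (\<open>sym_contraction_endomorphism\<close>).
\<close>

section \<open>Smooth functions between Euclidean spaces\<close>

abbreviation (input) "Ck_on \<equiv> higher_differentiable_on"

lemma Ck_on_cong:
  assumes "open S" "\<And>x. x \<in> S \<Longrightarrow> f x = g x" "Ck_on S f n"
  shows "Ck_on S g n"
  using assms(2,3)
proof (induction n arbitrary: f g)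
  case 0
  then show ?case by (simp cong: continuous_on_cong)
next
  case (Suc n)
  have d: "g differentiable (at x) \<and> frechet_derivative f (at x) = frechet_derivative g (at x)"
    if "x \<in> S" for x
  proof -
    have "(f has_derivative frechet_derivative f (at x)) (at x)"
      using Suc.prems(2) that by (auto simp: frechet_derivative_works)
    then have "(g has_derivative frechet_derivative f (at x)) (at x)"
      by (rule has_derivative_transform_within_open[OF _ assms(1) that]) (simp add: Suc.prems)
    then show ?thesis
      by (metis differentiable_def frechet_derivative_at)
  qed
  have "Ck_on S (\<lambda>x. frechet_derivative g (at x) v) n" for v
    by (rule Suc.IH[of "\<lambda>x. frechet_derivative f (at x) v"]) (use d Suc.prems(2) in auto)
  with d show ?case by simp
qed

lemma Ck_on_SucD:
  "Ck_on S f (Suc n) \<Longrightarrow> Ck_on S f n"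
proof (induction n arbitrary: f)
  case 0
  then show ?case
    by (auto simp: differentiable_imp_continuous_within intro!: continuous_at_imp_continuous_on)
next
  case (Suc n)
  then show ?case by (metis higher_differentiable_on.simps(2))
qed

lemma Ck_on_subset:
  "Ck_on S f n \<Longrightarrow> T \<subseteq> S \<Longrightarrow> Ck_on T f n"
  by (induction n arbitrary: f) (auto intro: continuous_on_subset)

lemma Ck_on_local:
  assumes "\<And>x. x \<in> S \<Longrightarrow> \<exists>T. open T \<and> x \<in> T \<and> Ck_on T f n"
  shows "Ck_on S f n"
  using assms
proof (induction n arbitrary: f)
  case 0
  show ?case
    unfolding higher_differentiable_on.simps
  proof (rule continuous_at_imp_continuous_on, rule ballI)
    fix x assume "x \<in> S"
    from 0[OF this] obtain T where "open T" "x \<in> T" "continuous_on T f" by auto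
    then show "isCont f x" by (simp add: continuous_on_eq_continuous_at)
  qed
next
  case (Suc n)
  have "f differentiable (at x)" if "x \<in> S" for x
    using Suc.prems[OF that] by auto
  moreover have "Ck_on S (\<lambda>x. frechet_derivative f (at x) v) n" for v
  proof (rule Suc.IH)
    fix x assume "x \<in> S"
    from Suc.prems[OF this]
    show "\<exists>T. open T \<and> x \<in> T \<and> Ck_on T (\<lambda>x. frechet_derivative f (at x) v) n"
      by auto
  qed
  ultimately show ?case by simp
qed

lemma Ck_on_const: "Ck_on S (\<lambda>x. k) n"
  by (induction n arbitrary: k) auto

lemma Ck_on_linear:
  assumes "bounded_linear f"
  shows "Ck_on S f n"
proof (cases n)
  case 0
  then show ?thesis by (simp add: linear_continuous_on assms)
next
  case (Suc m)
  have "(f has_derivative f) (at x)" for x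
    using assms by (rule bounded_linear_imp_has_derivative)
  then have "frechet_derivative f (at x) = f" "f differentiable (at x)" for x
    by (auto simp: frechet_derivative_at[symmetric] differentiable_def)
  then show ?thesis
    unfolding Suc by (simp add: Ck_on_const)
qed

lemma Ck_on_add:
  assumes "open S" "Ck_on S f n" "Ck_on S g n"
  shows "Ck_on S (\<lambda>x. f x + g x) n"
  using assms(2,3)
proof (induction n arbitrary: f g)
  case 0
  then show ?case by (auto intro: continuous_on_add)
next
  case (Suc n)
  have "frechet_derivative (\<lambda>x. f x + g x) (at x) =
      (\<lambda>v. frechet_derivative f (at x) v + frechet_derivative g (at x) v)" if "x \<in> S" for x
    using Suc.prems that
    by (intro frechet_derivative_at[symmetric] has_derivative_add)
      (auto simp: frechet_derivative_works[symmetric])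
  moreover have "Ck_on S
      (\<lambda>x. frechet_derivative f (at x) v + frechet_derivative g (at x) v) n" for v
    using Suc by auto
  ultimately have "Ck_on S (\<lambda>x. frechet_derivative (\<lambda>x. f x + g x) (at x) v) n" for v
    by - (rule Ck_on_cong[OF \<open>open S\<close>, rotated], assumption, simp)
  with Suc.prems show ?case by auto
qed

lemma Ck_on_sum:
  assumes "open S" "\<And>i. i \<in> I \<Longrightarrow> Ck_on S (f i) n"
  shows "Ck_on S (\<lambda>x. \<Sum>i\<in>I. f i x) n"
  using assms(2)
  by (induction I rule: infinite_finite_induct)
    (auto simp: Ck_on_const Ck_on_add[OF \<open>open S\<close>])

lemma Ck_on_bilinear:
  assumes "open S" "bounded_bilinear bop"
    "Ck_on S f n" "Ck_on S g n"
  shows "Ck_on S (\<lambda>x. bop (f x) (g x)) n"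
  using assms(3,4)
proof (induction n arbitrary: f g)
  case 0
  then show ?case using bounded_bilinear.continuous_on[OF assms(2)] by auto
next
  case (Suc n)
  have hd: "((\<lambda>x. bop (f x) (g x)) has_derivative
      (\<lambda>v. bop (f x) (frechet_derivative g (at x) v) + bop (frechet_derivative f (at x) v) (g x))) (at x)"
    if "x \<in> S" for x
    using Suc.prems that
    by (intro bounded_bilinear.FDERIV[OF assms(2)]) (auto simp: frechet_derivative_works[symmetric])
  have "Ck_on S
      (\<lambda>x. bop (f x) (frechet_derivative g (at x) v) + bop (frechet_derivative f (at x) v) (g x)) n" for v
    using Suc.prems(1)[THEN Ck_on_SucD] Suc.prems(2)[THEN Ck_on_SucD]
      Suc.prems
    by (intro Ck_on_add[OF \<open>open S\<close>] Suc.IH) auto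
  then have "Ck_on S
      (\<lambda>x. frechet_derivative (\<lambda>x. bop (f x) (g x)) (at x) v) n" for v
    by (rule Ck_on_cong[OF \<open>open S\<close>, rotated])
      (simp add: frechet_derivative_at[OF hd, symmetric])
  moreover have "(\<lambda>x. bop (f x) (g x)) differentiable (at x)" if "x \<in> S" for x
    using hd[OF that] by (auto simp: differentiable_def)
  ultimately show ?case by simp
qed

lemma frechet_derivative_basis_sum:
  fixes f :: "'a::euclidean_space \<Rightarrow> 'b::real_normed_vector"
  assumes "f differentiable (at x)"
  shows "frechet_derivative f (at x) v = (\<Sum>b\<in>Basis. (v \<bullet> b) *\<^sub>R frechet_derivative f (at x) b)"
proof -
  have l: "linear (frechet_derivative f (at x))"
    using assms linear_frechet_derivative by blast
  have "frechet_derivative f (at x) v = frechet_derivative f (at x) (\<Sum>b\<in>Basis. (v \<bullet> b) *\<^sub>R b)"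
    by (simp add: euclidean_representation)
  also have "\<dots> = (\<Sum>b\<in>Basis. (v \<bullet> b) *\<^sub>R frechet_derivative f (at x) b)"
    by (simp add: linear_sum[OF l] linear_cmul[OF l])
  finally show ?thesis .
qed

text \<open>In finite dimension the chain rule reads
  \<open>D(f \<circ> g)(v) = \<Sum>\<^sub>b \<langle>Dg(v), b\<rangle> D\<^sub>bf \<circ> g\<close>, a sum of products of functions that are differentiable
  once less, so that the induction on the order goes through.\<close>

lemma Ck_on_compose:
  fixes f :: "'a::euclidean_space \<Rightarrow> 'b::real_normed_vector"
    and g :: "'c::real_normed_vector \<Rightarrow> 'a"
  assumes "open S" "open T" "g ` S \<subseteq> T"
    "Ck_on T f n" "Ck_on S g n"
  shows "Ck_on S (\<lambda>x. f (g x)) n"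
  using assms(4,5)
proof (induction n arbitrary: f)
  case 0
  then show ?case using assms(3) by (auto intro: continuous_on_compose2)
next
  case (Suc n)
  have fd: "f differentiable (at (g x))" if "x \<in> S" for x using Suc.prems assms(3) that by auto
  have hd: "((\<lambda>x. f (g x)) has_derivative
      (\<lambda>v. frechet_derivative f (at (g x)) (frechet_derivative g (at x) v))) (at x)"
    if "x \<in> S" for x
  proof -
    have "(f \<circ> g has_derivative (frechet_derivative f (at (g x)) \<circ> frechet_derivative g (at x))) (at x)"
      using Suc.prems that fd[OF that]
      by (intro diff_chain_at) (auto simp: frechet_derivative_works[symmetric])
    then show ?thesis by (simp add: o_def)
  qed
  have "Ck_on S
     (\<lambda>x. \<Sum>b\<in>Basis. (frechet_derivative g (at x) v \<bullet> b) *\<^sub>R frechet_derivative f (at (g x)) b) n" for v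
  proof (intro Ck_on_sum[OF \<open>open S\<close>]
      Ck_on_bilinear[OF \<open>open S\<close> bounded_bilinear_scaleR]
      Ck_on_bilinear[OF \<open>open S\<close> bounded_bilinear_inner]
      Ck_on_const)
    show "Ck_on S (\<lambda>x. frechet_derivative g (at x) v) n"
      using Suc.prems by simp
    show "Ck_on S (\<lambda>x. frechet_derivative f (at (g x)) b) n" for b
      using Suc.prems by (intro Suc.IH[of "\<lambda>y. frechet_derivative f (at y) b"])
       (auto intro: Ck_on_SucD)
  qed
  then have "Ck_on S (\<lambda>x. frechet_derivative (\<lambda>x. f (g x)) (at x) v) n" for v
    by (rule Ck_on_cong[OF \<open>open S\<close>, rotated])
      (simp add: frechet_derivative_at[OF hd, symmetric] frechet_derivative_basis_sum[OF fd, symmetric])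
  moreover have "(\<lambda>x. f (g x)) differentiable (at x)" if "x \<in> S" for x
    using hd[OF that] by (auto simp: differentiable_def)
  ultimately show ?case by simp
qed

lemma smooth_on_cong:
  "open S \<Longrightarrow> (\<And>x. x \<in> S \<Longrightarrow> f x = g x) \<Longrightarrow> smooth_on S f \<Longrightarrow> smooth_on S g"
  using Ck_on_cong unfolding smooth_on_def by metis

lemma smooth_on_subset: "smooth_on S f \<Longrightarrow> T \<subseteq> S \<Longrightarrow> smooth_on T f"
  using Ck_on_subset unfolding smooth_on_def by metis

lemma smooth_on_local:
  assumes "\<And>x. x \<in> S \<Longrightarrow> \<exists>T g. open T \<and> x \<in> T \<and> smooth_on T g \<and> (\<forall>y\<in>T. f y = g y)"
  shows "smooth_on S f"
  unfolding smooth_on_def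
proof (intro allI Ck_on_local)
  fix n x assume "x \<in> S"
  from assms[OF this] obtain T g where "open T" "x \<in> T" "smooth_on T g" "\<forall>y\<in>T. f y = g y"
    by blast
  moreover then have "Ck_on T f n"
    using Ck_on_cong[of T g f n] by (simp add: smooth_on_def)
  ultimately show "\<exists>T. open T \<and> x \<in> T \<and> Ck_on T f n" by blast
qed

lemma smooth_on_const: "smooth_on S (\<lambda>x. k)"
  by (simp add: smooth_on_def Ck_on_const)

lemma smooth_on_linear: "bounded_linear f \<Longrightarrow> smooth_on S f"
  by (simp add: smooth_on_def Ck_on_linear)

lemma smooth_on_add:
  "open S \<Longrightarrow> smooth_on S f \<Longrightarrow> smooth_on S g \<Longrightarrow> smooth_on S (\<lambda>x. f x + g x)"
  by (simp add: smooth_on_def Ck_on_add)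

lemma smooth_on_sum:
  "open S \<Longrightarrow> (\<And>i. i \<in> I \<Longrightarrow> smooth_on S (f i)) \<Longrightarrow> smooth_on S (\<lambda>x. \<Sum>i\<in>I. f i x)"
  by (simp add: smooth_on_def Ck_on_sum)

lemma smooth_on_scaleR:
  "open S \<Longrightarrow> smooth_on S f \<Longrightarrow> smooth_on S g \<Longrightarrow> smooth_on S (\<lambda>x. f x *\<^sub>R g x)"
  by (simp add: smooth_on_def Ck_on_bilinear bounded_bilinear_scaleR)

lemma smooth_on_mult:
  fixes f g :: "'a::real_normed_vector \<Rightarrow> real"
  shows "open S \<Longrightarrow> smooth_on S f \<Longrightarrow> smooth_on S g \<Longrightarrow> smooth_on S (\<lambda>x. f x * g x)"
  by (simp add: smooth_on_def Ck_on_bilinear bounded_bilinear_mult)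

lemma smooth_on_inner:
  "open S \<Longrightarrow> smooth_on S f \<Longrightarrow> smooth_on S g \<Longrightarrow> smooth_on S (\<lambda>x. f x \<bullet> g x)"
  by (simp add: smooth_on_def Ck_on_bilinear bounded_bilinear_inner)

lemma smooth_on_compose:
  fixes f :: "'a::euclidean_space \<Rightarrow> 'b::real_normed_vector"
  shows "open S \<Longrightarrow> open T \<Longrightarrow> g ` S \<subseteq> T \<Longrightarrow> smooth_on T f \<Longrightarrow> smooth_on S g \<Longrightarrow>
    smooth_on S (\<lambda>x. f (g x))"
  by (simp add: smooth_on_def Ck_on_compose)

lemma smooth_on_differentiable: "smooth_on S f \<Longrightarrow> x \<in> S \<Longrightarrow> f differentiable (at x)"
  unfolding smooth_on_def by (metis higher_differentiable_on.simps(2))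

lemma smooth_on_frechet_derivative:
  fixes f :: "'a::euclidean_space \<Rightarrow> 'b::real_normed_vector"
  assumes "open S" "smooth_on S f" "smooth_on S u"
  shows "smooth_on S (\<lambda>x. frechet_derivative f (at x) (u x))"
proof (rule smooth_on_cong[OF assms(1)])
  show "smooth_on S (\<lambda>x. \<Sum>b\<in>Basis. (u x \<bullet> b) *\<^sub>R frechet_derivative f (at x) b)"
  proof (intro smooth_on_sum smooth_on_scaleR smooth_on_inner smooth_on_const assms)
    show "smooth_on S (\<lambda>x. frechet_derivative f (at x) b)" for b
      using assms(2) unfolding smooth_on_def by (metis higher_differentiable_on.simps(2))
  qed
  show "(\<Sum>b\<in>Basis. (u x \<bullet> b) *\<^sub>R frechet_derivative f (at x) b) = frechet_derivative f (at x) (u x)"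
    if "x \<in> S" for x
    using frechet_derivative_basis_sum[OF smooth_on_differentiable[OF assms(2) that]] by metis
qed

lemma Ck_on_real:
  fixes f f' :: "real \<Rightarrow> real"
  assumes "\<And>x. (f has_real_derivative f' x) (at x)" "Ck_on UNIV f' n"
  shows "Ck_on UNIV f (Suc n)"
proof -
  have d: "(f has_derivative (\<lambda>v. f' x * v)) (at x)" for x
    using assms(1) by (simp add: has_field_derivative_def)
  then have "frechet_derivative f (at x) v = f' x * v" for x v
    by (metis frechet_derivative_at)
  moreover have "Ck_on UNIV (\<lambda>x. f' x * v) n" for v
    by (rule Ck_on_bilinear[OF open_UNIV bounded_bilinear_mult assms(2)
          Ck_on_const])
  moreover have "f differentiable (at x)" for x
    using d unfolding differentiable_def by blast
  ultimately show ?thesis by simp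
qed

text \<open>\<open>poly_flat [:1:]\<close> is the flat function \<open>exp (- 1 / t)\<close>, continued by \<open>0\<close> to \<open>t \<le> 0\<close>. The class
  of all \<open>poly_flat P\<close> is closed under differentiation, which makes its members smooth.\<close>

definition poly_flat :: "real poly \<Rightarrow> real \<Rightarrow> real" where
  "poly_flat P t = (if t > 0 then poly P (1 / t) * exp (- (1 / t)) else 0)"

lemma poly_exp_tendsto_0: "((\<lambda>x::real. poly P x * exp (- x)) \<longlongrightarrow> 0) at_top"
proof -
  have m: "((\<lambda>x::real. x ^ k * exp (- x)) \<longlongrightarrow> 0) at_top" for k
    using tendsto_power_div_exp_0[of k] by (simp add: exp_minus field_simps)
  have "((\<lambda>x::real. \<Sum>i\<le>degree P. coeff P i * (x ^ i * exp (- x))) \<longlongrightarrow> (\<Sum>i\<le>degree P. coeff P i * 0)) at_top"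
    by (intro tendsto_sum tendsto_mult m tendsto_const)
  then show ?thesis by (simp add: poly_altdef sum_distrib_right mult.assoc)
qed

lemma poly_flat_has_derivative:
  "(poly_flat P has_real_derivative poly_flat ([:0, 0, 1:] * (P - pderiv P)) t) (at t)"
proof (cases t "0::real" rule: linorder_cases)
  case less
  have "(poly_flat P has_real_derivative 0) (at t)"
    by (rule has_field_derivative_transform_within_open[of "\<lambda>_. 0" _ _ "{..<0}"])
      (use less in \<open>auto simp: poly_flat_def\<close>)
  then show ?thesis using less by (simp add: poly_flat_def)
next
  case greater
  have "((\<lambda>t. poly P (1 / t) * exp (- (1 / t))) has_real_derivative
      poly ([:0, 0, 1:] * (P - pderiv P)) (1 / t) * exp (- (1 / t))) (at t)"
  proof -
    have d: "((\<lambda>t. 1 / t) has_real_derivative - (1 / t * (1 / t))) (at t)"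
      using greater by (auto intro!: derivative_eq_intros)
    have e: "((\<lambda>t. exp (- (1 / t))) has_real_derivative exp (- (1 / t)) * (1 / t * (1 / t))) (at t)"
      using DERIV_chain2[OF DERIV_exp DERIV_minus[OF d]] by simp
    from DERIV_mult[OF DERIV_chain2[OF poly_DERIV d] e] show ?thesis
      by (rule DERIV_cong) (simp add: algebra_simps)
  qed
  then have "(poly_flat P has_real_derivative
      poly ([:0, 0, 1:] * (P - pderiv P)) (1 / t) * exp (- (1 / t))) (at t)"
    by (rule has_field_derivative_transform_within_open[of _ _ _ "{0<..}"])
      (use greater in \<open>auto simp: poly_flat_def\<close>)
  then show ?thesis using greater by (simp add: poly_flat_def)
next
  case equal
  have "((\<lambda>h. poly_flat P h / h) \<longlongrightarrow> 0) (at 0)"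
  proof (rule filterlim_split_at_real)
    show "((\<lambda>h. poly_flat P h / h) \<longlongrightarrow> 0) (at_left 0)"
      by (rule tendsto_eventually) (auto simp: eventually_at_filter poly_flat_def)
    have "((\<lambda>h. poly ([:0, 1:] * P) (inverse h) * exp (- inverse h)) \<longlongrightarrow> 0) (at_right 0)"
      using poly_exp_tendsto_0 filterlim_inverse_at_top_right by (rule filterlim_compose)
    then show "((\<lambda>h. poly_flat P h / h) \<longlongrightarrow> 0) (at_right 0)"
      by (rule Lim_transform_eventually)
        (auto simp: eventually_at_filter poly_flat_def field_simps)
  qed
  then show ?thesis
    using equal by (simp add: has_field_derivative_iff poly_flat_def)
qed

lemma smooth_poly_flat: "smooth_on UNIV (poly_flat P)"
proof -
  have "Ck_on UNIV (poly_flat P) n" for n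
  proof (induction n arbitrary: P)
    case 0
    have "isCont (poly_flat P) t" for t
      using poly_flat_has_derivative DERIV_isCont by blast
    then show ?case by (simp add: continuous_on_eq_continuous_at)
  next
    case (Suc n)
    show ?case using poly_flat_has_derivative Suc by (rule Ck_on_real)
  qed
  then show ?thesis by (simp add: smooth_on_def)
qed

text \<open>With the flat function \<open>h\<close>, the function \<open>t \<mapsto> h (h 1 - h t)\<close> is a positive constant
  for \<open>t \<le> 0\<close> and vanishes for \<open>t \<ge> 1\<close>, because \<open>h\<close> increases and vanishes for \<open>t \<le> 0\<close>.\<close>

lemma smooth_step:
  obtains s :: "real \<Rightarrow> real" where "smooth_on UNIV s" "\<And>t. t \<le> 0 \<Longrightarrow> s t = 1" "\<And>t. t \<ge> 1 \<Longrightarrow> s t = 0"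
proof -
  define h where "h = poly_flat [:1:]"
  have h: "h t = (if t > 0 then exp (- (1 / t)) else 0)" for t
    unfolding h_def poly_flat_def by simp
  have sm: "smooth_on UNIV h" unfolding h_def by (rule smooth_poly_flat)
  have pos: "h (h 1) > 0" by (simp add: h)
  have mono: "h 1 \<le> h t" if "t \<ge> 1" for t
    using that by (auto simp: h divide_simps)
  have "smooth_on UNIV (\<lambda>t. h 1 + (-1) * h t)"
    by (intro smooth_on_add smooth_on_mult smooth_on_const sm) auto
  then have "smooth_on UNIV (\<lambda>t. h (h 1 + (-1) * h t))"
    by (intro smooth_on_compose[OF _ _ _ sm]) auto
  then have "smooth_on UNIV (\<lambda>t. inverse (h (h 1)) * h (h 1 + (-1) * h t))"
    by (intro smooth_on_mult smooth_on_const) auto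
  moreover have "inverse (h (h 1)) * h (h 1 + (-1) * h t) = 1" if "t \<le> 0" for t
    using that pos by (simp add: h[of t])
  moreover have "inverse (h (h 1)) * h (h 1 + (-1) * h t) = 0" if "t \<ge> 1" for t
  proof -
    have "h 1 + (-1) * h t \<le> 0" using mono[OF that] by simp
    then have "h (h 1 + (-1) * h t) = 0" unfolding h[of "h 1 + (-1) * h t"] by simp
    then show ?thesis by simp
  qed
  ultimately show thesis by (rule that)
qed

lemma euclidean_bump:
  fixes a :: "'a::euclidean_space"
  assumes "r > 0"
  obtains b :: "'a \<Rightarrow> real" where "smooth_on UNIV b" "\<And>x. x \<in> ball a r \<Longrightarrow> b x = 1"
    "\<And>x. x \<notin> ball a (2 * r) \<Longrightarrow> b x = 0"
proof -
  obtain s :: "real \<Rightarrow> real" where s: "smooth_on UNIV s" "\<And>t. t \<le> 0 \<Longrightarrow> s t = 1" "\<And>t. t \<ge> 1 \<Longrightarrow> s t = 0"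
    by (rule smooth_step) blast
  \<comment> \<open>\<open>q \<le> 0\<close> on the ball of radius \<open>r\<close> and \<open>q \<ge> 3\<close> outside the ball of radius \<open>2 * r\<close>\<close>
  define q where "q x = inverse (r\<^sup>2) * ((x + (- a)) \<bullet> (x + (- a))) + (- 1)" for x
  have q: "q x = (dist a x / r)\<^sup>2 - 1" for x
    by (simp add: q_def dist_norm norm_minus_commute[of x] power2_norm_eq_inner[symmetric] divide_simps)
  have "smooth_on UNIV q"
    unfolding q_def
    by (intro smooth_on_add smooth_on_mult smooth_on_inner smooth_on_const
        smooth_on_linear[OF bounded_linear_ident]) auto
  then have "smooth_on UNIV (\<lambda>x. s (q x))"
    by (intro smooth_on_compose[OF _ _ _ s(1)]) auto
  moreover have "s (q x) = 1" if "x \<in> ball a r" for x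
  proof -
    have "(dist a x / r)\<^sup>2 \<le> 1" using that assms by (intro power_le_one) auto
    then show ?thesis by (intro s) (simp add: q)
  qed
  moreover have "s (q x) = 0" if "x \<notin> ball a (2 * r)" for x
  proof -
    have "2 \<le> dist a x / r" using that assms by (simp add: field_simps)
    from power_mono[OF this, of 2] show ?thesis by (intro s) (simp add: q)
  qed
  ultimately show ?thesis using that by blast
qed

section \<open>Charts, bump functions and local frames\<close>

context smooth_manifold
begin

abbreviation (input) "\<XX> \<equiv> vector_fields A"
abbreviation (input) "\<F> \<equiv> smooth_functions A"
abbreviation (input) "\<T> \<equiv> tangent_space A"
abbreviation (input) "coord U c \<equiv> coord_vector A (U, c)"

lemma open_chart: "(U, c) \<in> A \<Longrightarrow> open U" "(U, c) \<in> A \<Longrightarrow> open (c ` U)"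
  using charts by auto

lemma chart_inv_left: "(U, c) \<in> A \<Longrightarrow> p \<in> U \<Longrightarrow> chart_inv (U, c) (c p) = p"
  using charts[of U c] by (auto simp: homeomorphism_def)

lemma chart_inv_right: "(U, c) \<in> A \<Longrightarrow> x \<in> c ` U \<Longrightarrow> c (chart_inv (U, c) x) = x"
  using charts[of U c] by (auto simp: homeomorphism_def)

lemma chart_inv_in: "(U, c) \<in> A \<Longrightarrow> x \<in> c ` U \<Longrightarrow> chart_inv (U, c) x \<in> U"
  using charts[of U c] by (auto simp: homeomorphism_def)

lemma continuous_chart: "(U, c) \<in> A \<Longrightarrow> continuous_on U c"
  using charts[of U c] by (auto simp: homeomorphism_def)

lemma continuous_chart_inv: "(U, c) \<in> A \<Longrightarrow> continuous_on (c ` U) (chart_inv (U, c))"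
  using charts[of U c] by (auto simp: homeomorphism_def)

lemma open_chart_image:
  assumes "(U, c) \<in> A" "open N"
  shows "open (c ` (U \<inter> N))"
proof -
  have "c ` (U \<inter> N) = c ` U \<inter> chart_inv (U, c) -` N"
    using assms(1) by (auto simp: chart_inv_left)
  then show ?thesis
    using continuous_open_preimage[OF continuous_chart_inv open_chart(2) assms(2)] assms(1) by simp
qed

lemma open_chart_preimage:
  assumes "(U, c) \<in> A" "open B"
  shows "open (U \<inter> c -` B)"
  using continuous_open_preimage[OF continuous_chart open_chart(1) assms(2)] assms(1) by blast

lemma ex_chart:
  obtains U c where "(U, c) \<in> A" "p \<in> U"
  using cover by (metis (mono_tags, lifting) UNIV_I UN_E case_prod_unfold prod.collapse)

lemma smooth_functionsD:
  "f \<in> \<F> \<Longrightarrow> (U, c) \<in> A \<Longrightarrow> smooth_on (c ` U) (\<lambda>x. f (chart_inv (U, c) x))"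
  by (auto simp: smooth_functions_def o_def)

lemma smooth_functionsI:
  "(\<And>U c. (U, c) \<in> A \<Longrightarrow> smooth_on (c ` U) (\<lambda>x. f (chart_inv (U, c) x))) \<Longrightarrow> f \<in> \<F>"
  by (auto simp: smooth_functions_def o_def)

lemma smooth_functions_const: "(\<lambda>p. k) \<in> \<F>"
  by (rule smooth_functionsI) (rule smooth_on_const)

lemma smooth_functions_add:
  "f \<in> \<F> \<Longrightarrow> g \<in> \<F> \<Longrightarrow> (\<lambda>p. f p + g p) \<in> \<F>"
  by (rule smooth_functionsI, rule smooth_on_add) (simp_all add: open_chart smooth_functionsD)

lemma smooth_functions_mult:
  "f \<in> \<F> \<Longrightarrow> g \<in> \<F> \<Longrightarrow> (\<lambda>p. f p * g p) \<in> \<F>"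
  by (rule smooth_functionsI, rule smooth_on_mult) (simp_all add: open_chart smooth_functionsD)

lemma smooth_functions_diff:
  "f \<in> \<F> \<Longrightarrow> g \<in> \<F> \<Longrightarrow> (\<lambda>p. f p - g p) \<in> \<F>"
  using smooth_functions_add[OF _ smooth_functions_mult[OF smooth_functions_const[of "-1"]], of f g] by simp

lemma smooth_functions_sum:
  "(\<And>i. i \<in> I \<Longrightarrow> f i \<in> \<F>) \<Longrightarrow> (\<lambda>p. \<Sum>i\<in>I. f i p) \<in> \<F>"
  by (induction I rule: infinite_finite_induct)
    (auto simp: smooth_functions_const intro: smooth_functions_add)

lemma smooth_transition:
  assumes "(U, c) \<in> A" "(V, d) \<in> A"
  shows "smooth_on (c ` (U \<inter> V)) (\<lambda>x. d (chart_inv (U, c) x))"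
  using compatible[OF assms] by (simp add: o_def)

text \<open>A point of \<open>d ` V\<close> lies in the open set \<open>d ` (V \<inter> U)\<close>, where \<open>g\<close> is smooth, or in the
  open set \<open>d ` (V - K)\<close>, where \<open>g\<close> vanishes.\<close>

lemma smooth_on_extend_by_zero:
  fixes g :: "'e \<Rightarrow> 'b::real_normed_vector"
  assumes "(U, c) \<in> A" "(V, d) \<in> A" "closed K" "K \<subseteq> U"
    and "smooth_on (d ` (V \<inter> U)) g"
    and "\<And>p. p \<in> V - K \<Longrightarrow> g (d p) = 0"
  shows "smooth_on (d ` V) g"
proof (rule smooth_on_local)
  fix x assume x: "x \<in> d ` V"
  show "\<exists>T h. open T \<and> x \<in> T \<and> smooth_on T h \<and> (\<forall>y\<in>T. g y = h y)"
  proof (cases "x \<in> d ` (V \<inter> U)")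
    case True
    then show ?thesis using assms open_chart_image[of V d U] open_chart by blast
  next
    case False
    then have "x \<in> d ` (V \<inter> - K)" using x assms(4) by auto
    moreover have "open (d ` (V \<inter> - K))"
      using assms open_chart_image[of V d "- K"] by auto
    moreover have "g y = 0" if "y \<in> d ` (V \<inter> - K)" for y
      using that assms(6) by auto
    ultimately show ?thesis using smooth_on_const[of "d ` (V \<inter> - K)" 0] by blast
  qed
qed

lemma smooth_function_extend:
  assumes "(U, c) \<in> A" "smooth_on (c ` U) g" "closed K" "K \<subseteq> U" "\<And>p. p \<in> U - K \<Longrightarrow> g (c p) = 0"
  shows "(\<lambda>p. if p \<in> U then g (c p) else 0) \<in> \<F>"
proof (rule smooth_functionsI)
  fix V d assume V: "(V, d) \<in> A"
  let ?f = "\<lambda>x. if chart_inv (V, d) x \<in> U then g (c (chart_inv (V, d) x)) else 0"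
  have o: "open (d ` (V \<inter> U))"
    using open_chart_image V open_chart assms by blast
  show "smooth_on (d ` V) ?f"
  proof (rule smooth_on_extend_by_zero[OF assms(1) V assms(3,4)])
    have "smooth_on (d ` (V \<inter> U)) (\<lambda>x. g (c (chart_inv (V, d) x)))"
      by (rule smooth_on_compose[OF o open_chart(2)[OF assms(1)] _ assms(2)])
        (use smooth_transition[OF V assms(1)] in \<open>auto simp: chart_inv_left[OF V]\<close>)
    then show "smooth_on (d ` (V \<inter> U)) ?f"
      by (rule smooth_on_cong[OF o, rotated]) (auto simp: chart_inv_left[OF V])
    show "?f (d p) = 0" if "p \<in> V - K" for p
      using that assms(5) by (auto simp: chart_inv_left[OF V])
  qed
qed

text \<open>The bump comes from a chart. It vanishes outside the preimage \<open>K\<close> of a closed ball; \<open>K\<close> is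
  compact, hence closed because the manifold is Hausdorff, so the bump can be extended by zero.\<close>

lemma bump_function:
  assumes "open N" "p \<in> N"
  obtains b W K where "b \<in> \<F>" "open W" "p \<in> W" "W \<subseteq> N" "\<And>q. q \<in> W \<Longrightarrow> b q = 1"
    "closed K" "K \<subseteq> N" "\<And>q. q \<notin> K \<Longrightarrow> b q = 0"
proof -
  obtain U c where U: "(U, c) \<in> A" "p \<in> U" by (rule ex_chart)
  have "open (c ` (U \<inter> N))" "c p \<in> c ` (U \<inter> N)"
    using U assms open_chart_image by auto
  then obtain e where e: "e > 0" "cball (c p) e \<subseteq> c ` (U \<inter> N)"
    using open_contains_cball by blast
  obtain b :: "'e \<Rightarrow> real" where b: "smooth_on UNIV b" "\<And>x. x \<in> ball (c p) (e / 2) \<Longrightarrow> b x = 1"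
      "\<And>x. x \<notin> ball (c p) (2 * (e / 2)) \<Longrightarrow> b x = 0"
    using euclidean_bump[of "e / 2" "c p"] e(1) by auto
  define K where "K = chart_inv (U, c) ` cball (c p) e"
  define W where "W = U \<inter> c -` ball (c p) (e / 2)"
  have "compact K"
    unfolding K_def
    by (rule compact_continuous_image)
      (use e in \<open>auto intro!: continuous_on_subset[OF continuous_chart_inv[OF U(1)]]\<close>)
  then have K: "closed K" by (rule compact_imp_closed)
  have "chart_inv (U, c) x \<in> U \<inter> N" if x: "x \<in> cball (c p) e" for x
  proof -
    obtain y where "y \<in> U \<inter> N" "x = c y" using e(2) x by blast
    then show ?thesis using chart_inv_left[OF U(1), of y] by simp
  qed
  then have KN: "K \<subseteq> U \<inter> N" by (auto simp: K_def)
  have z: "b (c q) = 0" if "q \<in> U - K" for q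
  proof -
    have "c q \<notin> cball (c p) e"
      using that chart_inv_left[OF U(1), of q] unfolding K_def by (metis Diff_iff imageI)
    then show ?thesis by (intro b) auto
  qed
  show thesis
  proof (rule that[of "\<lambda>q. if q \<in> U then b (c q) else 0" W K])
    show "(\<lambda>q. if q \<in> U then b (c q) else 0) \<in> \<F>"
      by (rule smooth_function_extend[OF U(1) _ K]) (use KN z smooth_on_subset[OF b(1)] in auto)
    show "open W" unfolding W_def by (rule open_chart_preimage[OF U(1)]) simp
    show "p \<in> W" using U e by (simp add: W_def)
    show "W \<subseteq> N"
    proof
      fix q assume q: "q \<in> W"
      then have "c q \<in> cball (c p) e" using e by (auto simp: W_def)
      then obtain q' where "q' \<in> U \<inter> N" "c q = c q'" using e(2) by blast
      then show "q \<in> N"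
        using chart_inv_left[OF U(1), of q] chart_inv_left[OF U(1), of q'] q by (simp add: W_def)
    qed
  qed (use b z K KN in \<open>auto simp: W_def\<close>)
qed

lemma coord_vector_eq:
  "coord U c p u f =
    (if f \<in> \<F> then frechet_derivative (\<lambda>x. f (chart_inv (U, c) x)) (at (c p)) u else 0)"
  by (simp add: coord_vector_def o_def)

lemma smooth_functions_differentiable:
  "f \<in> \<F> \<Longrightarrow> (U, c) \<in> A \<Longrightarrow> p \<in> U \<Longrightarrow>
    (\<lambda>x. f (chart_inv (U, c) x)) differentiable (at (c p))"
  using smooth_on_differentiable[OF smooth_functionsD] by blast

lemma coord_vector_linear:
  assumes "(U, c) \<in> A" "p \<in> U"
  shows "coord U c p (a *\<^sub>R u + b *\<^sub>R w) f =
    a * coord U c p u f + b * coord U c p w f"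
proof (cases "f \<in> \<F>")
  case True
  then have l: "linear (frechet_derivative (\<lambda>x. f (chart_inv (U, c) x)) (at (c p)))"
    using smooth_functions_differentiable assms linear_frechet_derivative by blast
  show ?thesis by (simp add: coord_vector_eq linear_add[OF l] linear_cmul[OF l])
qed (simp add: coord_vector_eq)

lemma coord_vector_zero: "(U, c) \<in> A \<Longrightarrow> p \<in> U \<Longrightarrow> coord U c p 0 = 0"
  using coord_vector_linear[of U c p 0 0 0 0] by auto

lemma coord_vector_basis_sum:
  assumes "(U, c) \<in> A" "p \<in> U"
  shows "coord U c p u f = (\<Sum>i\<in>Basis. (u \<bullet> i) * coord U c p i f)"
  using frechet_derivative_basis_sum[OF smooth_functions_differentiable[OF _ assms]]
  by (cases "f \<in> \<F>") (simp_all add: coord_vector_eq)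

text \<open>By the chain rule, components change with the derivative of the transition map. Therefore every
  chart around \<open>p\<close> yields the same tangent space.\<close>

lemma coord_vector_change:
  assumes "(U, c) \<in> A" "(V, d) \<in> A" "p \<in> U" "p \<in> V"
  shows "coord U c p u =
    coord V d p (frechet_derivative (\<lambda>x. d (chart_inv (U, c) x)) (at (c p)) u)"
proof
  fix f
  show "coord U c p u f =
    coord V d p (frechet_derivative (\<lambda>x. d (chart_inv (U, c) x)) (at (c p)) u) f"
  proof (cases "f \<in> \<F>")
    case True
    have o: "open (c ` (U \<inter> V))" "c p \<in> c ` (U \<inter> V)"
      using open_chart_image assms open_chart by blast+
    let ?t = "\<lambda>x. d (chart_inv (U, c) x)" and ?g = "\<lambda>x. f (chart_inv (V, d) x)"
    have tp: "?t (c p) = d p" using assms by (simp add: chart_inv_left)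
    have dt: "?t differentiable (at (c p))"
      using smooth_on_differentiable[OF smooth_transition[OF assms(1,2)] o(2)] .
    have dg: "?g differentiable (at (?t (c p)))"
      unfolding tp using smooth_functions_differentiable True assms by blast
    have "(?g \<circ> ?t has_derivative frechet_derivative ?g (at (d p)) \<circ> frechet_derivative ?t (at (c p))) (at (c p))"
      using diff_chain_at[of ?t _ "c p" ?g] dt dg unfolding tp frechet_derivative_works by blast
    then have "((\<lambda>x. f (chart_inv (U, c) x)) has_derivative
        frechet_derivative ?g (at (d p)) \<circ> frechet_derivative ?t (at (c p))) (at (c p))"
      by (rule has_derivative_transform_within_open[OF _ o])
        (auto simp: chart_inv_left[OF assms(1)] chart_inv_left[OF assms(2)])
    then show ?thesis
      using True by (simp add: coord_vector_eq frechet_derivative_at[symmetric])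
  qed (simp add: coord_vector_eq)
qed

lemma tangent_space_eq:
  assumes "(U, c) \<in> A" "p \<in> U"
  shows "\<T> p = range (coord U c p)"
  unfolding tangent_space_def using assms coord_vector_change[OF _ assms(1) _ assms(2)] by blast

lemma tangent_space_lincomb:
  assumes "v \<in> \<T> p" "w \<in> \<T> p"
  shows "(\<lambda>f. a * v f + b * w f) \<in> \<T> p"
proof -
  obtain U c where U: "(U, c) \<in> A" "p \<in> U" by (rule ex_chart)
  obtain u u' where "v = coord U c p u" "w = coord U c p u'"
    using assms unfolding tangent_space_eq[OF U] by blast
  then have "(\<lambda>f. a * v f + b * w f) = coord U c p (a *\<^sub>R u + b *\<^sub>R u')"
    by (auto simp: coord_vector_linear[OF U])
  then show ?thesis unfolding tangent_space_eq[OF U] by blast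
qed

lemma tangent_space_zero: "0 \<in> \<T> p"
proof -
  obtain U c where U: "(U, c) \<in> A" "p \<in> U" by (rule ex_chart)
  show ?thesis unfolding tangent_space_eq[OF U] using coord_vector_zero[OF U] by (metis rangeI)
qed

lemma tangent_vector_diff:
  assumes "v \<in> \<T> p" "f \<in> \<F>" "g \<in> \<F>"
  shows "v (\<lambda>q. f q - g q) = v f - v g"
proof -
  obtain U c where U: "(U, c) \<in> A" "p \<in> U" by (rule ex_chart)
  obtain u where v: "v = coord U c p u"
    using assms unfolding tangent_space_eq[OF U] by blast
  have "((\<lambda>x. f (chart_inv (U, c) x) - g (chart_inv (U, c) x)) has_derivative
     (\<lambda>u. frechet_derivative (\<lambda>x. f (chart_inv (U, c) x)) (at (c p)) u -
          frechet_derivative (\<lambda>x. g (chart_inv (U, c) x)) (at (c p)) u)) (at (c p))"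
    using assms U by (intro has_derivative_diff) (auto simp: frechet_derivative_works[symmetric] smooth_functions_differentiable)
  from fun_cong[OF frechet_derivative_at[OF this], of u] show ?thesis
    using assms smooth_functions_diff[OF assms(2,3)] by (simp add: v coord_vector_eq)
qed

lemma tangent_vector_mult:
  assumes "v \<in> \<T> p" "f \<in> \<F>" "g \<in> \<F>"
  shows "v (\<lambda>q. f q * g q) = v f * g p + f p * v g"
proof -
  obtain U c where U: "(U, c) \<in> A" "p \<in> U" by (rule ex_chart)
  obtain u where v: "v = coord U c p u"
    using assms unfolding tangent_space_eq[OF U] by blast
  have "((\<lambda>x. f (chart_inv (U, c) x) * g (chart_inv (U, c) x)) has_derivative
     (\<lambda>u. f (chart_inv (U, c) (c p)) * frechet_derivative (\<lambda>x. g (chart_inv (U, c) x)) (at (c p)) u +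
          frechet_derivative (\<lambda>x. f (chart_inv (U, c) x)) (at (c p)) u * g (chart_inv (U, c) (c p)))) (at (c p))"
    using assms U by (intro has_derivative_mult) (auto simp: frechet_derivative_works[symmetric] smooth_functions_differentiable)
  from fun_cong[OF frechet_derivative_at[OF this], of u] show ?thesis
    using assms smooth_functions_mult[OF assms(2,3)] by (simp add: v coord_vector_eq chart_inv_left U)
qed

lemma tangent_vector_const: "v \<in> \<T> p \<Longrightarrow> v (\<lambda>q. k) = 0"
  by (auto simp: tangent_space_def coord_vector_eq)

lemma tangent_vector_add:
  assumes "v \<in> \<T> p" "f \<in> \<F>" "g \<in> \<F>"
  shows "v (\<lambda>q. f q + g q) = v f + v g"
proof -
  have "v (\<lambda>q. f q - (-1) * g q) = v f - v (\<lambda>q. (-1) * g q)"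
    using assms by (intro tangent_vector_diff smooth_functions_mult smooth_functions_const)
  moreover have "v (\<lambda>q. (-1) * g q) = - v g"
    using tangent_vector_mult[OF assms(1) smooth_functions_const[of "-1"] assms(3)]
      tangent_vector_const[OF assms(1)] by simp
  ultimately show ?thesis by simp
qed

lemma vector_field_components:
  assumes "X \<in> \<XX>" "(U, c) \<in> A"
  obtains u where "smooth_on (c ` U) u" "\<And>p. p \<in> U \<Longrightarrow> X p = coord U c p (u (c p))"
  using assms unfolding vector_fields_def by fast

lemma vector_fields_tangent: "X \<in> \<XX> \<Longrightarrow> X p \<in> \<T> p"
proof -
  assume X: "X \<in> \<XX>"
  obtain U c where U: "(U, c) \<in> A" "p \<in> U" by (rule ex_chart)
  show ?thesis using X U unfolding vector_fields_def tangent_space_eq[OF U] by fastforce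
qed

lemma vector_fields_lincomb:
  assumes "X \<in> \<XX>" "Y \<in> \<XX>" "f \<in> \<F>" "g \<in> \<F>"
  shows "(\<lambda>p h. f p * X p h + g p * Y p h) \<in> \<XX>"
  unfolding vector_fields_def
proof (safe)
  fix U c assume U: "(U, c) \<in> A"
  obtain u where u: "smooth_on (c ` U) u" "\<And>p. p \<in> U \<Longrightarrow> X p = coord U c p (u (c p))"
    using vector_field_components[OF assms(1) U] by metis
  obtain w where w: "smooth_on (c ` U) w" "\<And>p. p \<in> U \<Longrightarrow> Y p = coord U c p (w (c p))"
    using vector_field_components[OF assms(2) U] by metis
  let ?z = "\<lambda>x. f (chart_inv (U, c) x) *\<^sub>R u x + g (chart_inv (U, c) x) *\<^sub>R w x"
  show "\<exists>z. smooth_on (c ` U) z \<and>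
     (\<forall>p\<in>U. (\<lambda>h. f p * X p h + g p * Y p h) = coord U c p (z (c p)))"
  proof (intro exI conjI ballI)
    show "smooth_on (c ` U) ?z"
      using U u w assms by (intro smooth_on_add smooth_on_scaleR) (simp_all add: open_chart smooth_functionsD)
    show "(\<lambda>h. f p * X p h + g p * Y p h) = coord U c p (?z (c p))" if "p \<in> U" for p
      by (rule ext) (simp add: that u w coord_vector_linear[OF U that] chart_inv_left[OF U that])
  qed
qed

lemma vector_fields_zero: "0 \<in> \<XX>"
  unfolding vector_fields_def
  by (auto simp: coord_vector_zero intro!: exI[of _ "\<lambda>_. 0"] smooth_on_const)

lemma vector_fields_scale:
  assumes "f \<in> \<F>" "X \<in> \<XX>"
  shows "vf_scale f X \<in> \<XX>"
proof -
  have "vf_scale f X = (\<lambda>p h. f p * X p h + 0 * X p h)" by (simp add: vf_scale_def)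
  also have "\<dots> \<in> \<XX>"
    by (intro vector_fields_lincomb smooth_functions_const assms)
  finally show ?thesis .
qed

lemma vector_fields_add:
  assumes "X \<in> \<XX>" "Y \<in> \<XX>"
  shows "X + Y \<in> \<XX>"
proof -
  have "X + Y = (\<lambda>p h. 1 * X p h + 1 * Y p h)" by (intro ext) simp
  also have "\<dots> \<in> \<XX>"
    by (intro vector_fields_lincomb smooth_functions_const assms)
  finally show ?thesis .
qed

lemma vector_fields_diff:
  assumes "X \<in> \<XX>" "Y \<in> \<XX>"
  shows "X - Y \<in> \<XX>"
proof -
  have "X - Y = (\<lambda>p h. 1 * X p h + (-1) * Y p h)" by (intro ext) simp
  also have "\<dots> \<in> \<XX>"
    by (intro vector_fields_lincomb smooth_functions_const assms)
  finally show ?thesis .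
qed

lemma vector_fields_sum:
  "(\<And>i. i \<in> I \<Longrightarrow> X i \<in> \<XX>) \<Longrightarrow> (\<Sum>i\<in>I. X i) \<in> \<XX>"
  by (induction I rule: infinite_finite_induct) (auto intro: vector_fields_zero vector_fields_add)

lemma vf_apply_smooth:
  assumes "X \<in> \<XX>" "f \<in> \<F>"
  shows "vf_apply X f \<in> \<F>"
proof (rule smooth_functionsI)
  fix U c assume U: "(U, c) \<in> A"
  obtain u where u: "smooth_on (c ` U) u" "\<And>p. p \<in> U \<Longrightarrow> X p = coord U c p (u (c p))"
    using vector_field_components[OF assms(1) U] by metis
  show "smooth_on (c ` U) (\<lambda>x. vf_apply X f (chart_inv (U, c) x))"
  proof (rule smooth_on_cong[OF open_chart(2)[OF U]])
    show "smooth_on (c ` U) (\<lambda>x. frechet_derivative (\<lambda>x. f (chart_inv (U, c) x)) (at x) (u x))"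
      by (intro smooth_on_frechet_derivative open_chart(2) U smooth_functionsD assms u)
  qed (simp add: vf_apply_def u chart_inv_in[OF U] chart_inv_right[OF U] coord_vector_eq assms)
qed

text \<open>The components in another chart arise by applying the derivative of the transition map, which is
  linear and depends smoothly on the point; so they are smooth and vanish outside \<open>K\<close>.\<close>

lemma vector_field_extend:
  assumes U: "(U, c) \<in> A" and "smooth_on (c ` U) u" "closed K" "K \<subseteq> U" "\<And>p. p \<in> U - K \<Longrightarrow> u (c p) = 0"
  shows "(\<lambda>p. if p \<in> U then coord U c p (u (c p)) else 0) \<in> \<XX>"
  unfolding vector_fields_def
proof (safe)
  fix V d assume V: "(V, d) \<in> A"
  let ?D = "\<lambda>x. frechet_derivative (\<lambda>x. d (chart_inv (U, c) x)) (at x) (u x)"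
  let ?w = "\<lambda>y. if chart_inv (V, d) y \<in> U then ?D (c (chart_inv (V, d) y)) else 0"
  have o: "open (d ` (V \<inter> U))" "open (c ` (U \<inter> V))"
    using open_chart_image V U open_chart by blast+
  show "\<exists>w. smooth_on (d ` V) w \<and>
      (\<forall>p\<in>V. (if p \<in> U then coord U c p (u (c p)) else 0) = coord V d p (w (d p)))"
  proof (intro exI conjI ballI)
    show "smooth_on (d ` V) ?w"
    proof (rule smooth_on_extend_by_zero[OF U V assms(3,4)])
      have "smooth_on (c ` (U \<inter> V)) ?D"
        by (intro smooth_on_frechet_derivative o smooth_transition U V smooth_on_subset[OF assms(2)]) auto
      then have "smooth_on (d ` (V \<inter> U)) (\<lambda>y. ?D (c (chart_inv (V, d) y)))"
        by (rule smooth_on_compose[OF o, rotated])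
          (use smooth_transition[OF V U] in \<open>auto simp: chart_inv_left[OF V]\<close>)
      then show "smooth_on (d ` (V \<inter> U)) ?w"
        by (rule smooth_on_cong[OF o(1), rotated]) (auto simp: chart_inv_left[OF V])
      show "?w (d p) = 0" if p: "p \<in> V - K" for p
      proof (cases "p \<in> U")
        case True
        have "linear (frechet_derivative (\<lambda>x. d (chart_inv (U, c) x)) (at (c p)))"
          using smooth_on_differentiable[OF smooth_transition[OF U V]] True p
          by (intro linear_frechet_derivative) auto
        then show ?thesis
          using p True assms(5) linear_0 by (auto simp: chart_inv_left[OF V])
      qed (use p in \<open>auto simp: chart_inv_left[OF V]\<close>)
    qed
    show "(if p \<in> U then coord U c p (u (c p)) else 0) = coord V d p (?w (d p))"
      if "p \<in> V" for p
      using that coord_vector_change[OF U V _ that] coord_vector_zero[OF V that]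
      by (auto simp: chart_inv_left[OF V])
  qed
qed

text \<open>Cut off by a bump function, the coordinate vector fields and the coordinate functions of a
  chart become global objects \<open>E i\<close> and \<open>h i\<close>, unchanged near \<open>p\<close>.\<close>

lemma local_frame:
  assumes U: "(U, c) \<in> A" "p \<in> U"
  obtains W E h where "open W" "p \<in> W" "W \<subseteq> U"
    "\<And>i. i \<in> Basis \<Longrightarrow> E i \<in> \<XX>" "\<And>i. i \<in> Basis \<Longrightarrow> h i \<in> \<F>"
    "\<And>q i. q \<in> W \<Longrightarrow> i \<in> Basis \<Longrightarrow> E i q = coord U c q i"
    "\<And>q u i. q \<in> W \<Longrightarrow> i \<in> Basis \<Longrightarrow> coord U c q u (h i) = u \<bullet> i"
proof -
  obtain b W K where b: "b \<in> \<F>" "open W" "p \<in> W" "W \<subseteq> U" "\<And>q. q \<in> W \<Longrightarrow> b q = 1"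
    "closed K" "K \<subseteq> U" "\<And>q. q \<notin> K \<Longrightarrow> b q = 0"
    using bump_function[OF open_chart(1)[OF U(1)] U(2)] by metis
  let ?b = "\<lambda>x. b (chart_inv (U, c) x)"
  have sb: "smooth_on (c ` U) ?b" using b U smooth_functionsD by blast
  define E where "E i = (\<lambda>q. if q \<in> U then coord U c q (?b (c q) *\<^sub>R i) else 0)" for i
  define h where "h i = (\<lambda>q. if q \<in> U then ?b (c q) * (c q \<bullet> i) else 0)" for i
  note o = open_chart(2)[OF U(1)]
  have "smooth_on (c ` U) (\<lambda>x. ?b x * (x \<bullet> i))" for i
    by (rule smooth_on_mult[OF o sb smooth_on_inner[OF o smooth_on_linear[OF bounded_linear_ident] smooth_on_const]])
  then have h: "h i \<in> \<F>" for i
    unfolding h_def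
    by (rule smooth_function_extend[OF U(1) _ b(6,7)]) (simp add: b(8) chart_inv_left[OF U(1)])
  have sE: "smooth_on (c ` U) (\<lambda>x. ?b x *\<^sub>R i)" for i :: 'e
    by (rule smooth_on_scaleR[OF o sb smooth_on_const])
  show thesis
  proof (rule that[of W E h])
    show "E i \<in> \<XX>" for i
      unfolding E_def
      by (rule vector_field_extend[OF U(1) sE b(6,7)]) (simp add: b(8) chart_inv_left[OF U(1)])
    show "E i q = coord U c q i" if "q \<in> W" for q i
      using that b(4,5) by (auto simp: E_def chart_inv_left[OF U(1)])
    show "coord U c q u (h i) = u \<bullet> i" if "q \<in> W" for q u i
    proof -
      have q: "q \<in> U" using that b(4) by auto
      have o: "open (c ` (U \<inter> W))" "c q \<in> c ` (U \<inter> W)" using open_chart_image U b(2) that q by auto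
      have "((\<lambda>x. x \<bullet> i) has_derivative (\<lambda>x. x \<bullet> i)) (at (c q))"
        by (intro derivative_eq_intros) auto
      then have "((\<lambda>x. h i (chart_inv (U, c) x)) has_derivative (\<lambda>x. x \<bullet> i)) (at (c q))"
        by (rule has_derivative_transform_within_open[OF _ o])
          (use b in \<open>auto simp: h_def chart_inv_left[OF U(1)]\<close>)
      then show ?thesis by (simp add: coord_vector_eq h frechet_derivative_at[symmetric])
    qed
  qed (use b h in auto)
qed

text \<open>The derivatives of the local coordinate functions \<open>h i\<close> recover the components.\<close>

lemma coord_vector_inject:
  assumes U: "(U, c) \<in> A" "p \<in> U" and "coord U c p u = coord U c p w"
  shows "u = w"
proof -
  obtain W E h where "p \<in> W" and
    h: "\<And>q u i. q \<in> W \<Longrightarrow> i \<in> Basis \<Longrightarrow> coord U c q u (h i) = u \<bullet> i"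
    using local_frame[OF U] by metis
  then have "u \<bullet> i = w \<bullet> i" if "i \<in> Basis" for i
    using assms(3) that by metis
  then show ?thesis by (rule euclidean_eqI)
qed

lemma frame_expansion:
  assumes U: "(U, c) \<in> A" "q \<in> U"
    and "\<And>i. i \<in> Basis \<Longrightarrow> E i q = coord U c q i"
    and "\<And>u i. i \<in> Basis \<Longrightarrow> coord U c q u (h i) = u \<bullet> i"
    and "v \<in> \<T> q"
  shows "v = (\<lambda>f. \<Sum>i\<in>Basis. v (h i) * E i q f)"
proof -
  obtain u where v: "v = coord U c q u"
    using assms unfolding tangent_space_eq[OF U] by blast
  show ?thesis
    by (rule ext, subst v, subst coord_vector_basis_sum[OF U])
      (rule sum.cong, auto simp: assms v)
qed

end

section \<open>Tensors as function-linear maps on vector fields\<close>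

lemma sum_vfield_apply: "(\<Sum>i\<in>I. X i) p f = (\<Sum>i\<in>I. X i p f)" for X :: "'i \<Rightarrow> 'm vfield"
  by (induction I rule: infinite_finite_induct) auto

lemma vf_scale_apply: "vf_scale f X p g = f p * X p g"
  by (simp add: vf_scale_def)

abbreviation (input) vf_lin :: "('m \<Rightarrow> real) \<Rightarrow> 'm vfield \<Rightarrow> ('m \<Rightarrow> real) \<Rightarrow> 'm vfield \<Rightarrow> 'm vfield" where
  "vf_lin f X g Y \<equiv> vf_scale f X + vf_scale g Y"

lemma vf_lin_simps: "vf_lin (\<lambda>_. 1) X (\<lambda>_. 1) Y = X + Y" "vf_lin f X (\<lambda>_. 0) X = vf_scale f X"
  by (intro ext; simp add: vf_scale_apply)+

lemma multilinear_onD: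
  "multilinear_on V F \<Longrightarrow> set xs \<subseteq> V \<Longrightarrow> set ys \<subseteq> V \<Longrightarrow> v \<in> V \<Longrightarrow> w \<in> V \<Longrightarrow>
    F (xs @ (\<lambda>f. a * v f + b * w f) # ys) = a * F (xs @ v # ys) + b * F (xs @ w # ys)"
  unfolding multilinear_on_def by simp

context smooth_manifold
begin

lemma function_linear_sum:
  fixes t :: "'m vfield \<Rightarrow> real"
  assumes add: "\<And>X Y. X \<in> \<XX> \<Longrightarrow> Y \<in> \<XX> \<Longrightarrow> t (X + Y) = t X + t Y"
    and scale: "\<And>f X. f \<in> \<F> \<Longrightarrow> X \<in> \<XX> \<Longrightarrow> t (vf_scale f X) = f p * t X"
    and "\<And>i. i \<in> I \<Longrightarrow> f i \<in> \<F>" "\<And>i. i \<in> I \<Longrightarrow> X i \<in> \<XX>"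
  shows "t (\<Sum>i\<in>I. vf_scale (f i) (X i)) = (\<Sum>i\<in>I. f i p * t (X i))"
proof -
  have "vf_scale (\<lambda>_. 0) 0 = (0 :: 'm vfield)" by (intro ext) (simp add: vf_scale_def)
  then have t0: "t 0 = 0"
    using scale[OF smooth_functions_const vector_fields_zero, of 0] by simp
  show ?thesis
    using assms(3,4)
  proof (induction I rule: infinite_finite_induct)
    case (insert i I)
    then have "t (vf_scale (f i) (X i) + (\<Sum>i\<in>I. vf_scale (f i) (X i))) =
        t (vf_scale (f i) (X i)) + t (\<Sum>i\<in>I. vf_scale (f i) (X i))"
      by (intro add vector_fields_scale vector_fields_sum) auto
    also have "vf_scale (f i) (X i) + (\<Sum>i\<in>I. vf_scale (f i) (X i)) = (\<Sum>i\<in>insert i I. vf_scale (f i) (X i))"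
      using insert.hyps by (rule sum.insert[symmetric])
    finally show ?case using insert by (simp add: scale)
  qed (simp_all add: t0)
qed

text \<open>Multiplying by a bump function \<open>b\<close> with \<open>b p = 1\<close> does not change \<open>t X\<close>, and it turns the
  local expansion of \<open>X\<close> in a frame into a global one.\<close>

lemma function_linear_pointwise:
  fixes t :: "'m vfield \<Rightarrow> real"
  assumes add: "\<And>X Y. X \<in> \<XX> \<Longrightarrow> Y \<in> \<XX> \<Longrightarrow> t (X + Y) = t X + t Y"
    and scale: "\<And>f X. f \<in> \<F> \<Longrightarrow> X \<in> \<XX> \<Longrightarrow> t (vf_scale f X) = f p * t X"
    and XY: "X \<in> \<XX>" "Y \<in> \<XX>" "X p = Y p"
  shows "t X = t Y"
proof -
  obtain U c where U: "(U, c) \<in> A" "p \<in> U" by (rule ex_chart)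
  obtain W E h where W: "open W" "p \<in> W" "W \<subseteq> U"
    and E: "\<And>i. i \<in> Basis \<Longrightarrow> E i \<in> \<XX>" "\<And>i. i \<in> Basis \<Longrightarrow> h i \<in> \<F>"
      "\<And>q i. q \<in> W \<Longrightarrow> i \<in> Basis \<Longrightarrow> E i q = coord U c q i"
      "\<And>q u i. q \<in> W \<Longrightarrow> i \<in> Basis \<Longrightarrow> coord U c q u (h i) = u \<bullet> i"
    using local_frame[OF U] by metis
  obtain b W' K where b: "b \<in> \<F>" "p \<in> W'" "\<And>q. q \<in> W' \<Longrightarrow> b q = 1"
    "K \<subseteq> W" "\<And>q. q \<notin> K \<Longrightarrow> b q = 0"
    using bump_function[OF W(1,2)] by metis
  have "t Z = (\<Sum>i\<in>Basis. Z p (h i) * t (E i))" if Z: "Z \<in> \<XX>" for Z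
  proof -
    have eq: "vf_scale b Z = (\<Sum>i\<in>Basis. vf_scale (\<lambda>q. b q * vf_apply Z (h i) q) (E i))"
    proof (intro ext)
      fix q f
      show "vf_scale b Z q f = (\<Sum>i\<in>Basis. vf_scale (\<lambda>q. b q * vf_apply Z (h i) q) (E i)) q f"
      proof (cases "q \<in> W")
        case True
        then have "Z q = (\<lambda>f. \<Sum>i\<in>Basis. Z q (h i) * E i q f)"
          using W U E Z vector_fields_tangent by (intro frame_expansion[of U c]) auto
        from fun_cong[OF this, of f] show ?thesis
          by (simp add: sum_vfield_apply vf_scale_def vf_apply_def sum_distrib_left mult.assoc)
      next
        case False
        then have "b q = 0" using b by blast
        then show ?thesis by (simp add: sum_vfield_apply vf_scale_def)
      qed
    qed
    have "t Z = t (vf_scale b Z)" using scale[OF b(1) Z] b(2,3) by simp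
    also have "\<dots> = (\<Sum>i\<in>Basis. b p * vf_apply Z (h i) p * t (E i))"
      unfolding eq using E b Z
      by (intro function_linear_sum add scale) (auto intro!: smooth_functions_mult vf_apply_smooth)
    finally show ?thesis using b(2,3) by (simp add: vf_apply_def)
  qed
  with XY show ?thesis by simp
qed

lemma tangent_vector_extension:
  assumes "v \<in> \<T> p"
  obtains X where "X \<in> \<XX>" "X p = v"
proof -
  obtain U c where U: "(U, c) \<in> A" "p \<in> U" by (rule ex_chart)
  obtain W E h where W: "p \<in> W"
    and E: "\<And>i. i \<in> Basis \<Longrightarrow> E i \<in> \<XX>"
      "\<And>q i. q \<in> W \<Longrightarrow> i \<in> Basis \<Longrightarrow> E i q = coord U c q i"
      "\<And>q u i. q \<in> W \<Longrightarrow> i \<in> Basis \<Longrightarrow> coord U c q u (h i) = u \<bullet> i"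
    using local_frame[OF U] by metis
  let ?X = "\<Sum>i\<in>Basis. vf_scale (\<lambda>_. v (h i)) (E i)"
  have e: "v = (\<lambda>f. \<Sum>i\<in>Basis. v (h i) * E i p f)"
    using W U E assms by (intro frame_expansion[of U c]) auto
  have "?X p f = v f" for f
    using fun_cong[OF e, of f] by (simp add: sum_vfield_apply vf_scale_def)
  then have "?X p = v" by (rule ext)
  moreover have "?X \<in> \<XX>"
    using E by (intro vector_fields_sum vector_fields_scale smooth_functions_const)
  ultimately show thesis using that by blast
qed

definition extend :: "'m \<Rightarrow> 'm tvec \<Rightarrow> 'm vfield" where
  "extend p v = (SOME X. X \<in> \<XX> \<and> X p = v)"

lemma extend:
  assumes "v \<in> \<T> p"
  shows "extend p v \<in> \<XX>" "extend p v p = v"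
  using someI_ex[of "\<lambda>X. X \<in> \<XX> \<and> X p = v"] tangent_vector_extension[OF assms]
  unfolding extend_def by blast+

lemma extend_list:
  assumes "set vs \<subseteq> \<T> p"
  shows "set (map (extend p) vs) \<subseteq> \<XX>"
    "tensor_eval \<Phi> (map (extend p) vs) p = \<Phi> p vs"
proof -
  show "set (map (extend p) vs) \<subseteq> \<XX>" using assms extend by auto
  have "map (\<lambda>X. X p) (map (extend p) vs) = vs"
    using assms extend by (auto intro!: map_idI)
  then show "tensor_eval \<Phi> (map (extend p) vs) p = \<Phi> p vs"
    unfolding tensor_eval_def by presburger
qed

text \<open>Because of the symmetry it is enough to ask for linearity in the first argument.\<close>

definition tensorial :: "('m vfield list \<Rightarrow> 'm \<Rightarrow> real) \<Rightarrow> bool" where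
  "tensorial T \<longleftrightarrow>
    (\<forall>Xs. set Xs \<subseteq> \<XX> \<longrightarrow> T Xs \<in> \<F>) \<and>
    (\<forall>Xs Ys. set Xs \<subseteq> \<XX> \<and> mset Ys = mset Xs \<longrightarrow> T Ys = T Xs) \<and>
    (\<forall>f X g Y Zs p. f \<in> \<F> \<and> X \<in> \<XX> \<and> g \<in> \<F> \<and> Y \<in> \<XX> \<and> set Zs \<subseteq> \<XX> \<longrightarrow>
      T (vf_lin f X g Y # Zs) p = f p * T (X # Zs) p + g p * T (Y # Zs) p) \<and>
    (\<exists>n. \<forall>Xs p. set Xs \<subseteq> \<XX> \<and> length Xs > n \<longrightarrow> T Xs p = 0)"

lemma tensorialI:
  assumes "\<And>Xs. set Xs \<subseteq> \<XX> \<Longrightarrow> T Xs \<in> \<F>"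
    and "\<And>Xs Ys. set Xs \<subseteq> \<XX> \<Longrightarrow> mset Ys = mset Xs \<Longrightarrow> T Ys = T Xs"
    and "\<And>f X g Y Zs p. f \<in> \<F> \<Longrightarrow> X \<in> \<XX> \<Longrightarrow> g \<in> \<F> \<Longrightarrow> Y \<in> \<XX> \<Longrightarrow> set Zs \<subseteq> \<XX> \<Longrightarrow>
      T (vf_lin f X g Y # Zs) p = f p * T (X # Zs) p + g p * T (Y # Zs) p"
    and "\<And>Xs p. set Xs \<subseteq> \<XX> \<Longrightarrow> length Xs > n \<Longrightarrow> T Xs p = 0"
  shows "tensorial T"
  unfolding tensorial_def
proof (intro conjI exI)
  show "\<forall>Xs. set Xs \<subseteq> \<XX> \<longrightarrow> T Xs \<in> \<F>"
    using assms(1) by blast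
  show "\<forall>Xs Ys. set Xs \<subseteq> \<XX> \<and> mset Ys = mset Xs \<longrightarrow> T Ys = T Xs"
    using assms(2) by blast
  show "\<forall>f X g Y Zs p. f \<in> \<F> \<and> X \<in> \<XX> \<and> g \<in> \<F> \<and> Y \<in> \<XX> \<and> set Zs \<subseteq> \<XX> \<longrightarrow>
      T (vf_lin f X g Y # Zs) p = f p * T (X # Zs) p + g p * T (Y # Zs) p"
    using assms(3) by blast
  show "\<forall>Xs p. set Xs \<subseteq> \<XX> \<and> n < length Xs \<longrightarrow> T Xs p = 0"
    using assms(4) by blast
qed

lemma tensorialD:
  assumes "tensorial T"
  shows "set Xs \<subseteq> \<XX> \<Longrightarrow> T Xs \<in> \<F>"
    and "set Xs \<subseteq> \<XX> \<Longrightarrow> mset Ys = mset Xs \<Longrightarrow> T Ys = T Xs"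
    and "f \<in> \<F> \<Longrightarrow> X \<in> \<XX> \<Longrightarrow> g \<in> \<F> \<Longrightarrow> Y \<in> \<XX> \<Longrightarrow> set Zs \<subseteq> \<XX> \<Longrightarrow>
      T (vf_lin f X g Y # Zs) p = f p * T (X # Zs) p + g p * T (Y # Zs) p"
    and "\<exists>n. \<forall>Xs p. set Xs \<subseteq> \<XX> \<and> length Xs > n \<longrightarrow> T Xs p = 0"
proof -
  note T = assms[unfolded tensorial_def]
  show "set Xs \<subseteq> \<XX> \<Longrightarrow> T Xs \<in> \<F>"
    using T[THEN conjunct1] by blast
  show "set Xs \<subseteq> \<XX> \<Longrightarrow> mset Ys = mset Xs \<Longrightarrow> T Ys = T Xs"
    using T[THEN conjunct2, THEN conjunct1] by blast
  show "f \<in> \<F> \<Longrightarrow> X \<in> \<XX> \<Longrightarrow> g \<in> \<F> \<Longrightarrow> Y \<in> \<XX> \<Longrightarrow> set Zs \<subseteq> \<XX> \<Longrightarrow>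
      T (vf_lin f X g Y # Zs) p = f p * T (X # Zs) p + g p * T (Y # Zs) p"
    using T[THEN conjunct2, THEN conjunct2, THEN conjunct1] by blast
  show "\<exists>n. \<forall>Xs p. set Xs \<subseteq> \<XX> \<and> length Xs > n \<longrightarrow> T Xs p = 0"
    using T[THEN conjunct2, THEN conjunct2, THEN conjunct2] .
qed

lemma tensorial_add:
  assumes "tensorial T" "X \<in> \<XX>" "Y \<in> \<XX>" "set Zs \<subseteq> \<XX>"
  shows "T ((X + Y) # Zs) p = T (X # Zs) p + T (Y # Zs) p"
  using tensorialD(3)[OF assms(1) smooth_functions_const assms(2) smooth_functions_const assms(3,4), of 1 1 p]
  unfolding vf_lin_simps by simp

lemma tensorial_scale:
  assumes "tensorial T" "f \<in> \<F>" "X \<in> \<XX>" "set Zs \<subseteq> \<XX>"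
  shows "T (vf_scale f X # Zs) p = f p * T (X # Zs) p"
  using tensorialD(3)[OF assms(1,2,3) smooth_functions_const assms(3,4), of 0 p]
  unfolding vf_lin_simps by simp

lemma vf_lin_vector_fields: "f \<in> \<F> \<Longrightarrow> X \<in> \<XX> \<Longrightarrow> g \<in> \<F> \<Longrightarrow> Y \<in> \<XX> \<Longrightarrow> vf_lin f X g Y \<in> \<XX>"
  by (intro vector_fields_add vector_fields_scale)

lemma tensorial_cong:
  assumes "tensorial T" "\<And>Xs p. set Xs \<subseteq> \<XX> \<Longrightarrow> T' Xs p = T Xs p"
  shows "tensorial T'"
proof -
  have eq: "T' Xs = T Xs" if "set Xs \<subseteq> \<XX>" for Xs
    using assms(2)[OF that] by auto
  obtain n where "\<forall>Xs p. set Xs \<subseteq> \<XX> \<and> length Xs > n \<longrightarrow> T Xs p = 0"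
    using tensorialD(4)[OF assms(1)] by blast
  then have n: "T Xs p = 0" if "set Xs \<subseteq> \<XX>" "length Xs > n" for Xs p
    using that by blast
  show ?thesis
  proof (rule tensorialI[of _ n])
    show "T' Xs \<in> \<F>" if "set Xs \<subseteq> \<XX>" for Xs
      unfolding eq[OF that] using that by (rule tensorialD(1)[OF assms(1)])
    show "T' Ys = T' Xs" if "set Xs \<subseteq> \<XX>" "mset Ys = mset Xs" for Xs Ys
      using tensorialD(2)[OF assms(1) that] mset_eq_setD[OF that(2)] eq[of Ys] eq[of Xs] that(1) by simp
    show "T' Xs p = 0" if "set Xs \<subseteq> \<XX>" "length Xs > n" for Xs p
      unfolding eq[OF that(1)] using that by (rule n)
    show "T' (vf_lin f X g Y # Zs) p = f p * T' (X # Zs) p + g p * T' (Y # Zs) p"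
      if "f \<in> \<F>" "X \<in> \<XX>" "g \<in> \<F>" "Y \<in> \<XX>" "set Zs \<subseteq> \<XX>" for f X g Y Zs p
      using tensorialD(3)[OF assms(1) that] eq[of "vf_lin f X g Y # Zs"] eq[of "X # Zs"] eq[of "Y # Zs"]
        vf_lin_vector_fields[OF that(1-4)] that by simp
  qed
qed

lemma tensorial_slot:
  assumes "tensorial T" "set Xs \<subseteq> \<XX>" "X \<in> \<XX>" "set Ys \<subseteq> \<XX>"
  shows "T (Xs @ X # Ys) = T (X # Xs @ Ys)"
  by (rule tensorialD(2)[OF assms(1)]) (use assms in auto)

text \<open>The arguments are exchanged one after the other; \<open>Zs\<close> collects those already treated.\<close>

lemma tensorial_pointwise:
  assumes T: "tensorial T"
    and "set Zs \<subseteq> \<XX>" "set Xs \<subseteq> \<XX>" "set Ys \<subseteq> \<XX>"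
    and "map (\<lambda>X. X p) Xs = map (\<lambda>X. X p) Ys"
  shows "T (Zs @ Xs) p = T (Zs @ Ys) p"
  using assms(2-)
proof (induction Xs arbitrary: Ys Zs)
  case Nil
  then show ?case by simp
next
  case (Cons X Xs)
  then obtain Y Ys' where Y: "Ys = Y # Ys'" "X p = Y p" "map (\<lambda>X. X p) Xs = map (\<lambda>X. X p) Ys'"
    by (cases Ys) auto
  have "T (X # Zs @ Xs) p = T (Y # Zs @ Xs) p"
    by (rule function_linear_pointwise[of "\<lambda>X. T (X # Zs @ Xs) p" p])
      (use Cons.prems Y in \<open>simp_all add: tensorial_add[OF T] tensorial_scale[OF T]\<close>)
  then have "T (Zs @ X # Xs) p = T (Zs @ Y # Xs) p"
    using Cons.prems Y by (simp add: tensorial_slot[OF T])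
  also have "\<dots> = T ((Zs @ [Y]) @ Ys') p"
    using Cons.IH[of "Zs @ [Y]" Ys'] Cons.prems Y by simp
  finally show ?case using Y by simp
qed

text \<open>The algebraic conditions at a point follow by extending tangent vectors to vector fields. The
  smoothness of components in a chart is a local condition, and near a given point the coordinate
  vectors are the values of global fields.\<close>

lemma sym_tensorsI:
  assumes T: "tensorial (tensor_eval \<Psi>)"
    and zero: "\<And>p vs. \<not> set vs \<subseteq> \<T> p \<Longrightarrow> \<Psi> p vs = 0"
  shows "\<Psi> \<in> sym_tensors A"
  unfolding sym_tensors_def
proof (intro CollectI conjI allI)
  fix p
  show "multilinear_on (\<T> p) (\<Psi> p)"
    unfolding multilinear_on_def
  proof (intro allI impI, elim conjE)
    fix xs ys v w a b
    assume l: "set xs \<subseteq> \<T> p" "set ys \<subseteq> \<T> p"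
      "v \<in> \<T> p" "w \<in> \<T> p"
    let ?Xs = "map (extend p) xs" and ?Ys = "map (extend p) ys"
    let ?v = "vf_scale (\<lambda>_. a) (extend p v)" and ?w = "vf_scale (\<lambda>_. b) (extend p w)"
    have V: "set ?Xs \<subseteq> \<XX>" "set ?Ys \<subseteq> \<XX>" "extend p v \<in> \<XX>" "extend p w \<in> \<XX>"
      using l extend_list(1) by (auto intro!: extend)
    have ev: "tensor_eval \<Psi> (?Xs @ Z # ?Ys) p = \<Psi> p (xs @ Z p # ys)" for Z
      using l extend(2) by (simp add: tensor_eval_def o_def map_idI subset_iff)
    have "(?v + ?w) p = (\<lambda>f. a * v f + b * w f)"
      by (rule ext) (simp add: vf_scale_def extend(2) l)
    then have "\<Psi> p (xs @ (\<lambda>f. a * v f + b * w f) # ys) = tensor_eval \<Psi> (?Xs @ (?v + ?w) # ?Ys) p"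
      by (simp only: ev)
    also have "\<dots> = a * tensor_eval \<Psi> (?Xs @ extend p v # ?Ys) p + b * tensor_eval \<Psi> (?Xs @ extend p w # ?Ys) p"
      using V vf_lin_vector_fields[OF smooth_functions_const V(3) smooth_functions_const V(4), of a b]
      by (simp add: tensorial_slot[OF T] tensorialD(3)[OF T] smooth_functions_const)
    finally show "\<Psi> p (xs @ (\<lambda>f. a * v f + b * w f) # ys) = a * \<Psi> p (xs @ v # ys) + b * \<Psi> p (xs @ w # ys)"
      by (simp add: ev extend(2) l)
  qed
  show "symmetric_on (\<T> p) (\<Psi> p)"
    unfolding symmetric_on_def
  proof (intro allI impI, elim conjE)
    fix vs ws assume l: "set vs \<subseteq> \<T> p" "mset ws = mset vs"
    then have l': "set ws \<subseteq> \<T> p" using mset_eq_setD by blast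
    have "tensor_eval \<Psi> (map (extend p) ws) = tensor_eval \<Psi> (map (extend p) vs)"
      by (rule tensorialD(2)[OF T extend_list(1)[OF l(1)]]) (simp add: l)
    then show "\<Psi> p ws = \<Psi> p vs" using extend_list(2)[OF l(1)] extend_list(2)[OF l'] by metis
  qed
next
  show "\<forall>(U, c)\<in>A. \<forall>us\<in>lists Basis.
      smooth_on (c ` U) (\<lambda>x. let p = chart_inv (U, c) x in \<Psi> p (map (coord U c p) us))"
  proof (rule ballI, unfold split_paired_all prod.case, rule ballI)
      fix U c us assume U: "(U, c) \<in> A" and us: "us \<in> lists (Basis :: 'e set)"
    show "smooth_on (c ` U) (\<lambda>x. let p = chart_inv (U, c) x in \<Psi> p (map (coord U c p) us))"
    proof (rule smooth_on_local)
      fix x assume "x \<in> c ` U"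
      then obtain p where p: "p \<in> U" "x = c p" by blast
      obtain W E where W: "open W" "p \<in> W"
        and E: "\<And>i. i \<in> Basis \<Longrightarrow> E i \<in> \<XX>"
          "\<And>q i. q \<in> W \<Longrightarrow> i \<in> Basis \<Longrightarrow> E i q = coord U c q i"
        using local_frame[OF U p(1)] by metis
      have s: "smooth_on (c ` U) (\<lambda>x. tensor_eval \<Psi> (map E us) (chart_inv (U, c) x))"
        using us E by (intro smooth_functionsD[OF tensorialD(1)[OF T] U]) auto
      have eq: "map (\<lambda>X. X q) (map E us) = map (coord U c q) us" if "q \<in> W" for q
        using us E(2)[OF that] by auto
      show "\<exists>T g. open T \<and> x \<in> T \<and> smooth_on T g \<and>
         (\<forall>y\<in>T. (let p = chart_inv (U, c) y in \<Psi> p (map (coord U c p) us)) = g y)"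
      proof (intro exI conjI ballI)
        show "open (c ` (U \<inter> W))" using open_chart_image[OF U W(1)] .
        show "x \<in> c ` (U \<inter> W)" using p W by auto
        show "smooth_on (c ` (U \<inter> W)) (\<lambda>x. tensor_eval \<Psi> (map E us) (chart_inv (U, c) x))"
          by (rule smooth_on_subset[OF s]) auto
        show "(let p = chart_inv (U, c) y in \<Psi> p (map (coord U c p) us)) =
            tensor_eval \<Psi> (map E us) (chart_inv (U, c) y)" if "y \<in> c ` (U \<inter> W)" for y
        proof -
          have "chart_inv (U, c) y \<in> W" using that by (auto simp: chart_inv_left[OF U])
          from eq[OF this] show ?thesis by (simp only: tensor_eval_def Let_def)
        qed
      qed
    qed
  qed
  obtain n where n: "\<forall>Xs p. set Xs \<subseteq> \<XX> \<and> length Xs > n \<longrightarrow> tensor_eval \<Psi> Xs p = 0"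
    using tensorialD(4)[OF T] by blast
  show "\<exists>n. \<forall>p vs. length vs > n \<longrightarrow> \<Psi> p vs = 0"
  proof (intro exI allI impI)
    fix p vs assume "n < length (vs :: 'm tvec list)"
    show "\<Psi> p vs = 0"
    proof (cases "set vs \<subseteq> \<T> p")
      case True
      have "tensor_eval \<Psi> (map (extend p) vs) p = 0"
        using n extend_list(1)[OF True] \<open>length vs > n\<close> by (metis length_map)
      then show ?thesis using extend_list(2)[OF True] by metis
    qed (rule zero)
  qed
  show "\<not> set vs \<subseteq> \<T> p \<longrightarrow> \<Psi> p vs = 0" for p vs using zero by blast
qed

lemma sym_tensorsD:
  assumes "\<Phi> \<in> sym_tensors A"
  shows "multilinear_on (\<T> p) (\<Phi> p)" "symmetric_on (\<T> p) (\<Phi> p)"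
    "(U, c) \<in> A \<Longrightarrow> us \<in> lists Basis \<Longrightarrow>
      smooth_on (c ` U) (\<lambda>x. \<Phi> (chart_inv (U, c) x) (map (coord U c (chart_inv (U, c) x)) us))"
    "\<exists>n. \<forall>p vs. length vs > n \<longrightarrow> \<Phi> p vs = 0"
    "\<not> set vs \<subseteq> \<T> p \<Longrightarrow> \<Phi> p vs = 0"
  using assms unfolding sym_tensors_def Let_def by (blast, blast, fast, blast, blast)

lemma sym_tensors_symmetric:
  "\<Phi> \<in> sym_tensors A \<Longrightarrow> mset ws = mset vs \<Longrightarrow> \<Phi> p ws = \<Phi> p vs"
  using sym_tensorsD(2,5)[of \<Phi>] mset_eq_setD unfolding symmetric_on_def by metis

lemma sym_tensor_sum:
  assumes "\<Phi> \<in> sym_tensors A" "set xs \<subseteq> \<T> p" "set ys \<subseteq> \<T> p"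
    "finite I" "\<And>i. i \<in> I \<Longrightarrow> v i \<in> \<T> p"
  shows "\<Phi> p (xs @ (\<lambda>f. \<Sum>i\<in>I. a i * v i f) # ys) = (\<Sum>i\<in>I. a i * \<Phi> p (xs @ v i # ys))
    \<and> (\<lambda>f. \<Sum>i\<in>I. a i * v i f) \<in> \<T> p"
  using assms(4,5)
proof (induction I)
  case empty
  show ?case
    using multilinear_onD[OF sym_tensorsD(1)[OF assms(1)] assms(2,3) tangent_space_zero tangent_space_zero, of 0 0]
      tangent_space_zero by (simp add: zero_fun_def)
next
  case (insert i I)
  let ?w = "\<lambda>f. \<Sum>i\<in>I. a i * v i f"
  have w: "?w \<in> \<T> p" using insert by blast
  show ?case
    using multilinear_onD[OF sym_tensorsD(1)[OF assms(1)] assms(2,3), of "v i" ?w "a i" 1] insert w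
      tangent_space_lincomb[of "v i" p ?w "a i" 1] by simp
qed

text \<open>In a chart, \<open>\<Phi>(X\<^sub>1, \<dots>, X\<^sub>r)\<close> is a polynomial in the components of the fields and of \<open>\<Phi>\<close>. The
  induction expands the fields one after the other into coordinate fields.\<close>

lemma tensor_eval_smooth:
  assumes \<Phi>: "\<Phi> \<in> sym_tensors A" and "set Xs \<subseteq> \<XX>"
  shows "tensor_eval \<Phi> Xs \<in> \<F>"
proof (rule smooth_functionsI)
  fix U c assume U: "(U, c) \<in> A"
  note o = open_chart(2)[OF U]
  have "smooth_on (c ` U) (\<lambda>x. \<Phi> (chart_inv (U, c) x)
    (map (coord U c (chart_inv (U, c) x)) us @ map (\<lambda>X. X (chart_inv (U, c) x)) Xs))"
    if "us \<in> lists Basis" for us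
    using that assms(2)
  proof (induction Xs arbitrary: us)
    case Nil
    then show ?case using sym_tensorsD(3)[OF \<Phi> U] by simp
  next
    case (Cons X Xs)
    have X: "X \<in> \<XX>" using Cons.prems by simp
    obtain u where u: "smooth_on (c ` U) u" "\<And>p. p \<in> U \<Longrightarrow> X p = coord U c p (u (c p))"
      using vector_field_components[OF X U] by metis
    show ?case
    proof (rule smooth_on_cong[OF o])
      show "smooth_on (c ` U) (\<lambda>x. \<Sum>i\<in>Basis. (u x \<bullet> i) * \<Phi> (chart_inv (U, c) x)
        (map (coord U c (chart_inv (U, c) x)) (us @ [i]) @ map (\<lambda>X. X (chart_inv (U, c) x)) Xs))"
        using Cons.prems
        by (intro smooth_on_sum[OF o] smooth_on_mult[OF o] smooth_on_inner[OF o] u smooth_on_const Cons.IH) auto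
      fix x assume x: "x \<in> c ` U"
      define p where "p = chart_inv (U, c) x"
      have p: "p \<in> U" "c p = x" using x U by (auto simp: p_def chart_inv_in chart_inv_right)
      have "X p = (\<lambda>f. \<Sum>i\<in>Basis. (u x \<bullet> i) * coord U c p i f)"
        unfolding u(2)[OF p(1)] p(2) by (rule ext) (rule coord_vector_basis_sum[OF U p(1)])
      moreover have "set (map (coord U c p) us) \<subseteq> \<T> p"
        "set (map (\<lambda>X. X p) Xs) \<subseteq> \<T> p"
        using tangent_space_eq[OF U p(1)] by force (use Cons.prems vector_fields_tangent in auto)
      ultimately have "\<Phi> p (map (coord U c p) us @ X p # map (\<lambda>X. X p) Xs) =
          (\<Sum>i\<in>Basis. (u x \<bullet> i) * \<Phi> p (map (coord U c p) us @ coord U c p i # map (\<lambda>X. X p) Xs))"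
        using sym_tensor_sum[OF \<Phi>, of _ p _ Basis "coord U c p" "\<lambda>i. u x \<bullet> i"]
          tangent_space_eq[OF U p(1)] by simp
      then show "(\<Sum>i\<in>Basis. (u x \<bullet> i) * \<Phi> (chart_inv (U, c) x)
          (map (coord U c (chart_inv (U, c) x)) (us @ [i]) @ map (\<lambda>X. X (chart_inv (U, c) x)) Xs)) =
        \<Phi> (chart_inv (U, c) x)
         (map (coord U c (chart_inv (U, c) x)) us @ map (\<lambda>X. X (chart_inv (U, c) x)) (X # Xs))"
        unfolding p_def[symmetric] by simp
    qed
  qed
  from this[of "[]"] show "smooth_on (c ` U) (\<lambda>x. tensor_eval \<Phi> Xs (chart_inv (U, c) x))"
    by (simp add: tensor_eval_def)
qed

lemma tensorial_tensor_eval: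
  assumes \<Phi>: "\<Phi> \<in> sym_tensors A"
  shows "tensorial (tensor_eval \<Phi>)"
proof -
  obtain n where n: "\<And>p vs. length vs > n \<Longrightarrow> \<Phi> p vs = 0" using sym_tensorsD(4)[OF \<Phi>] by blast
  note m = multilinear_onD[OF sym_tensorsD(1)[OF \<Phi>], of "[]", simplified]
  have s: "set (map (\<lambda>X. X p) Zs) \<subseteq> \<T> p" if "set Zs \<subseteq> \<XX>" for Zs p
    using that vector_fields_tangent by auto
  show ?thesis
  proof (rule tensorialI[of _ n])
    show "tensor_eval \<Phi> Xs \<in> \<F>" if "set Xs \<subseteq> \<XX>" for Xs
      using tensor_eval_smooth[OF \<Phi> that] .
    show "tensor_eval \<Phi> Ys = tensor_eval \<Phi> Xs" if "mset Ys = mset Xs" for Xs Ys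
      unfolding tensor_eval_def by (rule ext, rule sym_tensors_symmetric[OF \<Phi>]) (simp add: that)
    show "tensor_eval \<Phi> (vf_lin f X g Y # Zs) p = f p * tensor_eval \<Phi> (X # Zs) p + g p * tensor_eval \<Phi> (Y # Zs) p"
      if "X \<in> \<XX>" "Y \<in> \<XX>" "set Zs \<subseteq> \<XX>" for f X g Y Zs p
    proof -
      have "vf_lin f X g Y p = (\<lambda>h. f p * X p h + g p * Y p h)" by (rule ext) (simp add: vf_scale_apply)
      then show ?thesis
        using m[OF s[OF that(3)] vector_fields_tangent[OF that(1)] vector_fields_tangent[OF that(2)], where a="f p" and b="g p"]
        by (simp only: tensor_eval_def list.map)
    qed
    show "tensor_eval \<Phi> Xs p = 0" if "length Xs > n" for Xs p
      using n that by (simp add: tensor_eval_def)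
  qed
qed

lemma sym_tensors_eqI:
  assumes "\<Phi> \<in> sym_tensors A" "\<Psi> \<in> sym_tensors A"
    and "\<And>Xs p. set Xs \<subseteq> \<XX> \<Longrightarrow> tensor_eval \<Phi> Xs p = tensor_eval \<Psi> Xs p"
  shows "\<Phi> = \<Psi>"
proof (intro ext)
  fix p vs
  show "\<Phi> p vs = \<Psi> p vs"
  proof (cases "set vs \<subseteq> \<T> p")
    case True
    show ?thesis
      using assms(3)[OF extend_list(1)[OF True], of p] unfolding extend_list(2)[OF True] .
  next
    case False
    then show ?thesis by (simp add: sym_tensorsD(5)[OF assms(1)] sym_tensorsD(5)[OF assms(2)])
  qed
qed

text \<open>The tensor takes the value of \<open>T\<close> on arbitrary extensions of the tangent vectors; by
  \<open>tensorial_pointwise\<close> the choice does not matter.\<close>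

lemma tensor_of:
  assumes T: "tensorial T"
  shows "tensor_of A T \<in> sym_tensors A"
    "set Xs \<subseteq> \<XX> \<Longrightarrow> tensor_eval (tensor_of A T) Xs p = T Xs p"
proof -
  define \<Psi> where "\<Psi> p vs = (if set vs \<subseteq> \<T> p then T (map (extend p) vs) p else 0)" for p vs
  have ev: "tensor_eval \<Psi> Xs p = T Xs p" if Xs: "set Xs \<subseteq> \<XX>" for Xs p
  proof -
    have s: "set (map (\<lambda>X. X p) Xs) \<subseteq> \<T> p" using Xs vector_fields_tangent by auto
    have "map (\<lambda>X. X p) (map (extend p) (map (\<lambda>X. X p) Xs)) = map (\<lambda>X. X p) Xs"
      using s extend(2) by auto
    from tensorial_pointwise[OF T, of "[]", OF _ extend_list(1)[OF s] Xs this] show ?thesis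
      using s by (simp add: tensor_eval_def \<Psi>_def)
  qed
  have \<Psi>: "\<Psi> \<in> sym_tensors A"
    by (rule sym_tensorsI[OF tensorial_cong[OF T ev]]) (auto simp: \<Psi>_def)
  have "tensor_of A T = \<Psi>"
    unfolding tensor_of_def
  proof (rule the_equality)
    show "\<Psi> \<in> sym_tensors A \<and> (\<forall>Xs\<in>lists (\<XX>). tensor_eval \<Psi> Xs = T Xs)"
      using \<Psi> ev by (auto simp: lists_eq_set)
    show "\<Phi> = \<Psi>" if "\<Phi> \<in> sym_tensors A \<and> (\<forall>Xs\<in>lists (\<XX>). tensor_eval \<Phi> Xs = T Xs)" for \<Phi>
      by (rule sym_tensors_eqI) (use that \<Psi> ev in \<open>auto simp: lists_eq_set\<close>)
  qed
  then show "tensor_of A T \<in> sym_tensors A"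
    "set Xs \<subseteq> \<XX> \<Longrightarrow> tensor_eval (tensor_of A T) Xs p = T Xs p"
    using \<Psi> ev by auto
qed

definition module_endomorphism :: "('m vfield \<Rightarrow> 'm vfield) \<Rightarrow> bool" where
  "module_endomorphism S \<longleftrightarrow> (\<forall>Z\<in>\<XX>. S Z \<in> \<XX>) \<and>
    (\<forall>f\<in>\<F>. \<forall>Y\<in>\<XX>. \<forall>g\<in>\<F>. \<forall>Z\<in>\<XX>. S (vf_lin f Y g Z) = vf_lin f (S Y) g (S Z))"

lemma module_endomorphismD:
  assumes "module_endomorphism S"
  shows "Z \<in> \<XX> \<Longrightarrow> S Z \<in> \<XX>"
    "f \<in> \<F> \<Longrightarrow> Y \<in> \<XX> \<Longrightarrow> g \<in> \<F> \<Longrightarrow> Z \<in> \<XX> \<Longrightarrow> S (vf_lin f Y g Z) = vf_lin f (S Y) g (S Z)"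
    "Y \<in> \<XX> \<Longrightarrow> Z \<in> \<XX> \<Longrightarrow> S (Y + Z) = S Y + S Z"
    "f \<in> \<F> \<Longrightarrow> Z \<in> \<XX> \<Longrightarrow> S (vf_scale f Z) = vf_scale f (S Z)"
proof -
  note s = assms[unfolded module_endomorphism_def]
  show "Z \<in> \<XX> \<Longrightarrow> S Z \<in> \<XX>" by (rule s[THEN conjunct1, THEN bspec])
  note lin = s[THEN conjunct2, THEN bspec, THEN bspec, THEN bspec, THEN bspec]
  show "f \<in> \<F> \<Longrightarrow> Y \<in> \<XX> \<Longrightarrow> g \<in> \<F> \<Longrightarrow> Z \<in> \<XX> \<Longrightarrow> S (vf_lin f Y g Z) = vf_lin f (S Y) g (S Z)"
    by (rule lin)
  show "S (Y + Z) = S Y + S Z" if "Y \<in> \<XX>" "Z \<in> \<XX>"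
    using lin[OF smooth_functions_const that(1) smooth_functions_const that(2), of 1 1] unfolding vf_lin_simps .
  show "S (vf_scale f Z) = vf_scale f (S Z)" if "f \<in> \<F>" "Z \<in> \<XX>"
    using lin[OF that smooth_functions_const that(2), of 0] unfolding vf_lin_simps .
qed

lemma sym_vtensorsD:
  assumes "\<sigma> \<in> sym_vtensors A k"
  shows "set vs \<subseteq> \<T> p \<Longrightarrow> \<sigma> p vs \<in> \<T> p"
    and "length vs \<noteq> k \<or> \<not> set vs \<subseteq> \<T> p \<Longrightarrow> \<sigma> p vs = 0"
proof -
  note s = assms[unfolded sym_vtensors_def mem_Collect_eq]
  show "set vs \<subseteq> \<T> p \<Longrightarrow> \<sigma> p vs \<in> \<T> p"
    using s[THEN conjunct2, THEN conjunct1] by (simp add: lists_eq_set)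
  show "length vs \<noteq> k \<or> \<not> set vs \<subseteq> \<T> p \<Longrightarrow> \<sigma> p vs = 0"
    using s[THEN conjunct2, THEN conjunct2, THEN conjunct2] by blast
qed

text \<open>The value on a tangent vector is again that of an arbitrary extension. For a coordinate vector,
  the components of the result are smooth near each point of the chart, where a frame extends the
  coordinate field; being unique (\<open>coord_vector_inject\<close>), they fit together.\<close>

lemma endo_of:
  assumes "module_endomorphism S"
  shows "endo_of A S \<in> sym_vtensors A 1"
    "Z \<in> \<XX> \<Longrightarrow> endo_of A S p [Z p] = S Z p"
proof -
  note S = module_endomorphismD(1)[OF assms] and add = module_endomorphismD(3)[OF assms]
    and scale = module_endomorphismD(4)[OF assms]
  define \<sigma> where "\<sigma> p vs = (if length vs = 1 \<and> set vs \<subseteq> \<T> p then S (extend p (hd vs)) p else 0)"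
    for p vs
  have pw: "S Y p = S Z p" if "Y \<in> \<XX>" "Z \<in> \<XX>" "Y p = Z p" for Y Z p
    by (rule ext, rule function_linear_pointwise[of "\<lambda>Z. S Z p f" p for f])
      (use that in \<open>simp_all add: add scale vf_scale_apply\<close>)
  have ev: "\<sigma> p [Z p] = S Z p" if "Z \<in> \<XX>" for Z p
    using pw[of "extend p (Z p)" Z p] that vector_fields_tangent[OF that, of p] extend[of "Z p" p]
    by (simp add: \<sigma>_def)
  have \<sigma>: "\<sigma> \<in> sym_vtensors A 1"
    unfolding sym_vtensors_def
  proof (intro CollectI conjI allI)
    fix p f
    show "multilinear_on (\<T> p) (\<lambda>vs. \<sigma> p vs f)"
      unfolding multilinear_on_def
    proof (intro allI impI, elim conjE)
      fix xs ys v w a b assume vw: "v \<in> \<T> p" "w \<in> \<T> p"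
      let ?v = "vf_scale (\<lambda>_. a) (extend p v)" and ?w = "vf_scale (\<lambda>_. b) (extend p w)"
      have V: "?v \<in> \<XX>" "?w \<in> \<XX>"
        using vw by (auto intro!: vector_fields_scale smooth_functions_const extend)
      have "(?v + ?w) p = (\<lambda>f. a * v f + b * w f)"
        by (rule ext) (simp add: vf_scale_def extend(2) vw)
      then have "\<sigma> p [\<lambda>f. a * v f + b * w f] f = S (?v + ?w) p f"
        using ev[OF vector_fields_add[OF V], of p] by simp
      also have "\<dots> = a * S (extend p v) p f + b * S (extend p w) p f"
        using vw V by (simp add: add scale extend smooth_functions_const vf_scale_apply)
      also have "\<dots> = a * \<sigma> p [v] f + b * \<sigma> p [w] f"
        using vw by (simp add: \<sigma>_def)
      finally show "\<sigma> p (xs @ (\<lambda>f. a * v f + b * w f) # ys) f = a * \<sigma> p (xs @ v # ys) f + b * \<sigma> p (xs @ w # ys) f"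
        by (cases "xs = [] \<and> ys = []") (auto simp: \<sigma>_def)
    qed
  next
    fix p
    show "symmetric_on (\<T> p) (\<sigma> p)"
      unfolding symmetric_on_def
    proof (intro allI impI, elim conjE)
      fix vs ws :: "'m tvec list" assume e: "mset ws = mset vs"
      show "\<sigma> p ws = \<sigma> p vs"
      proof (cases "length vs = 1")
        case True
        then obtain v where "vs = [v]" by (auto simp: length_Suc_conv)
        then show ?thesis using e by simp
      next
        case False
        then show ?thesis using mset_eq_length[OF e] by (simp add: \<sigma>_def)
      qed
    qed
    show "\<forall>vs\<in>lists (\<T> p). \<sigma> p vs \<in> \<T> p"
      using extend(1) S vector_fields_tangent tangent_space_zero
      by (auto simp: \<sigma>_def length_Suc_conv)
  next
    show "\<forall>(U, c)\<in>A. \<forall>us\<in>lists Basis. \<exists>w. smooth_on (c ` U) w \<and>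
        (\<forall>p\<in>U. \<sigma> p (map (coord U c p) us) = coord U c p (w (c p)))"
    proof (rule ballI, unfold split_paired_all prod.case, rule ballI)
      fix U c us assume U: "(U, c) \<in> A" and us: "us \<in> lists (Basis :: 'e set)"
      show "\<exists>w. smooth_on (c ` U) w \<and>
        (\<forall>p\<in>U. \<sigma> p (map (coord U c p) us) = coord U c p (w (c p)))"
      proof (cases "length us = 1")
        case False
        then show ?thesis
          using coord_vector_zero[OF U] by (intro exI[of _ "\<lambda>_. 0"]) (auto simp: \<sigma>_def smooth_on_const)
      next
        case True
        then obtain i where i: "us = [i]" "i \<in> Basis" using us by (auto simp: length_Suc_conv)
        have loc: "\<exists>W w. open W \<and> p \<in> W \<and> smooth_on (c ` U) w \<and>
            (\<forall>q\<in>U \<inter> W. \<sigma> q [coord U c q i] = coord U c q (w (c q)))" if p: "p \<in> U" for p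
        proof -
          obtain W E where W: "open W" "p \<in> W"
            and E: "\<And>i. i \<in> Basis \<Longrightarrow> E i \<in> \<XX>"
              "\<And>q i. q \<in> W \<Longrightarrow> i \<in> Basis \<Longrightarrow> E i q = coord U c q i"
            using local_frame[OF U p] by metis
          obtain w where "smooth_on (c ` U) w" "\<And>q. q \<in> U \<Longrightarrow> S (E i) q = coord U c q (w (c q))"
            using vector_field_components[OF S[OF E(1)[OF i(2)]] U] by metis
          then show ?thesis using W E i ev by (metis Int_iff)
        qed
        define w where "w x = (THE u. \<sigma> (chart_inv (U, c) x) [coord U c (chart_inv (U, c) x) i] =
            coord U c (chart_inv (U, c) x) u)" for x
        have w: "w (c q) = u" if "q \<in> U" "\<sigma> q [coord U c q i] = coord U c q u" for q u
          unfolding w_def chart_inv_left[OF U that(1)]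
          by (rule the_equality) (use that coord_vector_inject[OF U that(1)] in auto)
        have "smooth_on (c ` U) w"
        proof (rule smooth_on_local)
          fix x assume "x \<in> c ` U"
          then obtain p where p: "p \<in> U" "x = c p" by blast
          from loc[OF p(1)] obtain W w' where W: "open W" "p \<in> W" "smooth_on (c ` U) w'"
            "\<And>q. q \<in> U \<inter> W \<Longrightarrow> \<sigma> q [coord U c q i] = coord U c q (w' (c q))"
            by blast
          have "\<forall>y\<in>c ` (U \<inter> W). w y = w' y" using w W(4) by auto
          then show "\<exists>T g. open T \<and> x \<in> T \<and> smooth_on T g \<and> (\<forall>y\<in>T. w y = g y)"
            using open_chart_image[OF U W(1)] W p smooth_on_subset[OF W(3), of "c ` (U \<inter> W)"] by blast
        qed
        moreover have "\<sigma> p [coord U c p i] = coord U c p (w (c p))" if "p \<in> U" for p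
          using loc[OF that] w[OF that] that by (metis IntI)
        ultimately show ?thesis using i by auto
      qed
    qed
    show "length vs \<noteq> 1 \<or> \<not> set vs \<subseteq> \<T> p \<longrightarrow> \<sigma> p vs = 0" for p vs
      by (auto simp: \<sigma>_def)
  qed
  have "endo_of A S = \<sigma>"
    unfolding endo_of_def
  proof (rule the_equality)
    show "\<sigma> \<in> sym_vtensors A 1 \<and> (\<forall>Z\<in>\<XX>. tensor_eval \<sigma> [Z] = S Z)"
      using \<sigma> ev by (auto simp: tensor_eval_def)
    fix \<tau> assume \<tau>: "\<tau> \<in> sym_vtensors A 1 \<and> (\<forall>Z\<in>\<XX>. tensor_eval \<tau> [Z] = S Z)"
    show "\<tau> = \<sigma>"
    proof (intro ext)
      fix p vs f
      show "\<tau> p vs f = \<sigma> p vs f"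
      proof (cases "length vs = 1 \<and> set vs \<subseteq> \<T> p")
        case True
        then obtain v where v: "vs = [v]" "v \<in> \<T> p" by (auto simp: length_Suc_conv)
        have "tensor_eval \<tau> [extend p v] p = S (extend p v) p" using \<tau> extend(1)[OF v(2)] by auto
        then show ?thesis using v extend(2)[OF v(2)] by (simp add: tensor_eval_def \<sigma>_def)
      next
        case False
        then have f: "length vs \<noteq> 1 \<or> \<not> set vs \<subseteq> \<T> p" by blast
        show ?thesis
          unfolding sym_vtensorsD(2)[OF \<sigma> f] sym_vtensorsD(2)[OF conjunct1[OF \<tau>] f] ..
      qed
    qed
  qed
  then show "endo_of A S \<in> sym_vtensors A 1"
    "Z \<in> \<XX> \<Longrightarrow> endo_of A S p [Z p] = S Z p"
    using \<sigma> ev by auto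
qed

end

section \<open>Derivations of tensors, the symmetric derivative and the symmetric Lie derivative\<close>

lemma sum_fun_apply: "(\<Sum>i\<in>I. f i) x = (\<Sum>i\<in>I. f i x)"
  by (induction I rule: infinite_finite_induct) auto

text \<open>Expressions that sum over the positions of a list are symmetric if the summands depend only on
  the entry at the position and on the list up to order.\<close>

lemma sum_positions_permute:
  assumes "mset ys = mset xs"
    and "\<And>i j. i < length xs \<Longrightarrow> j < length ys \<Longrightarrow> ys ! j = xs ! i \<Longrightarrow> H ys j = H xs i"
  shows "(\<Sum>j<length ys. H ys j) = (\<Sum>i<length xs. H xs i)"
proof -
  obtain \<pi> where \<pi>: "\<pi> permutes {..<length xs}" "permute_list \<pi> xs = ys"
    using assms(1) mset_eq_permutation by metis
  have l: "length ys = length xs" using \<pi>(2) by auto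
  have "(\<Sum>i<length xs. H xs i) = (\<Sum>j<length xs. H xs (\<pi> j))"
    using sum.permute[OF \<pi>(1), of "H xs"] by (simp add: o_def)
  also have "\<dots> = (\<Sum>j<length ys. H ys j)"
  proof (rule sum.cong)
    fix j assume j: "j \<in> {..<length ys}"
    then have "\<pi> j < length xs" using permutes_in_image[OF \<pi>(1), of j] l by simp
    moreover have "ys ! j = xs ! \<pi> j" using permute_list_nth[OF \<pi>(1)] \<pi>(2) j l by auto
    ultimately show "H xs (\<pi> j) = H ys j" using assms(2)[of "\<pi> j" j] j by simp
  qed (simp add: l)
  finally show ?thesis ..
qed

lemma mset_remove_nth: "j < length xs \<Longrightarrow> add_mset (xs ! j) (mset (take j xs @ drop (Suc j) xs)) = mset xs"
  by (subst (4) id_take_nth_drop[of j xs]) auto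

lemma mset_update_eq: "j < length xs \<Longrightarrow> mset (xs[j := z]) = mset (z # take j xs @ drop (Suc j) xs)"
  by (simp add: upd_conv_take_nth_drop)

definition symmetric_bracket :: "'m connection \<Rightarrow> 'm vfield \<Rightarrow> 'm vfield \<Rightarrow> 'm vfield" where
  "symmetric_bracket D X Z = D X Z + D Z X"

context smooth_manifold
begin

lemma set_update_vector_fields:
  "set Zs \<subseteq> \<XX> \<Longrightarrow> Z \<in> \<XX> \<Longrightarrow> set (Zs[j := Z]) \<subseteq> \<XX>"
  using set_update_subset_insert[of Zs j Z] by auto

lemma set_remove_subset: "set Zs \<subseteq> V \<Longrightarrow> set (take j Zs @ drop (Suc j) Zs) \<subseteq> V"
  using set_take_subset set_drop_subset by fastforce

lemma tensorial_update:
  assumes "tensorial T" "set Zs \<subseteq> \<XX>" "Z \<in> \<XX>" "j < length Zs"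
  shows "T (Zs[j := Z]) = T (Z # take j Zs @ drop (Suc j) Zs)"
  by (rule tensorialD(2)[OF assms(1) _ mset_update_eq[OF assms(4)]])
    (use assms(2,3) set_remove_subset[of Zs] in auto)

lemma tensorial_update_add:
  assumes "tensorial T" "set Zs \<subseteq> \<XX>" "X \<in> \<XX>" "Y \<in> \<XX>"
    "j < length Zs"
  shows "T (Zs[j := X + Y]) p = T (Zs[j := X]) p + T (Zs[j := Y]) p"
  unfolding tensorial_update[OF assms(1,2,3,5)] tensorial_update[OF assms(1,2,4,5)]
    tensorial_update[OF assms(1,2) vector_fields_add[OF assms(3,4)] assms(5)]
  by (rule tensorial_add[OF assms(1,3,4) set_remove_subset[OF assms(2)]])

lemma tensorial_update_lin:
  assumes "tensorial T" "set Zs \<subseteq> \<XX>" "f \<in> \<F>" "X \<in> \<XX>" "g \<in> \<F>" "Y \<in> \<XX>" "j < length Zs"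
  shows "T (Zs[j := vf_lin f X g Y]) p = f p * T (Zs[j := X]) p + g p * T (Zs[j := Y]) p"
  unfolding tensorial_update[OF assms(1,2,4,7)] tensorial_update[OF assms(1,2,6,7)]
    tensorial_update[OF assms(1,2) vf_lin_vector_fields[OF assms(3-6)] assms(7)]
  by (rule tensorialD(3)[OF assms(1,3-6) set_remove_subset[OF assms(2)]])

lemma tensorial_update_diff:
  assumes "tensorial T" "set Zs \<subseteq> \<XX>" "X \<in> \<XX>" "Y \<in> \<XX>"
    "j < length Zs"
  shows "T (Zs[j := X - Y]) p = T (Zs[j := X]) p - T (Zs[j := Y]) p"
proof -
  have "X - Y + Y = X" by simp
  then show ?thesis
    using tensorial_update_add[OF assms(1,2) vector_fields_diff[OF assms(3,4)] assms(4,5), of p] by simp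
qed

lemma tensorial_Cons:
  assumes T: "tensorial T" and X: "X \<in> \<XX>"
  shows "tensorial (\<lambda>Zs. T (X # Zs))"
proof -
  obtain n where n: "\<And>Xs p. set Xs \<subseteq> \<XX> \<Longrightarrow> length Xs > n \<Longrightarrow> T Xs p = 0"
    using tensorialD(4)[OF T] by blast
  have swap: "T (X # Y # Zs) = T (Y # X # Zs)" if "Y \<in> \<XX>" "set Zs \<subseteq> \<XX>" for Y Zs
    by (rule tensorialD(2)[OF T]) (use that X in auto)
  show ?thesis
  proof (rule tensorialI[of _ n])
    show "T (X # Zs) \<in> \<F>" if "set Zs \<subseteq> \<XX>" for Zs
      by (rule tensorialD(1)[OF T]) (use that X in auto)
    show "T (X # Ys) = T (X # Zs)" if "set Zs \<subseteq> \<XX>" "mset Ys = mset Zs" for Ys Zs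
      by (rule tensorialD(2)[OF T]) (use that X in auto)
    show "T (X # vf_lin f Y g Z # Zs) p = f p * T (X # Y # Zs) p + g p * T (X # Z # Zs) p"
      if V: "f \<in> \<F>" "Y \<in> \<XX>" "g \<in> \<F>" "Z \<in> \<XX>" "set Zs \<subseteq> \<XX>" for f Y g Z Zs p
      unfolding swap[OF V(2,5)] swap[OF V(4,5)] swap[OF vf_lin_vector_fields[OF V(1-4)] V(5)]
      by (rule tensorialD(3)[OF T V(1-4)]) (use V X in auto)
    show "T (X # Zs) p = 0" if "set Zs \<subseteq> \<XX>" "length Zs > n" for Zs p
      by (rule n) (use that X in auto)
  qed
qed

lemma tensorial_lincomb:
  assumes S: "tensorial S" and T: "tensorial T"
  shows "tensorial (\<lambda>Zs p. a * S Zs p + b * T Zs p)"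
proof -
  obtain n where n: "\<And>Xs p. set Xs \<subseteq> \<XX> \<Longrightarrow> length Xs > n \<Longrightarrow> S Xs p = 0"
    using tensorialD(4)[OF S] by blast
  obtain m where m: "\<And>Xs p. set Xs \<subseteq> \<XX> \<Longrightarrow> length Xs > m \<Longrightarrow> T Xs p = 0"
    using tensorialD(4)[OF T] by blast
  show ?thesis
  proof (rule tensorialI[of _ "max n m"])
    show "(\<lambda>p. a * S Zs p + b * T Zs p) \<in> \<F>" if "set Zs \<subseteq> \<XX>" for Zs
      by (rule smooth_functions_add smooth_functions_mult smooth_functions_const
          tensorialD(1)[OF S that] tensorialD(1)[OF T that])+
    show "(\<lambda>p. a * S Ys p + b * T Ys p) = (\<lambda>p. a * S Zs p + b * T Zs p)"
      if "set Zs \<subseteq> \<XX>" "mset Ys = mset Zs" for Ys Zs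
      unfolding tensorialD(2)[OF S that] tensorialD(2)[OF T that] ..
  qed (simp_all add: tensorialD(3)[OF S] tensorialD(3)[OF T] n m algebra_simps)
qed

lemma sym_tensors_lincomb:
  assumes "\<Phi> \<in> sym_tensors A" "\<Psi> \<in> sym_tensors A"
  shows "(\<lambda>p vs. a * \<Phi> p vs + b * \<Psi> p vs) \<in> sym_tensors A"
proof (rule sym_tensorsI)
  show "tensorial (tensor_eval (\<lambda>p vs. a * \<Phi> p vs + b * \<Psi> p vs))"
    using tensorial_lincomb[OF assms[THEN tensorial_tensor_eval]] by (simp add: tensor_eval_def[abs_def])
qed (simp add: sym_tensorsD(5)[OF assms(1)] sym_tensorsD(5)[OF assms(2)])

lemma sym_tensors_diff:
  assumes "\<Phi> \<in> sym_tensors A" "\<Psi> \<in> sym_tensors A"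
  shows "\<Phi> - \<Psi> \<in> sym_tensors A"
proof -
  have "\<Phi> - \<Psi> = (\<lambda>p vs. 1 * \<Phi> p vs + (-1) * \<Psi> p vs)" by (intro ext) simp
  then show ?thesis by (rule ssubst) (rule sym_tensors_lincomb[OF assms])
qed

lemma sym_tensors_add:
  assumes "\<Phi> \<in> sym_tensors A" "\<Psi> \<in> sym_tensors A"
  shows "\<Phi> + \<Psi> \<in> sym_tensors A"
proof -
  have "\<Phi> + \<Psi> = (\<lambda>p vs. 1 * \<Phi> p vs + 1 * \<Psi> p vs)" by (intro ext) simp
  then show ?thesis by (rule ssubst) (rule sym_tensors_lincomb[OF assms])
qed

lemma contraction_sym_tensors:
  assumes "\<Phi> \<in> sym_tensors A" "X \<in> \<XX>"
  shows "contraction X \<Phi> \<in> sym_tensors A"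
proof (rule sym_tensorsI)
  show "tensorial (tensor_eval (contraction X \<Phi>))"
    using tensorial_Cons[OF tensorial_tensor_eval[OF assms(1)] assms(2)]
    by (simp add: tensor_eval_def[abs_def] contraction_def)
  show "contraction X \<Phi> p vs = 0" if "\<not> set vs \<subseteq> \<T> p" for p vs
    using that by (simp add: contraction_def sym_tensorsD(5)[OF assms(1)])
qed

lemma tensor_eval_contraction: "tensor_eval (contraction X \<Phi>) Zs = tensor_eval \<Phi> (X # Zs)"
  by (simp add: tensor_eval_def contraction_def)

text \<open>A derivation \<open>S\<close> of the module of vector fields over the derivation \<open>X\<close> of functions induces
  \<open>(P \<Phi>)(Z\<^sub>1, \<dots>, Z\<^sub>r) = X(\<Phi>(Z\<^sub>1, \<dots>, Z\<^sub>r)) - \<Sum>\<^sub>j \<Phi>(Z\<^sub>1, \<dots>, S Z\<^sub>j, \<dots>, Z\<^sub>r)\<close>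
  on tensors. This covers \<open>\<nabla>\<^sub>X\<close> with \<open>S = \<nabla>\<^sub>X\<close>, the symmetric Lie derivative with
  \<open>S Z = \<nabla>\<^sub>XZ + \<nabla>\<^sub>ZX\<close>, and, up to sign, the contraction with an endomorphism \<open>S\<close>, for which \<open>X = 0\<close>.\<close>

definition module_derivation :: "'m vfield \<Rightarrow> ('m vfield \<Rightarrow> 'm vfield) \<Rightarrow> bool" where
  "module_derivation X S \<longleftrightarrow> X \<in> \<XX> \<and>
    (\<forall>Z\<in>\<XX>. S Z \<in> \<XX>) \<and>
    (\<forall>Y\<in>\<XX>. \<forall>Z\<in>\<XX>. S (Y + Z) = S Y + S Z) \<and>
    (\<forall>f\<in>\<F>. \<forall>Z\<in>\<XX>.
      S (vf_scale f Z) = vf_scale (vf_apply X f) Z + vf_scale f (S Z))"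

lemma module_derivationD:
  assumes "module_derivation X S"
  shows "X \<in> \<XX>"
    "Z \<in> \<XX> \<Longrightarrow> S Z \<in> \<XX>"
    "Y \<in> \<XX> \<Longrightarrow> Z \<in> \<XX> \<Longrightarrow> S (Y + Z) = S Y + S Z"
    "f \<in> \<F> \<Longrightarrow> Z \<in> \<XX> \<Longrightarrow>
      S (vf_scale f Z) = vf_scale (vf_apply X f) Z + vf_scale f (S Z)"
proof -
  note s = assms[unfolded module_derivation_def]
  show "X \<in> \<XX>" using s by blast
  show "Z \<in> \<XX> \<Longrightarrow> S Z \<in> \<XX>" using s by blast
  show "Y \<in> \<XX> \<Longrightarrow> Z \<in> \<XX> \<Longrightarrow> S (Y + Z) = S Y + S Z"
    by (rule s[THEN conjunct2, THEN conjunct2, THEN conjunct1, THEN bspec, THEN bspec])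
  show "f \<in> \<F> \<Longrightarrow> Z \<in> \<XX> \<Longrightarrow>
      S (vf_scale f Z) = vf_scale (vf_apply X f) Z + vf_scale f (S Z)"
    by (rule s[THEN conjunct2, THEN conjunct2, THEN conjunct2, THEN bspec, THEN bspec])
qed

definition induced_derivation ::
    "'m vfield \<Rightarrow> ('m vfield \<Rightarrow> 'm vfield) \<Rightarrow> 'm tensor \<Rightarrow> 'm vfield list \<Rightarrow> 'm \<Rightarrow> real" where
  "induced_derivation X S \<Phi> Zs p =
    X p (tensor_eval \<Phi> Zs) - (\<Sum>j<length Zs. tensor_eval \<Phi> (Zs[j := S (Zs ! j)]) p)"

lemma induced_derivation_smooth:
  assumes "module_derivation X S" "\<Phi> \<in> sym_tensors A" "set Zs \<subseteq> \<XX>"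
  shows "(\<lambda>p. X p (tensor_eval \<Phi> Zs)) \<in> \<F>"
    "(\<lambda>p. \<Sum>j<length Zs. tensor_eval \<Phi> (Zs[j := S (Zs ! j)]) p) \<in> \<F>"
proof -
  note T = tensorial_tensor_eval[OF assms(2)]
  show "(\<lambda>p. X p (tensor_eval \<Phi> Zs)) \<in> \<F>"
    using vf_apply_smooth[OF module_derivationD(1)[OF assms(1)] tensorialD(1)[OF T assms(3)]]
    by (simp add: vf_apply_def)
  show "(\<lambda>p. \<Sum>j<length Zs. tensor_eval \<Phi> (Zs[j := S (Zs ! j)]) p) \<in> \<F>"
  proof (rule smooth_functions_sum)
    fix j assume "j \<in> {..<length Zs}"
    then have "Zs ! j \<in> \<XX>" using assms(3) nth_mem by blast
    then show "tensor_eval \<Phi> (Zs[j := S (Zs ! j)]) \<in> \<F>"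
      by (intro tensorialD(1)[OF T] set_update_vector_fields assms module_derivationD(2)[OF assms(1)])
  qed
qed

text \<open>The term \<open>(X f) Z\<close> from \<open>S (f Z)\<close> cancels the one from \<open>X(f \<Phi>(Z, \<dots>))\<close>.\<close>

lemma tensorial_induced_derivation:
  assumes S: "module_derivation X S" and \<Phi>: "\<Phi> \<in> sym_tensors A"
  shows "tensorial (induced_derivation X S \<Phi>)"
proof -
  let ?E = "tensor_eval \<Phi>"
  note T = tensorial_tensor_eval[OF \<Phi>]
  note X = module_derivationD(1)[OF S]
  note XT = vector_fields_tangent[OF X]
  obtain n where n: "\<And>Xs p. set Xs \<subseteq> \<XX> \<Longrightarrow> length Xs > n \<Longrightarrow> ?E Xs p = 0"
    using tensorialD(4)[OF T] by blast
  have up: "set (Zs[j := S (Zs ! j)]) \<subseteq> \<XX>" if "set Zs \<subseteq> \<XX>" "j < length Zs" for Zs j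
    using that by (intro set_update_vector_fields module_derivationD(2)[OF S]) auto
  have Cons: "induced_derivation X S \<Phi> (Y # Zs) p =
      X p (?E (Y # Zs)) - ?E (S Y # Zs) p - (\<Sum>j<length Zs. ?E (Y # Zs[j := S (Zs ! j)]) p)" for Y Zs p
    by (simp add: induced_derivation_def sum.lessThan_Suc_shift del: sum.lessThan_Suc)
  show ?thesis
  proof (rule tensorialI[of _ n])
    show "induced_derivation X S \<Phi> Zs \<in> \<F>" if "set Zs \<subseteq> \<XX>" for Zs
      using smooth_functions_diff[OF induced_derivation_smooth[OF S \<Phi> that]]
      by (simp add: induced_derivation_def[abs_def])
    show "induced_derivation X S \<Phi> Ys = induced_derivation X S \<Phi> Zs"
      if Zs: "set Zs \<subseteq> \<XX>" and eq: "mset Ys = mset Zs" for Ys Zs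
    proof
      fix p
      have "(\<Sum>j<length Ys. ?E (Ys[j := S (Ys ! j)]) p) = (\<Sum>j<length Zs. ?E (Zs[j := S (Zs ! j)]) p)"
      proof (rule sum_positions_permute[OF eq])
        fix i j assume ij: "i < length Zs" "j < length Ys" "Ys ! j = Zs ! i"
        have "?E (Ys[j := S (Ys ! j)]) = ?E (Zs[i := S (Zs ! i)])"
          by (rule tensorialD(2)[OF T up[OF Zs ij(1)]]) (simp add: mset_update ij eq)
        then show "?E (Ys[j := S (Ys ! j)]) p = ?E (Zs[i := S (Zs ! i)]) p" by simp
      qed
      then show "induced_derivation X S \<Phi> Ys p = induced_derivation X S \<Phi> Zs p"
        by (simp only: induced_derivation_def tensorialD(2)[OF T Zs eq])
    qed
    show "induced_derivation X S \<Phi> (vf_lin f Y g Z # Zs) p =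
        f p * induced_derivation X S \<Phi> (Y # Zs) p + g p * induced_derivation X S \<Phi> (Z # Zs) p"
      if V: "f \<in> \<F>" "Y \<in> \<XX>" "g \<in> \<F>" "Z \<in> \<XX>" "set Zs \<subseteq> \<XX>" for f Y g Z Zs p
    proof -
      have sm: "?E (W # Zs) \<in> \<F>" if "W \<in> \<XX>" for W
        by (rule tensorialD(1)[OF T]) (use V that in auto)
      have "?E (vf_lin f Y g Z # Zs) = (\<lambda>p. f p * ?E (Y # Zs) p + g p * ?E (Z # Zs) p)"
        by (rule ext) (rule tensorialD(3)[OF T V])
      then have 1: "X p (?E (vf_lin f Y g Z # Zs)) =
          X p f * ?E (Y # Zs) p + f p * X p (?E (Y # Zs)) + (X p g * ?E (Z # Zs) p + g p * X p (?E (Z # Zs)))"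
        using V sm by (simp add: tangent_vector_add[OF XT] tangent_vector_mult[OF XT] smooth_functions_mult)
      have SW: "S (vf_scale f W) \<in> \<XX>" "?E (S (vf_scale f W) # Zs) p = X p f * ?E (W # Zs) p + f p * ?E (S W # Zs) p"
        if fW: "f \<in> \<F>" "W \<in> \<XX>" for f W
      proof -
        show "S (vf_scale f W) \<in> \<XX>"
          by (rule module_derivationD(2)[OF S vector_fields_scale[OF fW]])
        have "vf_apply X f \<in> \<F>" "S W \<in> \<XX>"
          using vf_apply_smooth[OF X fW(1)] module_derivationD(2)[OF S fW(2)] .
        from tensorialD(3)[OF T this(1) fW(2,1) this(2) V(5), of p]
        show "?E (S (vf_scale f W) # Zs) p = X p f * ?E (W # Zs) p + f p * ?E (S W # Zs) p"
          unfolding module_derivationD(4)[OF S fW] by (simp add: vf_apply_def)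
      qed
      have 2: "?E (S (vf_lin f Y g Z) # Zs) p =
          X p f * ?E (Y # Zs) p + f p * ?E (S Y # Zs) p + (X p g * ?E (Z # Zs) p + g p * ?E (S Z # Zs) p)"
        unfolding module_derivationD(3)[OF S vector_fields_scale[OF V(1,2)] vector_fields_scale[OF V(3,4)]]
          tensorial_add[OF T SW(1)[OF V(1,2)] SW(1)[OF V(3,4)] V(5)] SW(2)[OF V(1,2)] SW(2)[OF V(3,4)] ..
      have "(\<Sum>j<length Zs. ?E (vf_lin f Y g Z # Zs[j := S (Zs ! j)]) p) =
          (\<Sum>j<length Zs. f p * ?E (Y # Zs[j := S (Zs ! j)]) p + g p * ?E (Z # Zs[j := S (Zs ! j)]) p)"
        by (rule sum.cong[OF refl], rule tensorialD(3)[OF T V(1-4) up[OF V(5)]]) simp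
      then show ?thesis
        unfolding Cons 1 2 by (simp add: sum.distrib sum_distrib_left[symmetric]) (simp add: algebra_simps)
    qed
    show "induced_derivation X S \<Phi> Zs p = 0" if V: "set Zs \<subseteq> \<XX>" "length Zs > n" for Zs p
    proof -
      have "?E Zs = (\<lambda>q. 0)" by (rule ext) (rule n[OF V])
      moreover have "?E (Zs[j := S (Zs ! j)]) p = 0" if "j < length Zs" for j
        by (rule n[OF up[OF V(1) that]]) (simp add: V)
      ultimately show ?thesis by (simp add: induced_derivation_def tangent_vector_const[OF XT])
    qed
  qed
qed

text \<open>In the double sum, the terms in which \<open>S\<close> and \<open>S'\<close> act on different arguments are symmetric
  in \<open>S\<close> and \<open>S'\<close> and drop out of the commutator.\<close>

lemma induced_derivation_commutator:
  assumes S: "module_derivation X S" and S': "module_derivation Y S'" and \<Phi>: "\<Phi> \<in> sym_tensors A"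
    and P: "P \<in> sym_tensors A" "\<And>Zs p. set Zs \<subseteq> \<XX> \<Longrightarrow> tensor_eval P Zs p = induced_derivation X S \<Phi> Zs p"
    and P': "P' \<in> sym_tensors A" "\<And>Zs p. set Zs \<subseteq> \<XX> \<Longrightarrow> tensor_eval P' Zs p = induced_derivation Y S' \<Phi> Zs p"
    and Zs: "set Zs \<subseteq> \<XX>"
  shows "induced_derivation X S P' Zs p - induced_derivation Y S' P Zs p =
    X p (vf_apply Y (tensor_eval \<Phi> Zs)) - Y p (vf_apply X (tensor_eval \<Phi> Zs)) +
    (\<Sum>j<length Zs. tensor_eval \<Phi> (Zs[j := S' (S (Zs ! j))]) p - tensor_eval \<Phi> (Zs[j := S (S' (Zs ! j))]) p)"
proof -
  let ?E = "tensor_eval \<Phi>" and ?n = "length Zs"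
  define B where "B R R' j k = ?E ((Zs[j := R (Zs ! j)])[k := R' (Zs[j := R (Zs ! j)] ! k)]) p"
    for R R' :: "'m vfield \<Rightarrow> 'm vfield" and j k
  have main: "induced_derivation X S P' Zs p = X p (vf_apply Y (?E Zs)) -
      (\<Sum>j<?n. X p (?E (Zs[j := S' (Zs ! j)]))) - (\<Sum>j<?n. Y p (?E (Zs[j := S (Zs ! j)]))) +
      (\<Sum>j<?n. \<Sum>k<?n. B S S' j k)"
    if S: "module_derivation X S" and S': "module_derivation Y S'"
      and P': "P' \<in> sym_tensors A" "\<And>Zs p. set Zs \<subseteq> \<XX> \<Longrightarrow> tensor_eval P' Zs p = induced_derivation Y S' \<Phi> Zs p"
    for X S Y S' P'
  proof -
    note XT = vector_fields_tangent[OF module_derivationD(1)[OF S], of p]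
    have up: "set (Zs[j := S (Zs ! j)]) \<subseteq> \<XX>" "set (Zs[j := S' (Zs ! j)]) \<subseteq> \<XX>"
      if "j < ?n" for j
    proof -
      have "Zs ! j \<in> \<XX>" using that Zs nth_mem by blast
      then show "set (Zs[j := S (Zs ! j)]) \<subseteq> \<XX>" "set (Zs[j := S' (Zs ! j)]) \<subseteq> \<XX>"
        using set_update_vector_fields[OF Zs module_derivationD(2)[OF S]]
          set_update_vector_fields[OF Zs module_derivationD(2)[OF S']] by blast+
    qed
    have "tensor_eval P' Zs = (\<lambda>q. Y q (?E Zs) - (\<Sum>k<?n. ?E (Zs[k := S' (Zs ! k)]) q))"
      by (rule ext) (simp add: P'(2)[OF Zs] induced_derivation_def)
    then have "X p (tensor_eval P' Zs) = X p (\<lambda>q. Y q (?E Zs)) - X p (\<lambda>q. \<Sum>k<?n. ?E (Zs[k := S' (Zs ! k)]) q)"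
      using tangent_vector_diff[OF XT induced_derivation_smooth[OF S' \<Phi> Zs]] by simp
    also have "X p (\<lambda>q. \<Sum>k<?n. ?E (Zs[k := S' (Zs ! k)]) q) = (\<Sum>k<?n. X p (?E (Zs[k := S' (Zs ! k)])))"
    proof -
      have "X p (\<lambda>q. \<Sum>k<m. ?E (Zs[k := S' (Zs ! k)]) q) = (\<Sum>k<m. X p (?E (Zs[k := S' (Zs ! k)])))"
        if "m \<le> ?n" for m
        using that
      proof (induction m)
        case 0
        show ?case using tangent_vector_const[OF XT] by simp
      next
        case (Suc m)
        have s: "?E (Zs[k := S' (Zs ! k)]) \<in> \<F>" if "k < Suc m" for k
          using that Suc.prems up(2) by (intro tensor_eval_smooth[OF \<Phi>]) auto
        have "X p (\<lambda>q. (\<Sum>k<m. ?E (Zs[k := S' (Zs ! k)]) q) + ?E (Zs[m := S' (Zs ! m)]) q) =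
            X p (\<lambda>q. \<Sum>k<m. ?E (Zs[k := S' (Zs ! k)]) q) + X p (?E (Zs[m := S' (Zs ! m)]))"
          by (rule tangent_vector_add[OF XT smooth_functions_sum]) (use s in auto)
        then show ?case using Suc by simp
      qed
      then show ?thesis by blast
    qed
    finally have 1: "X p (tensor_eval P' Zs) = X p (vf_apply Y (?E Zs)) - (\<Sum>k<?n. X p (?E (Zs[k := S' (Zs ! k)])))"
      by (simp add: vf_apply_def[abs_def])
    have "(\<Sum>j<?n. tensor_eval P' (Zs[j := S (Zs ! j)]) p) = (\<Sum>j<?n. Y p (?E (Zs[j := S (Zs ! j)])) - (\<Sum>k<?n. B S S' j k))"
      by (rule sum.cong) (simp_all add: P'(2)[OF up(1)] induced_derivation_def B_def)
    then show ?thesis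
      unfolding induced_derivation_def 1 by (simp add: sum_subtractf)
  qed
  have BB: "B S S' j k = B S' S k j" if "j \<noteq> k" for j k
    using that by (simp add: B_def list_update_swap)
  have diag: "B R R' j j = ?E (Zs[j := R' (R (Zs ! j))]) p" if "j < ?n" for R R' j
    using that by (simp add: B_def)
  have "(\<Sum>j<?n. \<Sum>k<?n. B S S' j k) - (\<Sum>j<?n. \<Sum>k<?n. B S' S j k) =
      (\<Sum>j<?n. \<Sum>k<?n. B S S' j k) - (\<Sum>j<?n. \<Sum>k<?n. B S' S k j)"
    by (simp add: sum.swap[of "\<lambda>j k. B S' S j k"])
  also have "\<dots> = (\<Sum>j<?n. \<Sum>k<?n. B S S' j k - B S' S k j)"
    by (simp add: sum_subtractf)
  also have "\<dots> = (\<Sum>j<?n. \<Sum>k<?n. if k = j then B S S' j j - B S' S j j else 0)"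
    by (intro sum.cong refl) (simp add: BB)
  also have "\<dots> = (\<Sum>j<?n. B S S' j j - B S' S j j)"
    by (intro sum.cong refl) simp
  also have "\<dots> = (\<Sum>j<?n. ?E (Zs[j := S' (S (Zs ! j))]) p - ?E (Zs[j := S (S' (Zs ! j))]) p)"
    by (intro sum.cong refl) (simp add: diag)
  finally show ?thesis
    using main[OF S S' P'] main[OF S' S P] by linarith
qed

context
  fixes D :: "'m connection"
  assumes D: "is_connection A D"
begin

lemma connectionD:
  assumes "X \<in> \<XX>" "Y \<in> \<XX>"
  shows "D X Y \<in> \<XX>"
    "Z \<in> \<XX> \<Longrightarrow> D (X + Y) Z = D X Z + D Y Z"
    "Z \<in> \<XX> \<Longrightarrow> D X (Y + Z) = D X Y + D X Z"
    "f \<in> \<F> \<Longrightarrow> D (vf_scale f X) Y = vf_scale f (D X Y)"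
    "f \<in> \<F> \<Longrightarrow> D X (vf_scale f Y) = vf_scale (vf_apply X f) Y + vf_scale f (D X Y)"
proof -
  note s = D[unfolded is_connection_def]
  show "D X Y \<in> \<XX>" using s assms by blast
  show "D (X + Y) Z = D X Z + D Y Z" if "Z \<in> \<XX>"
    using s[THEN conjunct2, THEN conjunct1, THEN bspec, THEN bspec, THEN bspec, OF assms that] ..
  show "D X (Y + Z) = D X Y + D X Z" if "Z \<in> \<XX>"
    using s[THEN conjunct2, THEN conjunct1, THEN bspec, THEN bspec, THEN bspec, OF assms that] ..
  show "D (vf_scale f X) Y = vf_scale f (D X Y)" if "f \<in> \<F>"
    using s[THEN conjunct2, THEN conjunct2, THEN bspec, THEN bspec, THEN bspec, OF that assms] ..
  show "D X (vf_scale f Y) = vf_scale (vf_apply X f) Y + vf_scale f (D X Y)" if "f \<in> \<F>"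
    using s[THEN conjunct2, THEN conjunct2, THEN bspec, THEN bspec, THEN bspec, OF that assms] ..
qed

lemma module_derivation_connection:
  assumes "X \<in> \<XX>"
  shows "module_derivation X (D X)"
  unfolding module_derivation_def
  by (intro conjI ballI connectionD assms) assumption+

lemma cov_deriv:
  assumes X: "X \<in> \<XX>" and \<Phi>: "\<Phi> \<in> sym_tensors A"
  shows "cov_deriv A D X \<Phi> \<in> sym_tensors A"
    "set Zs \<subseteq> \<XX> \<Longrightarrow>
      tensor_eval (cov_deriv A D X \<Phi>) Zs p = induced_derivation X (D X) \<Phi> Zs p"
proof -
  have "(\<lambda>Ys. vf_apply X (tensor_eval \<Phi> Ys) - (\<Sum>j<length Ys. tensor_eval \<Phi> (Ys[j := D X (Ys ! j)]))) =
      induced_derivation X (D X) \<Phi>"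
    by (intro ext) (simp add: induced_derivation_def vf_apply_def sum_fun_apply)
  then have eq: "cov_deriv A D X \<Phi> = tensor_of A (induced_derivation X (D X) \<Phi>)"
    by (simp only: cov_deriv_def)
  note T = tensorial_induced_derivation[OF module_derivation_connection[OF X] \<Phi>]
  show "cov_deriv A D X \<Phi> \<in> sym_tensors A"
    "set Zs \<subseteq> \<XX> \<Longrightarrow>
      tensor_eval (cov_deriv A D X \<Phi>) Zs p = induced_derivation X (D X) \<Phi> Zs p"
    unfolding eq using tensor_of[OF T] .
qed

lemma cov_deriv_lin:
  assumes V: "f \<in> \<F>" "X \<in> \<XX>" "g \<in> \<F>" "Y \<in> \<XX>" and \<Phi>: "\<Phi> \<in> sym_tensors A" and Zs: "set Zs \<subseteq> \<XX>"
  shows "tensor_eval (cov_deriv A D (vf_lin f X g Y) \<Phi>) Zs p =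
    f p * tensor_eval (cov_deriv A D X \<Phi>) Zs p + g p * tensor_eval (cov_deriv A D Y \<Phi>) Zs p"
proof -
  let ?E = "tensor_eval \<Phi>"
  have "?E (Zs[j := D (vf_lin f X g Y) (Zs ! j)]) p = f p * ?E (Zs[j := D X (Zs ! j)]) p + g p * ?E (Zs[j := D Y (Zs ! j)]) p"
    if j: "j \<in> {..<length Zs}" for j
  proof -
    have Z: "Zs ! j \<in> \<XX>" using Zs j nth_mem by blast
    show ?thesis
      unfolding connectionD(2)[OF vector_fields_scale[OF V(1,2)] vector_fields_scale[OF V(3,4)] Z]
        connectionD(4)[OF V(2) Z V(1)] connectionD(4)[OF V(4) Z V(3)]
      using j by (intro tensorial_update_lin[OF tensorial_tensor_eval[OF \<Phi>] Zs] connectionD V Z) simp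
  qed
  then have "(\<Sum>j<length Zs. ?E (Zs[j := D (vf_lin f X g Y) (Zs ! j)]) p) =
      f p * (\<Sum>j<length Zs. ?E (Zs[j := D X (Zs ! j)]) p) + g p * (\<Sum>j<length Zs. ?E (Zs[j := D Y (Zs ! j)]) p)"
    unfolding sum_distrib_left sum.distrib[symmetric] by (intro sum.cong refl)
  then show ?thesis
    unfolding cov_deriv(2)[OF vf_lin_vector_fields[OF V] \<Phi> Zs] cov_deriv(2)[OF V(2) \<Phi> Zs] cov_deriv(2)[OF V(4) \<Phi> Zs]
      induced_derivation_def by (simp add: vf_scale_apply algebra_simps)
qed

lemma sym_deriv:
  assumes \<Phi>: "\<Phi> \<in> sym_tensors A"
  shows "sym_deriv A D \<Phi> \<in> sym_tensors A"
    "set Zs \<subseteq> \<XX> \<Longrightarrow> tensor_eval (sym_deriv A D \<Phi>) Zs p =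
      (\<Sum>j<length Zs. tensor_eval (cov_deriv A D (Zs ! j) \<Phi>) (take j Zs @ drop (Suc j) Zs) p)"
proof -
  let ?C = "\<lambda>X. tensor_eval (cov_deriv A D X \<Phi>)"
  define T where "T Zs p = (\<Sum>j<length Zs. ?C (Zs ! j) (take j Zs @ drop (Suc j) Zs) p)" for Zs p
  have C: "tensorial (?C X)" if "X \<in> \<XX>" for X
    using tensorial_tensor_eval[OF cov_deriv(1)[OF that \<Phi>]] .
  have Cons: "T (Y # Zs) p = ?C Y Zs p + (\<Sum>j<length Zs. ?C (Zs ! j) (Y # take j Zs @ drop (Suc j) Zs) p)" for Y Zs p
    by (simp add: T_def sum.lessThan_Suc_shift del: sum.lessThan_Suc)
  obtain n where n: "\<And>p vs. length vs > n \<Longrightarrow> \<Phi> p vs = 0" using sym_tensorsD(4)[OF \<Phi>] by blast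
  have T: "tensorial T"
  \<comment> \<open>the covariant derivative keeps the degree, the symmetric derivative raises it by one\<close>
  proof (rule tensorialI[of _ "Suc n"])
    show "T Zs \<in> \<F>" if Zs: "set Zs \<subseteq> \<XX>" for Zs
    proof -
      have "(\<lambda>p. \<Sum>j<length Zs. ?C (Zs ! j) (take j Zs @ drop (Suc j) Zs) p) \<in> \<F>"
      proof (rule smooth_functions_sum)
        fix j assume "j \<in> {..<length Zs}"
        then have "Zs ! j \<in> \<XX>" using Zs nth_mem by blast
        then show "?C (Zs ! j) (take j Zs @ drop (Suc j) Zs) \<in> \<F>"
          by (rule tensorialD(1)[OF C set_remove_subset[OF Zs]])
      qed
      then show ?thesis by (simp add: T_def[abs_def])
    qed
    show "T Ys = T Zs" if Zs: "set Zs \<subseteq> \<XX>" and eq: "mset Ys = mset Zs" for Ys Zs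
    proof
      fix p
      show "T Ys p = T Zs p"
        unfolding T_def
      proof (rule sum_positions_permute[OF eq])
        fix i j assume ij: "i < length Zs" "j < length Ys" "Ys ! j = Zs ! i"
        have Z: "Zs ! i \<in> \<XX>" using Zs nth_mem ij by blast
        have "add_mset (Zs ! i) (mset (take j Ys @ drop (Suc j) Ys)) =
            add_mset (Zs ! i) (mset (take i Zs @ drop (Suc i) Zs))"
          using mset_remove_nth[OF ij(1)] mset_remove_nth[OF ij(2)] ij(3) eq by metis
        then have "mset (take j Ys @ drop (Suc j) Ys) = mset (take i Zs @ drop (Suc i) Zs)"
          by simp
        from tensorialD(2)[OF C[OF Z] set_remove_subset[OF Zs] this]
        show "?C (Ys ! j) (take j Ys @ drop (Suc j) Ys) p = ?C (Zs ! i) (take i Zs @ drop (Suc i) Zs) p"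
          unfolding ij(3) by simp
      qed
    qed
    show "T (vf_lin f X g Y # Zs) p = f p * T (X # Zs) p + g p * T (Y # Zs) p"
      if V: "f \<in> \<F>" "X \<in> \<XX>" "g \<in> \<F>" "Y \<in> \<XX>" "set Zs \<subseteq> \<XX>" for f X g Y Zs p
    proof -
      let ?R = "\<lambda>j. take j Zs @ drop (Suc j) Zs"
      have "?C (Zs ! j) (vf_lin f X g Y # ?R j) p = f p * ?C (Zs ! j) (X # ?R j) p + g p * ?C (Zs ! j) (Y # ?R j) p"
        if j: "j \<in> {..<length Zs}" for j
      proof -
        have Z: "Zs ! j \<in> \<XX>" using V(5) j nth_mem by blast
        show ?thesis by (rule tensorialD(3)[OF C[OF Z] V(1-4) set_remove_subset[OF V(5)]])
      qed
      then have "(\<Sum>j<length Zs. ?C (Zs ! j) (vf_lin f X g Y # ?R j) p) =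
          f p * (\<Sum>j<length Zs. ?C (Zs ! j) (X # ?R j) p) + g p * (\<Sum>j<length Zs. ?C (Zs ! j) (Y # ?R j) p)"
        unfolding sum_distrib_left sum.distrib[symmetric] by (intro sum.cong refl)
      then show ?thesis unfolding Cons cov_deriv_lin[OF V(1-4) \<Phi> V(5)] by (simp add: algebra_simps)
    qed
    show "T Zs p = 0" if Zs: "set Zs \<subseteq> \<XX>" "length Zs > Suc n" for Zs p
      unfolding T_def
    proof (rule sum.neutral, rule ballI)
      fix j assume j: "j \<in> {..<length Zs}"
      then have Z: "Zs ! j \<in> \<XX>" using Zs(1) nth_mem by blast
      let ?R = "take j Zs @ drop (Suc j) Zs"
      have l: "length ?R > n" using Zs(2) j by auto
      have "tensor_eval \<Phi> ?R = (\<lambda>p. 0)" "tensor_eval \<Phi> (?R[k := W]) p = 0" for k W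
        using l by (simp_all add: tensor_eval_def n)
      then show "?C (Zs ! j) ?R p = 0"
        unfolding cov_deriv(2)[OF Z \<Phi> set_remove_subset[OF Zs(1)]] induced_derivation_def
        by (simp add: tangent_vector_const[OF vector_fields_tangent[OF Z]])
    qed
  qed
  have "(\<lambda>Xs. \<Sum>j<length Xs. ?C (Xs ! j) (take j Xs @ drop (Suc j) Xs)) = T"
    by (intro ext) (simp add: T_def sum_fun_apply)
  then have eq: "sym_deriv A D \<Phi> = tensor_of A T" by (simp only: sym_deriv_def)
  show "sym_deriv A D \<Phi> \<in> sym_tensors A"
    "set Zs \<subseteq> \<XX> \<Longrightarrow> tensor_eval (sym_deriv A D \<Phi>) Zs p =
      (\<Sum>j<length Zs. tensor_eval (cov_deriv A D (Zs ! j) \<Phi>) (take j Zs @ drop (Suc j) Zs) p)"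
    unfolding eq T_def[symmetric] using tensor_of[OF T] .
qed

lemma module_derivation_symmetric_bracket:
  assumes X: "X \<in> \<XX>"
  shows "module_derivation X (symmetric_bracket D X)"
  unfolding module_derivation_def
proof (intro conjI ballI)
  show "symmetric_bracket D X Z \<in> \<XX>" if "Z \<in> \<XX>" for Z
    unfolding symmetric_bracket_def using X that by (intro vector_fields_add connectionD)
  show "symmetric_bracket D X (Y + Z) = symmetric_bracket D X Y + symmetric_bracket D X Z"
    if "Y \<in> \<XX>" "Z \<in> \<XX>" for Y Z
    unfolding symmetric_bracket_def connectionD(3)[OF X that] connectionD(2)[OF that X] by (simp only: ac_simps)
  show "symmetric_bracket D X (vf_scale f Z) = vf_scale (vf_apply X f) Z + vf_scale f (symmetric_bracket D X Z)"
    if f: "f \<in> \<F>" and Z: "Z \<in> \<XX>" for f Z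
    unfolding symmetric_bracket_def connectionD(5)[OF X Z f] connectionD(4)[OF Z X f]
    by (intro ext) (simp add: vf_scale_apply distrib_left)
qed (rule X)

text \<open>\<open>L\<^sup>s\<^sub>X\<Phi>\<close> is \<open>\<nabla>\<^sub>X\<Phi>\<close> minus the contraction with \<open>\<nabla>X\<close>: the terms \<open>(\<nabla>\<^bsub>Z\<^sub>j\<^esub>\<Phi>)(X, \<dots>)\<close> of \<open>\<iota>\<^sub>X\<nabla>\<^sup>s\<Phi>\<close> and the
  terms \<open>(\<nabla>\<^bsub>Z\<^sub>j\<^esub>(\<iota>\<^sub>X\<Phi>))(\<dots>)\<close> of \<open>\<nabla>\<^sup>s(\<iota>\<^sub>X\<Phi>)\<close> differ by \<open>\<Phi>(\<nabla>\<^bsub>Z\<^sub>j\<^esub>X, \<dots>)\<close>.\<close>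

lemma sym_lie:
  assumes X: "X \<in> \<XX>" and \<Phi>: "\<Phi> \<in> sym_tensors A"
  shows "sym_lie A D X \<Phi> \<in> sym_tensors A"
    "set Zs \<subseteq> \<XX> \<Longrightarrow>
      tensor_eval (sym_lie A D X \<Phi>) Zs p = induced_derivation X (symmetric_bracket D X) \<Phi> Zs p"
proof -
  have eq: "sym_lie A D X \<Phi> = contraction X (sym_deriv A D \<Phi>) - sym_deriv A D (contraction X \<Phi>)"
    by (simp only: sym_lie_def commutator_def)
  note i\<Phi> = contraction_sym_tensors[OF \<Phi> X]
  show "sym_lie A D X \<Phi> \<in> sym_tensors A"
    unfolding eq by (intro sym_tensors_diff contraction_sym_tensors sym_deriv i\<Phi> X \<Phi>)
  assume Zs: "set Zs \<subseteq> \<XX>"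
  let ?E = "tensor_eval \<Phi>" and ?R = "\<lambda>j. take j Zs @ drop (Suc j) Zs" and ?n = "length Zs"
  note T = tensorial_tensor_eval[OF \<Phi>]
  have XZs: "set (X # Zs) \<subseteq> \<XX>" using X Zs by simp
  have "tensor_eval (sym_lie A D X \<Phi>) Zs p =
      tensor_eval (sym_deriv A D \<Phi>) (X # Zs) p - tensor_eval (sym_deriv A D (contraction X \<Phi>)) Zs p"
    by (simp add: eq tensor_eval_def contraction_def)
  also have "\<dots> = tensor_eval (cov_deriv A D X \<Phi>) Zs p +
      (\<Sum>j<?n. tensor_eval (cov_deriv A D (Zs ! j) \<Phi>) (X # ?R j) p) -
      (\<Sum>j<?n. tensor_eval (cov_deriv A D (Zs ! j) (contraction X \<Phi>)) (?R j) p)"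
    unfolding sym_deriv(2)[OF \<Phi> XZs] sym_deriv(2)[OF i\<Phi> Zs]
    by (simp add: sum.lessThan_Suc_shift del: sum.lessThan_Suc)
  also have "\<dots> = tensor_eval (cov_deriv A D X \<Phi>) Zs p +
      (\<Sum>j<?n. tensor_eval (cov_deriv A D (Zs ! j) \<Phi>) (X # ?R j) p -
        tensor_eval (cov_deriv A D (Zs ! j) (contraction X \<Phi>)) (?R j) p)"
    by (simp add: sum_subtractf)
  also have "(\<Sum>j<?n. tensor_eval (cov_deriv A D (Zs ! j) \<Phi>) (X # ?R j) p -
        tensor_eval (cov_deriv A D (Zs ! j) (contraction X \<Phi>)) (?R j) p) = (\<Sum>j<?n. - ?E (Zs[j := D (Zs ! j) X]) p)"
  proof (rule sum.cong[OF refl])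
    fix j assume j: "j \<in> {..<?n}"
    then have Z: "Zs ! j \<in> \<XX>" using Zs nth_mem by blast
    have R: "set (?R j) \<subseteq> \<XX>" by (rule set_remove_subset[OF Zs])
    then have XR: "set (X # ?R j) \<subseteq> \<XX>" using X by simp
    have "?E (Zs[j := D (Zs ! j) X]) = ?E (D (Zs ! j) X # ?R j)"
      by (rule tensorial_update[OF T Zs connectionD(1)[OF Z X]]) (use j in simp)
    then show "tensor_eval (cov_deriv A D (Zs ! j) \<Phi>) (X # ?R j) p -
        tensor_eval (cov_deriv A D (Zs ! j) (contraction X \<Phi>)) (?R j) p = - ?E (Zs[j := D (Zs ! j) X]) p"
      unfolding cov_deriv(2)[OF Z \<Phi> XR] cov_deriv(2)[OF Z i\<Phi> R] induced_derivation_def tensor_eval_contraction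
      by (simp add: sum.lessThan_Suc_shift del: sum.lessThan_Suc)
  qed
  also have "tensor_eval (cov_deriv A D X \<Phi>) Zs p + \<dots> =
      X p (?E Zs) - (\<Sum>j<?n. ?E (Zs[j := D X (Zs ! j)]) p + ?E (Zs[j := D (Zs ! j) X]) p)"
    unfolding cov_deriv(2)[OF X \<Phi> Zs] induced_derivation_def by (simp add: sum.distrib sum_negf)
  also have "(\<Sum>j<?n. ?E (Zs[j := D X (Zs ! j)]) p + ?E (Zs[j := D (Zs ! j) X]) p) =
      (\<Sum>j<?n. ?E (Zs[j := symmetric_bracket D X (Zs ! j)]) p)"
  proof (rule sum.cong[OF refl])
    fix j assume j: "j \<in> {..<?n}"
    then have Z: "Zs ! j \<in> \<XX>" using Zs nth_mem by blast
    show "?E (Zs[j := D X (Zs ! j)]) p + ?E (Zs[j := D (Zs ! j) X]) p = ?E (Zs[j := symmetric_bracket D X (Zs ! j)]) p"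
      unfolding symmetric_bracket_def
      by (rule tensorial_update_add[OF T Zs connectionD(1)[OF X Z] connectionD(1)[OF Z X], symmetric]) (use j in simp)
  qed
  finally show "tensor_eval (sym_lie A D X \<Phi>) Zs p = induced_derivation X (symmetric_bracket D X) \<Phi> Zs p"
    unfolding induced_derivation_def .
qed

end

end

section \<open>The symmetric product and contraction with endomorphisms\<close>

lemma permute_list_update:
  assumes "\<pi> permutes {..<length xs}" "k < length xs"
  shows "permute_list \<pi> (xs[\<pi> k := z]) = (permute_list \<pi> xs)[k := z]"
proof (rule nth_equalityI)
  fix i assume "i < length (permute_list \<pi> (xs[\<pi> k := z]))"
  then have i: "i < length xs" by simp
  have "\<pi> i < length xs" "\<pi> k < length xs"
    using permutes_in_image[OF assms(1)] i assms(2) by auto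
  moreover have "\<pi> k = \<pi> i \<longleftrightarrow> k = i" using permutes_inj[OF assms(1)] by (auto dest: injD)
  ultimately show "permute_list \<pi> (xs[\<pi> k := z]) ! i = (permute_list \<pi> xs)[k := z] ! i"
    using i assms by (simp add: permute_list_nth nth_list_update)
qed simp

lemma symmetrize_alt:
  "symmetrize F vs = (\<Sum>\<pi> | \<pi> permutes {..<length vs}. F (permute_list \<pi> vs)) / fact (length vs)"
  by (simp add: symmetrize_def permute_list_def)

lemma symmetrize_mset:
  assumes "mset ws = mset vs"
  shows "symmetrize F ws = symmetrize F vs"
proof -
  obtain \<tau> where \<tau>: "\<tau> permutes {..<length vs}" "permute_list \<tau> vs = ws"
    using assms mset_eq_permutation by metis
  have l: "length ws = length vs" using \<tau>(2) by auto
  have "(\<Sum>\<pi> | \<pi> permutes {..<length vs}. F (permute_list \<pi> vs)) =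
      (\<Sum>\<pi> | \<pi> permutes {..<length vs}. F (permute_list (\<tau> \<circ> \<pi>) vs))"
    by (rule sum.reindex_bij_witness[where i="\<lambda>\<pi>. \<tau> \<circ> \<pi>" and j="\<lambda>\<pi>. inv \<tau> \<circ> \<pi>"])
      (auto simp: permutes_compose permutes_inv \<tau>(1) o_assoc permutes_inv_o[OF \<tau>(1)])
  also have "\<dots> = (\<Sum>\<pi> | \<pi> permutes {..<length vs}. F (permute_list \<pi> ws))"
    by (intro sum.cong refl) (simp add: permute_list_compose \<tau>(2))
  finally show ?thesis by (simp add: symmetrize_alt l)
qed

lemma symmetrize_const:
  assumes "\<And>ws. mset ws = mset vs \<Longrightarrow> F ws = a"
  shows "symmetrize F vs = a"
proof -
  have "(\<Sum>\<pi> | \<pi> permutes {..<length vs}. F (permute_list \<pi> vs)) = (\<Sum>\<pi> | \<pi> permutes {..<length vs}. a)"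
    by (intro sum.cong refl assms) simp
  then show ?thesis by (simp add: symmetrize_alt card_permutations)
qed

lemma symmetrize_cong:
  assumes "\<And>ws. mset ws = mset vs \<Longrightarrow> F ws = G ws"
  shows "symmetrize F vs = symmetrize G vs"
  unfolding symmetrize_alt by (intro arg_cong2[where f="(/)"] sum.cong refl assms) simp

lemma symmetrize_sum: "symmetrize (\<lambda>ws. \<Sum>i\<in>I. F i ws) vs = (\<Sum>i\<in>I. symmetrize (F i) vs)"
  unfolding symmetrize_alt sum_divide_distrib[symmetric] by (subst sum.swap) simp

lemma symmetrize_add: "symmetrize (\<lambda>ws. F ws + G ws) vs = symmetrize F vs + symmetrize G vs"
  by (simp add: symmetrize_alt sum.distrib add_divide_distrib)

text \<open>The entry at position \<open>k\<close> of the list permuted by \<open>\<pi>\<close> is the one at position \<open>j = \<pi> k\<close> of the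
  original list, so the two sums correspond under \<open>\<pi>\<close>.\<close>

lemma symmetrize_insertion:
  "(\<Sum>j<length vs. symmetrize F (vs[j := s (vs ! j)])) =
    symmetrize (\<lambda>ws. \<Sum>k<length ws. F (ws[k := s (ws ! k)])) vs"
proof -
  have "(\<Sum>j<length vs. F (permute_list \<pi> (vs[j := s (vs ! j)]))) =
      (\<Sum>k<length vs. F ((permute_list \<pi> vs)[k := s (permute_list \<pi> vs ! k)]))"
    if \<pi>: "\<pi> permutes {..<length vs}" for \<pi>
  proof -
    have "(\<Sum>j<length vs. F (permute_list \<pi> (vs[j := s (vs ! j)]))) =
        (\<Sum>k<length vs. F (permute_list \<pi> (vs[\<pi> k := s (vs ! \<pi> k)])))"
      using sum.permute[OF \<pi>] by (simp add: o_def)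
    also have "\<dots> = (\<Sum>k<length vs. F ((permute_list \<pi> vs)[k := s (permute_list \<pi> vs ! k)]))"
      by (intro sum.cong refl) (simp add: permute_list_update[OF \<pi>] permute_list_nth[OF \<pi>])
    finally show ?thesis .
  qed
  then have "(\<Sum>\<pi> | \<pi> permutes {..<length vs}. \<Sum>j<length vs. F (permute_list \<pi> (vs[j := s (vs ! j)]))) =
      (\<Sum>\<pi> | \<pi> permutes {..<length vs}. \<Sum>k<length vs. F ((permute_list \<pi> vs)[k := s (permute_list \<pi> vs ! k)]))"
    by (rule sum.cong[OF refl]) simp
  then show ?thesis
    unfolding symmetrize_alt by (simp add: sum_divide_distrib[symmetric]) (subst sum.swap, simp)
qed

lemma sum_lessThan_split: "r \<le> n \<Longrightarrow> (\<Sum>k<n. f k) = (\<Sum>k<r. f k) + (\<Sum>k<n - r. f (r + k))"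
  for f :: "nat \<Rightarrow> real"
proof -
  have "(\<Sum>k<r + m. f k) = (\<Sum>k<r. f k) + (\<Sum>k<m. f (r + k))" for m
    by (induction m) auto
  from this[of "n - r"] show "r \<le> n \<Longrightarrow> ?thesis" by simp
qed

lemma tensor_eval_sym_product:
  "tensor_eval (\<Phi> \<odot> \<Psi>) Zs p = (\<Sum>r\<le>length Zs. fact (length Zs) / (fact r * fact (length Zs - r)) *
    symmetrize (\<lambda>Ws. tensor_eval \<Phi> (take r Ws) p * tensor_eval \<Psi> (drop r Ws) p) Zs)"
proof -
  have "symmetrize (\<lambda>ws. \<Phi> p (take r ws) * \<Psi> p (drop r ws)) (map (\<lambda>X. X p) Zs) =
      symmetrize (\<lambda>Ws. tensor_eval \<Phi> (take r Ws) p * tensor_eval \<Psi> (drop r Ws) p) Zs" for r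
    unfolding symmetrize_alt length_map
    by (intro arg_cong2[where f="(/)"] sum.cong refl)
      (simp add: permute_list_map tensor_eval_def take_map drop_map)
  then show ?thesis by (simp add: tensor_eval_def sym_product_def Let_def)
qed

context smooth_manifold
begin

lemma set_take_drop:
  assumes "set Ws \<subseteq> V"
  shows "set (take r Ws) \<subseteq> V" "set (drop r Ws) \<subseteq> V"
  using order_trans[OF set_take_subset assms] order_trans[OF set_drop_subset assms] .

lemma product_update:
  assumes "k < length Ws"
  shows "tensor_eval \<Phi> (take r (Ws[k := Z])) p * tensor_eval \<Psi> (drop r (Ws[k := Z])) p =
    (if k < r then tensor_eval \<Phi> ((take r Ws)[k := Z]) p * tensor_eval \<Psi> (drop r Ws) p
     else tensor_eval \<Phi> (take r Ws) p * tensor_eval \<Psi> ((drop r Ws)[k - r := Z]) p)"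
  using assms by (cases "k < r") (simp_all add: take_update_swap drop_update_swap list_update_beyond)

text \<open>After a permutation, a given argument belongs to one of the two factors, and the other factor
  does not involve it. So each summand inherits the linearity of \<open>\<Phi>\<close> and \<open>\<Psi>\<close>.\<close>

lemma sym_product_sym_tensors:
  assumes \<Phi>: "\<Phi> \<in> sym_tensors A" and \<Psi>: "\<Psi> \<in> sym_tensors A"
  shows "\<Phi> \<odot> \<Psi> \<in> sym_tensors A"
proof (rule sym_tensorsI)
  note T = tensorial_tensor_eval[OF \<Phi>] tensorial_tensor_eval[OF \<Psi>]
  obtain n where n: "\<And>p vs. length vs > n \<Longrightarrow> \<Phi> p vs = 0" using sym_tensorsD(4)[OF \<Phi>] by blast
  obtain m where m: "\<And>p vs. length vs > m \<Longrightarrow> \<Psi> p vs = 0" using sym_tensorsD(4)[OF \<Psi>] by blast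
  define G where "G r Ws p = tensor_eval \<Phi> (take r Ws) p * tensor_eval \<Psi> (drop r Ws) p" for r Ws p
  define c :: "nat \<Rightarrow> nat \<Rightarrow> real" where "c l r = fact l / (fact r * fact (l - r))" for l r
  have ev: "tensor_eval (\<Phi> \<odot> \<Psi>) Zs p = (\<Sum>r\<le>length Zs. c (length Zs) r * symmetrize (\<lambda>Ws. G r Ws p) Zs)" for Zs p
    by (simp add: tensor_eval_sym_product G_def c_def)
  have G_smooth: "G r Ws \<in> \<F>" if "set Ws \<subseteq> \<XX>" for r Ws
  proof -
    have "set (take r Ws) \<subseteq> \<XX>" "set (drop r Ws) \<subseteq> \<XX>"
      using set_take_drop[OF that] .
    from smooth_functions_mult[OF tensorialD(1)[OF T(1) this(1)] tensorialD(1)[OF T(2) this(2)]]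
    show ?thesis by (simp add: G_def[abs_def])
  qed
  have G_lin: "G r (Ws[k := vf_lin f X g Y]) p = f p * G r (Ws[k := X]) p + g p * G r (Ws[k := Y]) p"
    if V: "set Ws \<subseteq> \<XX>" "f \<in> \<F>" "X \<in> \<XX>" "g \<in> \<F>" "Y \<in> \<XX>" "k < length Ws" for r Ws k f X g Y p
  proof -
    have s: "set (take r Ws) \<subseteq> \<XX>" "set (drop r Ws) \<subseteq> \<XX>"
      using set_take_drop[OF V(1)] .
    show ?thesis
    proof (cases "k < r")
      case True
      then have "k < length (take r Ws)" using V(6) by simp
      from tensorial_update_lin[OF T(1) s(1) V(2-5) this] show ?thesis
        unfolding G_def product_update[OF V(6)] if_P[OF True] by (simp only: distrib_right mult.assoc)
    next
      case False
      then have "k - r < length (drop r Ws)" using V(6) by simp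
      from tensorial_update_lin[OF T(2) s(2) V(2-5) this] show ?thesis
        unfolding G_def product_update[OF V(6)] if_not_P[OF False] by (simp only: distrib_left mult.left_commute)
    qed
  qed
  \<comment> \<open>a permutation puts the first argument at a position \<open>k\<close> that does not depend on the argument\<close>
  have slot: "\<exists>k<Suc (length Zs). \<exists>Ws. length Ws = Suc (length Zs) \<and> set Ws \<subseteq> insert 0 (set Zs) \<and>
      (\<forall>X. permute_list \<pi> (X # Zs) = Ws[k := X])" if \<pi>: "\<pi> permutes {..<Suc (length Zs)}" for \<pi> and Zs :: "'m vfield list"
  proof -
    obtain k where k: "\<pi> k = 0" using permutes_surj[OF \<pi>] by (metis surjD)
    then have kl: "k < Suc (length Zs)" using permutes_in_image[OF \<pi>, of k] by auto
    have \<pi>': "\<pi> permutes {..<length (0 # Zs)}" using \<pi> by simp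
    have "permute_list \<pi> (X # Zs) = (permute_list \<pi> (0 # Zs))[k := X]" for X
      using permute_list_update[OF \<pi>', of k X] k kl by simp
    moreover have "set (permute_list \<pi> (0 # Zs)) \<subseteq> insert 0 (set Zs)"
      using set_permute_list[OF \<pi>'] by simp
    moreover have "length (permute_list \<pi> (0 # Zs)) = Suc (length Zs)" by simp
    ultimately show ?thesis using kl by blast
  qed
  show "tensorial (tensor_eval (\<Phi> \<odot> \<Psi>))"
  proof (rule tensorialI[of _ "n + m"])
    show "tensor_eval (\<Phi> \<odot> \<Psi>) Zs \<in> \<F>" if "set Zs \<subseteq> \<XX>" for Zs
    proof -
      have "(\<lambda>p. \<Sum>r\<le>length Zs. c (length Zs) r * ((\<Sum>\<pi> | \<pi> permutes {..<length Zs}. G r (permute_list \<pi> Zs) p) *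
          inverse (fact (length Zs)))) \<in> \<F>"
        using that
        by (intro smooth_functions_sum smooth_functions_mult[OF smooth_functions_const]
            smooth_functions_mult[OF _ smooth_functions_const] G_smooth) auto
      then show ?thesis by (simp add: ev[abs_def] symmetrize_alt divide_inverse)
    qed
    show "tensor_eval (\<Phi> \<odot> \<Psi>) Ys = tensor_eval (\<Phi> \<odot> \<Psi>) Zs" if "mset Ys = mset Zs" for Ys Zs
      by (rule ext) (simp only: ev symmetrize_mset[OF that] mset_eq_length[OF that])
    show "tensor_eval (\<Phi> \<odot> \<Psi>) (vf_lin f X g Y # Zs) p =
        f p * tensor_eval (\<Phi> \<odot> \<Psi>) (X # Zs) p + g p * tensor_eval (\<Phi> \<odot> \<Psi>) (Y # Zs) p"
      if V: "f \<in> \<F>" "X \<in> \<XX>" "g \<in> \<F>" "Y \<in> \<XX>" "set Zs \<subseteq> \<XX>" for f X g Y Zs p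
    proof -
      have "G r (permute_list \<pi> (vf_lin f X g Y # Zs)) p =
          f p * G r (permute_list \<pi> (X # Zs)) p + g p * G r (permute_list \<pi> (Y # Zs)) p"
        if \<pi>: "\<pi> permutes {..<Suc (length Zs)}" for \<pi> r
      proof -
        obtain k Ws where W: "k < length Ws" "set Ws \<subseteq> insert 0 (set Zs)" "\<And>X. permute_list \<pi> (X # Zs) = Ws[k := X]"
          using slot[OF \<pi>] by metis
        have "set Ws \<subseteq> \<XX>" using W(2) V(5) vector_fields_zero by blast
        then show ?thesis unfolding W(3) using V W(1) by (intro G_lin)
      qed
      then have "symmetrize (\<lambda>Ws. G r Ws p) (vf_lin f X g Y # Zs) =
          f p * symmetrize (\<lambda>Ws. G r Ws p) (X # Zs) + g p * symmetrize (\<lambda>Ws. G r Ws p) (Y # Zs)" for r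
        unfolding symmetrize_alt times_divide_eq_right sum_distrib_left add_divide_distrib[symmetric]
          sum.distrib[symmetric] list.size
        by (intro arg_cong2[where f="(/)"] sum.cong refl) simp
      then show ?thesis
        by (simp add: ev sum_distrib_left distrib_left sum.distrib mult.left_commute del: sum.atMost_Suc)
    qed
    show "tensor_eval (\<Phi> \<odot> \<Psi>) Zs p = 0" if l: "length Zs > n + m" for Zs p
    proof -
      have "G r Ws p = 0" if "length Ws = length Zs" "r \<le> length Zs" for r Ws
        using that l n[of "map (\<lambda>X. X p) (take r Ws)" p] m[of "map (\<lambda>X. X p) (drop r Ws)" p]
        by (cases "r > n") (auto simp: G_def tensor_eval_def)
      then have "symmetrize (\<lambda>Ws. G r Ws p) Zs = 0" if "r \<le> length Zs" for r
        using that by (intro symmetrize_const) (metis mset_eq_length)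
      then show ?thesis by (simp add: ev)
    qed
  qed
  show "(\<Phi> \<odot> \<Psi>) p vs = 0" if bad: "\<not> set vs \<subseteq> \<T> p" for p vs
  proof -
    have "\<Phi> p (take r ws) * \<Psi> p (drop r ws) = 0" if "mset ws = mset vs" for ws r
    proof -
      have "set (take r ws) \<union> set (drop r ws) = set vs"
        using mset_eq_setD[OF that] append_take_drop_id[of r ws] by (metis set_append)
      then have "\<not> set (take r ws) \<subseteq> \<T> p \<or> \<not> set (drop r ws) \<subseteq> \<T> p"
        using bad by blast
      then have "\<Phi> p (take r ws) = 0 \<or> \<Psi> p (drop r ws) = 0"
        using sym_tensorsD(5)[OF \<Phi>] sym_tensorsD(5)[OF \<Psi>] by blast
      then show ?thesis by auto
    qed
    then have "symmetrize (\<lambda>ws. \<Phi> p (take r ws) * \<Psi> p (drop r ws)) vs = 0" for r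
      by (rule symmetrize_const)
    then show ?thesis by (simp add: sym_product_def Let_def)
  qed
qed

context
  fixes S :: "'m vfield \<Rightarrow> 'm vfield"
  assumes S: "module_endomorphism S"
begin

definition insertion :: "'m tensor \<Rightarrow> 'm tensor" where
  "insertion \<Phi> = tensor_of A (\<lambda>Zs p. \<Sum>j<length Zs. tensor_eval \<Phi> (Zs[j := S (Zs ! j)]) p)"

lemma insertion:
  assumes \<Phi>: "\<Phi> \<in> sym_tensors A"
  shows "insertion \<Phi> \<in> sym_tensors A"
    "set Zs \<subseteq> \<XX> \<Longrightarrow> tensor_eval (insertion \<Phi>) Zs p = (\<Sum>j<length Zs. tensor_eval \<Phi> (Zs[j := S (Zs ! j)]) p)"
proof -
  have "module_derivation 0 S"
    unfolding module_derivation_def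
  proof (intro conjI ballI vector_fields_zero module_endomorphismD(1,3)[OF S])
    fix f Z assume f: "f \<in> \<F>" "Z \<in> \<XX>"
    show "S (vf_scale f Z) = vf_scale (vf_apply 0 f) Z + vf_scale f (S Z)"
      unfolding module_endomorphismD(4)[OF S f] by (intro ext) (simp add: vf_scale_apply vf_apply_def)
  qed
  from tensorial_induced_derivation[OF this \<Phi>]
  have "tensorial (\<lambda>Zs p. (-1) * induced_derivation 0 S \<Phi> Zs p + 0 * induced_derivation 0 S \<Phi> Zs p)"
    by (intro tensorial_lincomb)
  then have T: "tensorial (\<lambda>Zs p. \<Sum>j<length Zs. tensor_eval \<Phi> (Zs[j := S (Zs ! j)]) p)"
    by (rule tensorial_cong) (simp add: induced_derivation_def)
  show "insertion \<Phi> \<in> sym_tensors A"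
    "set Zs \<subseteq> \<XX> \<Longrightarrow> tensor_eval (insertion \<Phi>) Zs p = (\<Sum>j<length Zs. tensor_eval \<Phi> (Zs[j := S (Zs ! j)]) p)"
    unfolding insertion_def using tensor_of[OF T] .
qed

text \<open>In each summand of the product, \<open>S\<close> acts on an argument of the first or of the second factor.\<close>

lemma insertion_sym_product:
  assumes \<Phi>: "\<Phi> \<in> sym_tensors A" and \<Psi>: "\<Psi> \<in> sym_tensors A"
  shows "insertion (\<Phi> \<odot> \<Psi>) = insertion \<Phi> \<odot> \<Psi> + \<Phi> \<odot> insertion \<Psi>"
proof (rule sym_tensors_eqI)
  note st = sym_product_sym_tensors
  show "insertion (\<Phi> \<odot> \<Psi>) \<in> sym_tensors A" by (intro insertion st \<Phi> \<Psi>)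
  show "insertion \<Phi> \<odot> \<Psi> + \<Phi> \<odot> insertion \<Psi> \<in> sym_tensors A"
    by (intro sym_tensors_add st insertion \<Phi> \<Psi>)
  fix Zs and p :: 'm assume Zs: "set Zs \<subseteq> \<XX>"
  let ?n = "length Zs"
  let ?G = "\<lambda>\<Phi> \<Psi> r Ws. tensor_eval \<Phi> (take r Ws) p * tensor_eval \<Psi> (drop r Ws) p"
  let ?c = "\<lambda>r. fact ?n / (fact r * fact (?n - r)) :: real"
  have "symmetrize (\<lambda>Ws. \<Sum>k<length Ws. ?G \<Phi> \<Psi> r (Ws[k := S (Ws ! k)])) Zs =
      symmetrize (?G (insertion \<Phi>) \<Psi> r) Zs + symmetrize (?G \<Phi> (insertion \<Psi>) r) Zs" if r: "r \<le> ?n" for r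
    unfolding symmetrize_add[symmetric]
  proof (rule symmetrize_cong)
    fix Ws assume ms: "mset Ws = mset Zs"
    then have W: "length Ws = ?n" "set Ws \<subseteq> \<XX>"
      using mset_eq_length mset_eq_setD Zs by blast+
    have s: "set (take r Ws) \<subseteq> \<XX>" "set (drop r Ws) \<subseteq> \<XX>"
      using set_take_drop[OF W(2)] .
    have "(\<Sum>k<length Ws. ?G \<Phi> \<Psi> r (Ws[k := S (Ws ! k)])) =
        (\<Sum>k<r. ?G \<Phi> \<Psi> r (Ws[k := S (Ws ! k)])) + (\<Sum>k<?n - r. ?G \<Phi> \<Psi> r (Ws[r + k := S (Ws ! (r + k))]))"
      unfolding W(1) by (rule sum_lessThan_split[OF r])
    also have "(\<Sum>k<r. ?G \<Phi> \<Psi> r (Ws[k := S (Ws ! k)])) =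
        (\<Sum>k<r. tensor_eval \<Phi> ((take r Ws)[k := S (take r Ws ! k)]) p * tensor_eval \<Psi> (drop r Ws) p)"
      using r W(1) by (intro sum.cong refl) (simp add: take_update_swap)
    also have "\<dots> = ?G (insertion \<Phi>) \<Psi> r Ws"
      unfolding insertion(2)[OF \<Phi> s(1)] sum_distrib_right using r W(1) by simp
    also have "(\<Sum>k<?n - r. ?G \<Phi> \<Psi> r (Ws[r + k := S (Ws ! (r + k))])) =
        (\<Sum>k<?n - r. tensor_eval \<Phi> (take r Ws) p * tensor_eval \<Psi> ((drop r Ws)[k := S (drop r Ws ! k)]) p)"
      using r W(1) by (intro sum.cong refl) (simp add: drop_update_swap)
    also have "\<dots> = ?G \<Phi> (insertion \<Psi>) r Ws"
      unfolding insertion(2)[OF \<Psi> s(2)] sum_distrib_left using r W(1) by simp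
    finally show "(\<Sum>k<length Ws. ?G \<Phi> \<Psi> r (Ws[k := S (Ws ! k)])) =
        ?G (insertion \<Phi>) \<Psi> r Ws + ?G \<Phi> (insertion \<Psi>) r Ws" .
  qed
  note key = this
  have "tensor_eval (insertion (\<Phi> \<odot> \<Psi>)) Zs p =
      (\<Sum>j<?n. \<Sum>r\<le>?n. ?c r * symmetrize (?G \<Phi> \<Psi> r) (Zs[j := S (Zs ! j)]))"
    unfolding insertion(2)[OF st[OF \<Phi> \<Psi>] Zs] tensor_eval_sym_product by simp
  also have "\<dots> = (\<Sum>r\<le>?n. ?c r * (\<Sum>j<?n. symmetrize (?G \<Phi> \<Psi> r) (Zs[j := S (Zs ! j)])))"
    by (subst sum.swap) (simp add: sum_distrib_left)
  also have "\<dots> = (\<Sum>r\<le>?n. ?c r * (symmetrize (?G (insertion \<Phi>) \<Psi> r) Zs + symmetrize (?G \<Phi> (insertion \<Psi>) r) Zs))"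
    by (intro sum.cong refl) (simp only: symmetrize_insertion key atMost_iff)
  also have "\<dots> = tensor_eval (insertion \<Phi> \<odot> \<Psi>) Zs p + tensor_eval (\<Phi> \<odot> insertion \<Psi>) Zs p"
    unfolding tensor_eval_sym_product by (simp only: distrib_left sum.distrib)
  finally show "tensor_eval (insertion (\<Phi> \<odot> \<Psi>)) Zs p = tensor_eval (insertion \<Phi> \<odot> \<Psi> + \<Phi> \<odot> insertion \<Psi>) Zs p"
    by (simp add: tensor_eval_def)
qed

lemma insertion_deg:
  assumes "\<Phi> \<in> sym_tensors_deg A r"
  shows "insertion \<Phi> \<in> sym_tensors_deg A r"
proof -
  have \<Phi>: "\<Phi> \<in> sym_tensors A" "\<And>p vs. int (length vs) \<noteq> r \<Longrightarrow> \<Phi> p vs = 0"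
    using assms by (auto simp: sym_tensors_deg_def)
  have "insertion \<Phi> p vs = 0" if "int (length vs) \<noteq> r" for p vs
  proof (cases "set vs \<subseteq> \<T> p")
    case True
    have "tensor_eval (insertion \<Phi>) (map (extend p) vs) p = 0"
      unfolding insertion(2)[OF \<Phi>(1) extend_list(1)[OF True]]
      using that by (intro sum.neutral) (simp add: tensor_eval_def \<Phi>(2))
    then show ?thesis unfolding extend_list(2)[OF True] .
  qed (rule sym_tensorsD(5)[OF insertion(1)[OF \<Phi>(1)]])
  then show ?thesis using insertion(1)[OF \<Phi>(1)] by (simp add: sym_tensors_deg_def)
qed

lemma insertion_linear:
  assumes \<Phi>: "\<Phi> \<in> sym_tensors A" and \<Psi>: "\<Psi> \<in> sym_tensors A"
  shows "insertion (\<lambda>p vs. a * \<Phi> p vs + b * \<Psi> p vs) = (\<lambda>p vs. a * insertion \<Phi> p vs + b * insertion \<Psi> p vs)"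
proof (rule sym_tensors_eqI)
  note l = sym_tensors_lincomb[OF \<Phi> \<Psi>]
  show "insertion (\<lambda>p vs. a * \<Phi> p vs + b * \<Psi> p vs) \<in> sym_tensors A" by (rule insertion[OF l])
  show "(\<lambda>p vs. a * insertion \<Phi> p vs + b * insertion \<Psi> p vs) \<in> sym_tensors A"
    by (intro sym_tensors_lincomb insertion \<Phi> \<Psi>)
  fix Zs p assume Zs: "set Zs \<subseteq> \<XX>"
  have lin: "tensor_eval (\<lambda>p vs. a * \<Phi> p vs + b * \<Psi> p vs) Ws q = a * tensor_eval \<Phi> Ws q + b * tensor_eval \<Psi> Ws q"
    for \<Phi> \<Psi> :: "'m tensor" and Ws q by (simp add: tensor_eval_def)
  show "tensor_eval (insertion (\<lambda>p vs. a * \<Phi> p vs + b * \<Psi> p vs)) Zs p =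
      tensor_eval (\<lambda>p vs. a * insertion \<Phi> p vs + b * insertion \<Psi> p vs) Zs p"
    unfolding lin insertion(2)[OF l Zs] insertion(2)[OF \<Phi> Zs] insertion(2)[OF \<Psi> Zs]
    by (simp add: sum.distrib sum_distrib_left)
qed

end

end

section \<open>Derivations are determined by functions and one-forms\<close>

context smooth_manifold
begin

definition function_tensor :: "('m \<Rightarrow> real) \<Rightarrow> 'm tensor" where
  "function_tensor f p vs = (if vs = [] then f p else 0)"

definition differential :: "('m \<Rightarrow> real) \<Rightarrow> 'm tensor" where
  "differential f p vs = (if length vs = 1 \<and> set vs \<subseteq> \<T> p then hd vs f else 0)"

lemma sym_tensors_degI:
  "\<Phi> \<in> sym_tensors A \<Longrightarrow> (\<And>p vs. int (length vs) \<noteq> r \<Longrightarrow> \<Phi> p vs = 0) \<Longrightarrow> \<Phi> \<in> sym_tensors_deg A r"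
  by (simp add: sym_tensors_deg_def)

lemma sym_tensors_degD:
  "\<Phi> \<in> sym_tensors_deg A r \<Longrightarrow> \<Phi> \<in> sym_tensors A"
  "\<Phi> \<in> sym_tensors_deg A r \<Longrightarrow> int (length vs) \<noteq> r \<Longrightarrow> \<Phi> p vs = 0"
  by (simp_all add: sym_tensors_deg_def)

lemma function_tensor_deg:
  assumes "f \<in> \<F>"
  shows "function_tensor f \<in> sym_tensors_deg A 0"
proof (rule sym_tensors_degI[OF sym_tensorsI])
  have ev: "tensor_eval (function_tensor f) Zs = (if Zs = [] then f else (\<lambda>p. 0))" for Zs
    by (auto simp: tensor_eval_def function_tensor_def)
  show "tensorial (tensor_eval (function_tensor f))"
    by (rule tensorialI[of _ 0]) (auto simp: ev assms smooth_functions_const)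
qed (auto simp: function_tensor_def)

lemma differential_deg:
  assumes "f \<in> \<F>"
  shows "differential f \<in> sym_tensors_deg A 1"
proof (rule sym_tensors_degI[OF sym_tensorsI])
  have ev: "tensor_eval (differential f) Zs p = (if length Zs = 1 then hd Zs p f else 0)"
    if "set Zs \<subseteq> \<XX>" for Zs p
    using that vector_fields_tangent by (auto simp: tensor_eval_def differential_def length_Suc_conv)
  have "tensorial (\<lambda>Zs p. if length Zs = 1 then hd Zs p f else 0)"
  proof (rule tensorialI[of _ 1])
    show "(\<lambda>p. if length Zs = 1 then hd Zs p f else 0) \<in> \<F>" if "set Zs \<subseteq> \<XX>" for Zs
    proof (cases "length Zs = 1")
      case True
      then have "hd Zs \<in> \<XX>" using that by (auto simp: length_Suc_conv)
      from vf_apply_smooth[OF this assms] show ?thesis using True by (simp add: vf_apply_def)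
    qed (simp add: smooth_functions_const)
    show "(\<lambda>p. if length Ys = 1 then hd Ys p f else 0) = (\<lambda>p. if length Zs = 1 then hd Zs p f else 0)"
      if "mset Ys = mset Zs" for Ys Zs :: "'m vfield list"
    proof (cases "length Zs = 1")
      case True
      then obtain Z where "Zs = [Z]" by (auto simp: length_Suc_conv)
      with that show ?thesis by simp
    next
      case False
      then show ?thesis using mset_eq_length[OF that] by simp
    qed
  qed (auto simp: vf_scale_apply)
  then show "tensorial (tensor_eval (differential f))"
    by (rule tensorial_cong) (simp add: ev)
qed (auto simp: differential_def)

lemma function_tensor_product:
  assumes \<Phi>: "\<Phi> \<in> sym_tensors A"
  shows "(function_tensor f \<odot> \<Phi>) p vs = f p * \<Phi> p vs"
proof -
  have "symmetrize (\<lambda>ws. function_tensor f p (take r ws) * \<Phi> p (drop r ws)) vs = (if r = 0 then f p * \<Phi> p vs else 0)"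
    if "r \<le> length vs" for r
  proof (rule symmetrize_const)
    fix ws assume ms: "mset ws = mset vs"
    then have "length ws = length vs" by (rule mset_eq_length)
    with that show "function_tensor f p (take r ws) * \<Phi> p (drop r ws) = (if r = 0 then f p * \<Phi> p vs else 0)"
      using sym_tensors_symmetric[OF \<Phi> ms, of p] by (auto simp: function_tensor_def)
  qed
  then have "(function_tensor f \<odot> \<Phi>) p vs = (\<Sum>r\<le>length vs.
      fact (length vs) / (fact r * fact (length vs - r)) * (if r = 0 then f p * \<Phi> p vs else 0))"
    unfolding sym_product_def Let_def by (intro sum.cong refl) simp
  also have "\<dots> = (\<Sum>r\<le>length vs. if r = 0 then f p * \<Phi> p vs else 0)"
    by (intro sum.cong refl) auto
  also have "\<dots> = f p * \<Phi> p vs" by simp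
  finally show ?thesis .
qed

lemma differential_product:
  "(differential f \<odot> \<Psi>) p vs =
    real (length vs) * symmetrize (\<lambda>ws. differential f p (take 1 ws) * \<Psi> p (drop 1 ws)) vs"
proof -
  let ?s = "\<lambda>r. symmetrize (\<lambda>ws. differential f p (take r ws) * \<Psi> p (drop r ws)) vs"
  have z: "?s r = 0" if "r \<le> length vs" "r \<noteq> 1" for r
    by (rule symmetrize_const) (use that in \<open>auto simp: differential_def dest!: mset_eq_length\<close>)
  have "(differential f \<odot> \<Psi>) p vs = (\<Sum>r\<le>length vs. fact (length vs) / (fact r * fact (length vs - r)) * ?s r)"
    by (simp add: sym_product_def Let_def)
  also have "\<dots> = (\<Sum>r\<le>length vs. if r = 1 then fact (length vs) / fact (length vs - 1) * ?s 1 else 0)"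
    by (intro sum.cong refl) (simp add: z)
  also have "\<dots> = real (length vs) * ?s 1"
    by (cases "length vs") (auto simp: z)
  finally show ?thesis .
qed

lemma is_derivationD:
  assumes "is_derivation A d P"
  shows "\<Phi> \<in> sym_tensors_deg A r \<Longrightarrow> P \<Phi> \<in> sym_tensors_deg A (r + d)"
    "\<Phi> \<in> sym_tensors A \<Longrightarrow> \<Psi> \<in> sym_tensors A \<Longrightarrow>
      P (\<lambda>p vs. a * \<Phi> p vs + b * \<Psi> p vs) = (\<lambda>p vs. a * P \<Phi> p vs + b * P \<Psi> p vs)"
    "\<Phi> \<in> sym_tensors A \<Longrightarrow> \<Psi> \<in> sym_tensors A \<Longrightarrow> P (\<Phi> \<odot> \<Psi>) = P \<Phi> \<odot> \<Psi> + \<Phi> \<odot> P \<Psi>"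
proof -
  note s = assms[unfolded is_derivation_def]
  show "\<Phi> \<in> sym_tensors_deg A r \<Longrightarrow> P \<Phi> \<in> sym_tensors_deg A (r + d)"
    by (rule s[THEN conjunct1, THEN spec, THEN bspec])
  show "\<Phi> \<in> sym_tensors A \<Longrightarrow> \<Psi> \<in> sym_tensors A \<Longrightarrow>
      P (\<lambda>p vs. a * \<Phi> p vs + b * \<Psi> p vs) = (\<lambda>p vs. a * P \<Phi> p vs + b * P \<Psi> p vs)"
    by (rule s[THEN conjunct2, THEN conjunct1, THEN bspec, THEN bspec, THEN spec, THEN spec])
  show "\<Phi> \<in> sym_tensors A \<Longrightarrow> \<Psi> \<in> sym_tensors A \<Longrightarrow> P (\<Phi> \<odot> \<Psi>) = P \<Phi> \<odot> \<Psi> + \<Phi> \<odot> P \<Psi>"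
    by (rule s[THEN conjunct2, THEN conjunct2, THEN bspec, THEN bspec])
qed

lemma sym_tensors_zero: "(\<lambda>p vs. 0) \<in> sym_tensors A"
  by (rule sym_tensorsI[OF tensorialI[of _ 0]]) (auto simp: tensor_eval_def smooth_functions_const)

lemma derivation_sum:
  assumes P: "is_derivation A d P" and "finite I" "\<And>i. i \<in> I \<Longrightarrow> \<Psi> i \<in> sym_tensors A"
  shows "(\<lambda>p vs. \<Sum>i\<in>I. \<Psi> i p vs) \<in> sym_tensors A \<and>
    P (\<lambda>p vs. \<Sum>i\<in>I. \<Psi> i p vs) = (\<lambda>p vs. \<Sum>i\<in>I. P (\<Psi> i) p vs)"
  using assms(2,3)
proof (induction I)
  case empty
  show ?case
    using is_derivationD(2)[OF P sym_tensors_zero sym_tensors_zero, of 0 0] sym_tensors_zero by simp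
next
  case (insert i I)
  let ?R = "\<lambda>p vs. \<Sum>i\<in>I. \<Psi> i p vs"
  have i: "\<Psi> i \<in> sym_tensors A" and R: "?R \<in> sym_tensors A" using insert by auto
  have eq: "(\<Sum>i\<in>insert i I. \<Phi> i p vs) = 1 * \<Phi> i p vs + 1 * (\<Sum>i\<in>I. \<Phi> i p vs)" for \<Phi> :: "'a \<Rightarrow> 'm tensor" and p vs
    using insert.hyps by simp
  have IH: "P ?R = (\<lambda>p vs. \<Sum>i\<in>I. P (\<Psi> i) p vs)" using insert by blast
  show ?case
    unfolding eq[of \<Psi>] eq[of "\<lambda>i. P (\<Psi> i)"]
    using sym_tensors_lincomb[OF i R, of 1 1] is_derivationD(2)[OF P i R, of 1 1] unfolding IH by (rule conjI)
qed

text \<open>A version of Euler's identity for homogeneous functions: contraction with the fields of a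
  frame followed by multiplication with the dual one-forms multiplies the component of degree \<open>N\<close>
  by \<open>N\<close>. All permutations of the arguments contribute the same value, by the symmetry of \<open>\<Phi>\<close>.
  The frame exists only on \<open>W\<close>, which is why \<open>\<Phi>\<close> has to vanish elsewhere.\<close>

lemma euler_identity:
  assumes U: "(U, c) \<in> A" and W: "W \<subseteq> U"
    and E: "\<And>i. i \<in> Basis \<Longrightarrow> E i \<in> \<XX>" "\<And>i. i \<in> Basis \<Longrightarrow> h i \<in> \<F>"
      "\<And>q i. q \<in> W \<Longrightarrow> i \<in> Basis \<Longrightarrow> E i q = coord U c q i"
      "\<And>q u i. q \<in> W \<Longrightarrow> i \<in> Basis \<Longrightarrow> coord U c q u (h i) = u \<bullet> i"
    and \<Phi>: "\<Phi> \<in> sym_tensors A" "\<And>q vs. q \<notin> W \<Longrightarrow> \<Phi> q vs = 0"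
  shows "(\<Sum>i\<in>Basis. (differential (h i) \<odot> contraction (E i) \<Phi>) q vs) = real (length vs) * \<Phi> q vs"
proof (cases "set vs \<subseteq> \<T> q \<and> q \<in> W")
  case True
  then have vs: "set vs \<subseteq> \<T> q" and q: "q \<in> W" by auto
  have key: "(\<Sum>i\<in>Basis. differential (h i) q (take 1 ws) * contraction (E i) \<Phi> q (drop 1 ws)) = \<Phi> q vs"
    if ms: "mset ws = mset vs" and ne: "vs \<noteq> []" for ws
  proof -
    have s: "set ws = set vs" using ms by (rule mset_eq_setD)
    then obtain w us where w: "ws = w # us" using ne by (cases ws) auto
    have T: "w \<in> \<T> q" "set us \<subseteq> \<T> q" using vs s unfolding w by auto
    have e: "w = (\<lambda>f. \<Sum>i\<in>Basis. w (h i) * E i q f)"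
      by (rule frame_expansion[OF U]) (use W q E T in auto)
    have "(\<Sum>i\<in>Basis. differential (h i) q (take 1 ws) * contraction (E i) \<Phi> q (drop 1 ws)) =
        (\<Sum>i\<in>Basis. w (h i) * \<Phi> q ([] @ E i q # us))"
      using T by (simp add: w differential_def contraction_def)
    also have "\<dots> = \<Phi> q ([] @ (\<lambda>f. \<Sum>i\<in>Basis. w (h i) * E i q f) # us)"
      using sym_tensor_sum[OF \<Phi>(1), of "[]" q us Basis "\<lambda>i. E i q" "\<lambda>i. w (h i)"] T vector_fields_tangent E(1)
      by simp
    also have "\<dots> = \<Phi> q ws" unfolding e[symmetric] w by simp
    also have "\<dots> = \<Phi> q vs" by (rule sym_tensors_symmetric[OF \<Phi>(1) ms])
    finally show ?thesis .
  qed
  have "(\<Sum>i\<in>Basis. (differential (h i) \<odot> contraction (E i) \<Phi>) q vs) = real (length vs) *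
      symmetrize (\<lambda>ws. \<Sum>i\<in>Basis. differential (h i) q (take 1 ws) * contraction (E i) \<Phi> q (drop 1 ws)) vs"
    unfolding differential_product symmetrize_sum sum_distrib_left ..
  also have "\<dots> = real (length vs) * \<Phi> q vs"
    using symmetrize_const[of vs, OF key] by (cases "vs = []") auto
  finally show ?thesis .
next
  case False
  have "(differential (h i) \<odot> contraction (E i) \<Phi>) q vs = 0" if i: "i \<in> Basis" for i
  proof (cases "q \<in> W")
    case True
    then have "\<not> set vs \<subseteq> \<T> q" using False by blast
    then show ?thesis
      by (rule sym_tensorsD(5)[OF sym_product_sym_tensors[OF sym_tensors_degD(1)[OF differential_deg[OF E(2)[OF i]]]
            contraction_sym_tensors[OF \<Phi>(1) E(1)[OF i]]]])
  next
    case False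
    then have "symmetrize (\<lambda>ws. differential (h i) q (take 1 ws) * contraction (E i) \<Phi> q (drop 1 ws)) vs = 0"
      by (intro symmetrize_const) (simp add: contraction_def \<Phi>(2))
    then show ?thesis by (simp add: differential_product)
  qed
  moreover have "\<Phi> q vs = 0" using False \<Phi>(2) sym_tensorsD(5)[OF \<Phi>(1)] by blast
  ultimately show ?thesis by simp
qed

text \<open>A derivation \<open>P\<close> that kills functions is linear over them, \<open>P (\<gamma> \<Phi>) = \<gamma> P \<Phi>\<close>. So \<open>P \<Phi>\<close> can
  be computed at a point after multiplication with a bump function, where Euler's identity reduces
  the degree.\<close>

lemma derivation_unique_deg:
  assumes P: "is_derivation A d P" and Q: "is_derivation A d Q"
    and P0: "\<And>f. f \<in> sym_tensors_deg A 0 \<Longrightarrow> P f = 0" and Q0: "\<And>f. f \<in> sym_tensors_deg A 0 \<Longrightarrow> Q f = 0"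
    and PQ1: "\<And>\<alpha>. \<alpha> \<in> sym_tensors_deg A 1 \<Longrightarrow> P \<alpha> = Q \<alpha>"
    and "\<Phi> \<in> sym_tensors_deg A (int n)"
  shows "P \<Phi> = Q \<Phi>"
  using assms(6)
proof (induction n arbitrary: \<Phi>)
  case 0
  then show ?case using P0 Q0 by simp
next
  case (Suc n)
  note \<Phi> = sym_tensors_degD(1)[OF Suc.prems]
  show ?case
  proof (intro ext)
    fix p vs
    obtain U c where U: "(U, c) \<in> A" "p \<in> U" by (rule ex_chart)
    obtain W E h where W: "open W" "p \<in> W" "W \<subseteq> U"
      and E: "\<And>i. i \<in> Basis \<Longrightarrow> E i \<in> \<XX>" "\<And>i. i \<in> Basis \<Longrightarrow> h i \<in> \<F>"
        "\<And>q i. q \<in> W \<Longrightarrow> i \<in> Basis \<Longrightarrow> E i q = coord U c q i"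
        "\<And>q u i. q \<in> W \<Longrightarrow> i \<in> Basis \<Longrightarrow> coord U c q u (h i) = u \<bullet> i"
      using local_frame[OF U] by metis
    obtain g W' K where g: "g \<in> \<F>" "p \<in> W'" "\<And>q. q \<in> W' \<Longrightarrow> g q = 1"
      "K \<subseteq> W" "\<And>q. q \<notin> K \<Longrightarrow> g q = 0"
      using bump_function[OF W(1,2)] by metis
    define \<Phi>' where "\<Phi>' = function_tensor g \<odot> \<Phi>"
    note fg = function_tensor_deg[OF g(1)]
    have \<Phi>'_eq: "\<Phi>' q ws = g q * \<Phi> q ws" for q ws
      unfolding \<Phi>'_def by (rule function_tensor_product[OF \<Phi>])
    have \<Phi>': "\<Phi>' \<in> sym_tensors A"
      unfolding \<Phi>'_def by (rule sym_product_sym_tensors[OF sym_tensors_degD(1)[OF fg] \<Phi>])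
    have \<Phi>'_deg: "\<Phi>' q ws = 0" if "length ws \<noteq> Suc n" for q ws
      using sym_tensors_degD(2)[OF Suc.prems, of ws q] that by (simp add: \<Phi>'_eq)
    have off: "\<Phi>' q ws = 0" if "q \<notin> W" for q ws
      using that g(4,5) by (auto simp: \<Phi>'_eq)
    \<comment> \<open>\<open>\<Phi>'\<close> may replace \<open>\<Phi>\<close> at \<open>p\<close>, because \<open>R (g \<Phi>) = g R \<Phi>\<close> and \<open>g p = 1\<close>\<close>
    have local: "R \<Phi>' p vs = R \<Phi> p vs"
      if R: "is_derivation A d R" and R0: "\<And>f. f \<in> sym_tensors_deg A 0 \<Longrightarrow> R f = 0" for R
    proof -
      have "R \<Phi>' = 0 \<odot> \<Phi> + function_tensor g \<odot> R \<Phi>"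
        unfolding \<Phi>'_def is_derivationD(3)[OF R sym_tensors_degD(1)[OF fg] \<Phi>] R0[OF fg] ..
      moreover have "(0 \<odot> \<Phi>) p vs = 0"
        by (simp add: sym_product_def Let_def symmetrize_def)
      ultimately show ?thesis
        using function_tensor_product[OF sym_tensors_degD(1)[OF is_derivationD(1)[OF R Suc.prems]], of g p vs] g(2,3)
        by simp
    qed
    have euler: "(\<lambda>q ws. \<Sum>i\<in>Basis. (differential (h i) \<odot> contraction (E i) \<Phi>') q ws) =
        (\<lambda>q ws. real (Suc n) * \<Phi>' q ws + 0 * \<Phi>' q ws)"
    proof (intro ext)
      fix q ws
      show "(\<Sum>i\<in>Basis. (differential (h i) \<odot> contraction (E i) \<Phi>') q ws) = real (Suc n) * \<Phi>' q ws + 0 * \<Phi>' q ws"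
        using euler_identity[OF U(1) W(3) E \<Phi>' off, of q ws]
        by (cases "length ws = Suc n") (simp_all add: \<Phi>'_deg)
    qed
    have st: "differential (h i) \<odot> contraction (E i) \<Phi>' \<in> sym_tensors A" if "i \<in> Basis" for i
      by (intro sym_product_sym_tensors contraction_sym_tensors sym_tensors_degD(1)[OF differential_deg] \<Phi>' E that)
    have expand: "real (Suc n) * R \<Phi>' p vs =
        (\<Sum>i\<in>Basis. (R (differential (h i)) \<odot> contraction (E i) \<Phi>' + differential (h i) \<odot> R (contraction (E i) \<Phi>')) p vs)"
      if R: "is_derivation A d R" for R
    proof -
      have "real (Suc n) * R \<Phi>' p vs = R (\<lambda>q ws. real (Suc n) * \<Phi>' q ws + 0 * \<Phi>' q ws) p vs"
        unfolding is_derivationD(2)[OF R \<Phi>' \<Phi>'] by simp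
      also have "\<dots> = (\<Sum>i\<in>Basis. R (differential (h i) \<odot> contraction (E i) \<Phi>') p vs)"
        unfolding euler[symmetric]
        using derivation_sum[OF R finite_Basis, of "\<lambda>i. differential (h i) \<odot> contraction (E i) \<Phi>'"] st by simp
      also have "\<dots> = (\<Sum>i\<in>Basis. (R (differential (h i)) \<odot> contraction (E i) \<Phi>' +
          differential (h i) \<odot> R (contraction (E i) \<Phi>')) p vs)"
      proof (rule sum.cong[OF refl])
        fix i :: 'e assume i: "i \<in> Basis"
        show "R (differential (h i) \<odot> contraction (E i) \<Phi>') p vs =
          (R (differential (h i)) \<odot> contraction (E i) \<Phi>' + differential (h i) \<odot> R (contraction (E i) \<Phi>')) p vs"
          unfolding is_derivationD(3)[OF R sym_tensors_degD(1)[OF differential_deg[OF E(2)[OF i]]]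
              contraction_sym_tensors[OF \<Phi>' E(1)[OF i]]] ..
      qed
      finally show ?thesis .
    qed
    have "P (contraction (E i) \<Phi>') = Q (contraction (E i) \<Phi>')" if i: "i \<in> Basis" for i
      by (rule Suc.IH, rule sym_tensors_degI[OF contraction_sym_tensors[OF \<Phi>' E(1)[OF i]]])
        (simp add: contraction_def \<Phi>'_deg)
    moreover have "P (differential (h i)) = Q (differential (h i))" if i: "i \<in> Basis" for i
      by (rule PQ1[OF differential_deg[OF E(2)[OF i]]])
    ultimately have "real (Suc n) * P \<Phi>' p vs = real (Suc n) * Q \<Phi>' p vs"
      unfolding expand[OF P] expand[OF Q] by (intro sum.cong refl) simp
    then have "P \<Phi>' p vs = Q \<Phi>' p vs" by simp
    then show "P \<Phi> p vs = Q \<Phi> p vs"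
      using local[OF P P0] local[OF Q Q0] by simp
  qed
qed

lemma sym_tensors_component:
  assumes \<Phi>: "\<Phi> \<in> sym_tensors A"
  shows "(\<lambda>p vs. if length vs = n then \<Phi> p vs else 0) \<in> sym_tensors_deg A (int n)"
proof (rule sym_tensors_degI[OF sym_tensorsI])
  note T = tensorial_tensor_eval[OF \<Phi>]
  have ev: "tensor_eval (\<lambda>p vs. if length vs = n then \<Phi> p vs else 0) Zs p =
    (if length Zs = n then tensor_eval \<Phi> Zs p else 0)" for Zs p by (simp add: tensor_eval_def)
  have "tensorial (\<lambda>Zs p. if length Zs = n then tensor_eval \<Phi> Zs p else 0)"
  proof (rule tensorialI[of _ n])
    show "(\<lambda>p. if length Zs = n then tensor_eval \<Phi> Zs p else 0) \<in> \<F>"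
      if "set Zs \<subseteq> \<XX>" for Zs
      using tensorialD(1)[OF T that] by (cases "length Zs = n") (simp_all add: smooth_functions_const)
    show "(\<lambda>p. if length Ys = n then tensor_eval \<Phi> Ys p else 0) = (\<lambda>p. if length Zs = n then tensor_eval \<Phi> Zs p else 0)"
      if "set Zs \<subseteq> \<XX>" "mset Ys = mset Zs" for Ys Zs
      unfolding tensorialD(2)[OF T that] mset_eq_length[OF that(2)] ..
  qed (simp_all add: tensorialD(3)[OF T])
  then show "tensorial (tensor_eval (\<lambda>p vs. if length vs = n then \<Phi> p vs else 0))"
    by (rule tensorial_cong) (simp add: ev)
qed (simp_all add: sym_tensorsD(5)[OF \<Phi>])

lemma derivation_unique:
  assumes P: "is_derivation A d P" and Q: "is_derivation A d Q"
    and P0: "\<And>f. f \<in> sym_tensors_deg A 0 \<Longrightarrow> P f = 0" and Q0: "\<And>f. f \<in> sym_tensors_deg A 0 \<Longrightarrow> Q f = 0"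
    and PQ1: "\<And>\<alpha>. \<alpha> \<in> sym_tensors_deg A 1 \<Longrightarrow> P \<alpha> = Q \<alpha>"
    and \<Phi>: "\<Phi> \<in> sym_tensors A"
  shows "P \<Phi> = Q \<Phi>"
proof -
  obtain n where n: "\<And>p vs. length vs > n \<Longrightarrow> \<Phi> p vs = 0" using sym_tensorsD(4)[OF \<Phi>] by blast
  let ?C = "\<lambda>k p vs. if length vs = k then \<Phi> p vs else 0"
  note C = sym_tensors_component[OF \<Phi>]
  have eq: "\<Phi> = (\<lambda>p vs. \<Sum>k\<in>{..n}. ?C k p vs)"
    by (intro ext) (simp add: n)
  have sum: "R \<Phi> = (\<lambda>p vs. \<Sum>k\<in>{..n}. R (?C k) p vs)" if R: "is_derivation A d R" for R
    using derivation_sum[OF R finite_atMost, of n ?C] sym_tensors_degD(1)[OF C] unfolding eq[symmetric] by blast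
  show ?thesis
    unfolding sum[OF P] sum[OF Q] using derivation_unique_deg[OF P Q P0 Q0 PQ1 C] by simp
qed

text \<open>The insertion operator has the properties that describe the symmetric contraction, by its
  Leibniz rule, and no other operator has them, by \<open>derivation_unique\<close>.\<close>

lemma sym_contraction_endomorphism:
  assumes S: "module_endomorphism S"
    and \<sigma>: "\<And>Z p. Z \<in> \<XX> \<Longrightarrow> \<sigma> p [Z p] = S Z p"
    and \<Phi>: "\<Phi> \<in> sym_tensors A"
  shows "sym_contraction A 1 \<sigma> \<Phi> = insertion S \<Phi>"
proof -
  note ins = insertion[OF S]
  define P where "P = restrict (insertion S) (sym_tensors A)"
  have P: "P \<Psi> = insertion S \<Psi>" if "\<Psi> \<in> sym_tensors A" for \<Psi>
    using that by (simp add: P_def)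
  have der: "is_derivation A 0 P"
    unfolding is_derivation_def
  proof (intro conjI allI ballI)
    show "P \<Psi> \<in> sym_tensors_deg A (r + 0)" if "\<Psi> \<in> sym_tensors_deg A r" for r \<Psi>
      using insertion_deg[OF S that] P[OF sym_tensors_degD(1)[OF that]] by simp
    show "P (\<lambda>p vs. a * \<Psi> p vs + b * \<Theta> p vs) = (\<lambda>p vs. a * P \<Psi> p vs + b * P \<Theta> p vs)"
      if "\<Psi> \<in> sym_tensors A" "\<Theta> \<in> sym_tensors A" for \<Psi> \<Theta> a b
      unfolding P[OF that(1)] P[OF that(2)] P[OF sym_tensors_lincomb[OF that]]
      by (rule insertion_linear[OF S that])
    show "P (\<Psi> \<odot> \<Theta>) = P \<Psi> \<odot> \<Theta> + \<Psi> \<odot> P \<Theta>"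
      if "\<Psi> \<in> sym_tensors A" "\<Theta> \<in> sym_tensors A" for \<Psi> \<Theta>
      unfolding P[OF that(1)] P[OF that(2)] P[OF sym_product_sym_tensors[OF that]]
      by (rule insertion_sym_product[OF S that])
  qed
  have P0: "P f = 0" if f: "f \<in> sym_tensors_deg A 0" for f
  proof -
    note fs = sym_tensors_degD(1)[OF f]
    have "tensor_eval (insertion S f) Zs p = 0" if "set Zs \<subseteq> \<XX>" for Zs p
      unfolding ins(2)[OF fs that]
      by (rule sum.neutral) (auto simp: tensor_eval_def intro!: sym_tensors_degD(2)[OF f])
    then have "insertion S f = (\<lambda>p vs. 0)"
      by (intro sym_tensors_eqI ins(1)[OF fs] sym_tensors_zero) (simp add: tensor_eval_def)
    then show ?thesis unfolding P[OF fs] by (simp add: zero_fun_def)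
  qed
  have P1: "P \<alpha> p vs = \<alpha> p [\<sigma> p vs]"
    if \<alpha>: "\<alpha> \<in> sym_tensors_deg A 1" and vs: "vs \<in> lists (\<T> p)" "length vs = 1" for \<alpha> p vs
  proof -
    obtain v where v: "vs = [v]" "v \<in> \<T> p" using vs by (auto simp: length_Suc_conv)
    note e = extend[OF v(2)]
    have "tensor_eval (insertion S \<alpha>) [extend p v] p = tensor_eval \<alpha> [S (extend p v)] p"
      using ins(2)[OF sym_tensors_degD(1)[OF \<alpha>], of "[extend p v]"] e by simp
    then show ?thesis
      using \<sigma>[OF e(1), of p] e(2) by (simp add: P[OF sym_tensors_degD(1)[OF \<alpha>]] tensor_eval_def v(1))
  qed
  have "sym_contraction A 1 \<sigma> = P"
    unfolding sym_contraction_def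
  proof (rule the_equality)
    show "P \<in> extensional (sym_tensors A) \<and> is_derivation A (int 1 - 1) P \<and>
      (\<forall>f\<in>sym_tensors_deg A 0. P f = 0) \<and>
      (\<forall>\<alpha>\<in>sym_tensors_deg A 1. \<forall>p. \<forall>vs\<in>lists (\<T> p). length vs = 1 \<longrightarrow> P \<alpha> p vs = \<alpha> p [\<sigma> p vs])"
      using der P0 P1 by (simp add: P_def)
    fix Q assume Q: "Q \<in> extensional (sym_tensors A) \<and> is_derivation A (int 1 - 1) Q \<and>
      (\<forall>f\<in>sym_tensors_deg A 0. Q f = 0) \<and>
      (\<forall>\<alpha>\<in>sym_tensors_deg A 1. \<forall>p. \<forall>vs\<in>lists (\<T> p). length vs = 1 \<longrightarrow> Q \<alpha> p vs = \<alpha> p [\<sigma> p vs])"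
    then have Qd: "is_derivation A 0 Q" by simp
    have eq1: "Q \<alpha> = P \<alpha>" if \<alpha>: "\<alpha> \<in> sym_tensors_deg A 1" for \<alpha>
    proof (intro ext)
      fix p vs
      have Qa: "Q \<alpha> \<in> sym_tensors_deg A 1" and Pa: "P \<alpha> \<in> sym_tensors_deg A 1"
        using is_derivationD(1)[OF Qd \<alpha>] is_derivationD(1)[OF der \<alpha>] by simp_all
      show "Q \<alpha> p vs = P \<alpha> p vs"
      proof (cases "length vs = 1 \<and> set vs \<subseteq> \<T> p")
        case True
        then have vs: "vs \<in> lists (\<T> p)" "length vs = 1" by (auto simp: lists_eq_set)
        then have "Q \<alpha> p vs = \<alpha> p [\<sigma> p vs]" using Q \<alpha> by blast
        then show ?thesis using P1[OF \<alpha> vs] by simp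
      next
        case False
        have "R p vs = 0" if "R \<in> sym_tensors_deg A 1" for R
          using sym_tensors_degD(2)[OF that, of vs p] sym_tensorsD(5)[OF sym_tensors_degD(1)[OF that], of vs p] False
          by auto
        from this[OF Qa] this[OF Pa] show ?thesis by simp
      qed
    qed
    have eq: "Q \<Psi> = P \<Psi>" if "\<Psi> \<in> sym_tensors A" for \<Psi>
      by (rule derivation_unique[OF Qd der _ P0 eq1 that]) (use Q in blast)
    show "Q = P"
      by (rule extensionalityI[of Q "sym_tensors A" P]) (use Q eq in \<open>auto simp: P_def\<close>)
  qed
  then show ?thesis by (simp add: P[OF \<Phi>])
qed

end

section \<open>The commutator of symmetric Lie derivatives\<close>

context smooth_manifold
begin

lemma lie_bracket_apply:
  "f \<in> \<F> \<Longrightarrow> lie_bracket A X Y p f = X p (vf_apply Y f) - Y p (vf_apply X f)"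
  by (simp add: lie_bracket_def)

lemma lie_bracket_jacobi:
  assumes V: "X \<in> \<XX>" "Y \<in> \<XX>" "Z \<in> \<XX>"
  shows "lie_bracket A (lie_bracket A X Y) Z p f + lie_bracket A (lie_bracket A Y Z) X p f +
    lie_bracket A (lie_bracket A Z X) Y p f = 0"
proof (cases "f \<in> \<F>")
  case True
  have s: "vf_apply X f \<in> \<F>" if "X \<in> \<XX>" for X
    using vf_apply_smooth[OF that True] .
  have b: "lie_bracket A (lie_bracket A X Y) Z p f =
      X p (vf_apply Y (vf_apply Z f)) - Y p (vf_apply X (vf_apply Z f)) -
      Z p (vf_apply X (vf_apply Y f)) + Z p (vf_apply Y (vf_apply X f))"
    if V: "X \<in> \<XX>" "Y \<in> \<XX>" "Z \<in> \<XX>" for X Y Z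
  proof -
    have "vf_apply (lie_bracket A X Y) f = (\<lambda>q. vf_apply X (vf_apply Y f) q - vf_apply Y (vf_apply X f) q)"
      by (simp add: vf_apply_def[abs_def] lie_bracket_apply[OF True])
    then have "Z p (vf_apply (lie_bracket A X Y) f) =
        Z p (vf_apply X (vf_apply Y f)) - Z p (vf_apply Y (vf_apply X f))"
      using tangent_vector_diff[OF vector_fields_tangent[OF V(3)] vf_apply_smooth[OF V(1) s[OF V(2)]]
          vf_apply_smooth[OF V(2) s[OF V(1)]], of p] by simp
    then show ?thesis
      by (simp add: lie_bracket_apply[OF True] lie_bracket_apply[OF s[OF V(3)]])
  qed
  show ?thesis
    unfolding b[OF V] b[OF V(2,3,1)] b[OF V(3,1,2)] by simp
qed (simp add: lie_bracket_def)

context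
  fixes D :: "'m connection"
  assumes D: "is_connection A D" and tf: "torsion_free A D"
begin

lemma torsion_freeD:
  assumes "X \<in> \<XX>" "Y \<in> \<XX>"
  shows "lie_bracket A X Y = D X Y - D Y X"
proof -
  have "D X Y - D Y X - lie_bracket A X Y = 0"
    using tf assms unfolding torsion_free_def by blast
  then show ?thesis by simp
qed

text \<open>Since the torsion vanishes, the bracket is a difference of covariant derivatives; this spares a
  computation of its components.\<close>

lemma lie_bracket_vector_fields:
  assumes "X \<in> \<XX>" "Y \<in> \<XX>"
  shows "lie_bracket A X Y \<in> \<XX>"
  unfolding torsion_freeD[OF assms] by (intro vector_fields_diff connectionD[OF D] assms)

lemma connection_diff:
  assumes "X \<in> \<XX>" "Y \<in> \<XX>" "Z \<in> \<XX>"
  shows "D X (Y - Z) = D X Y - D X Z" "D (X - Y) Z = D X Z - D Y Z"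
proof -
  have "D X (Y - Z + Z) = D X (Y - Z) + D X Z"
    by (rule connectionD(3)[OF D assms(1) vector_fields_diff[OF assms(2,3)] assms(3)])
  then show "D X (Y - Z) = D X Y - D X Z" by simp
  have "D (X - Y + Y) Z = D (X - Y) Z + D Y Z"
    by (rule connectionD(2)[OF D vector_fields_diff[OF assms(1,2)] assms(2,3)])
  then show "D (X - Y) Z = D X Z - D Y Z" by simp
qed

text \<open>Expressed by \<open>\<nabla>\<close>, the Jacobi identity is the first Bianchi identity; it is what turns the
  commutator of the operators \<open>symmetric_bracket\<close> into the endomorphism of the theorem.\<close>

lemma symmetric_bracket_commutator:
  assumes X: "X \<in> \<XX>" and Y: "Y \<in> \<XX>" and Z: "Z \<in> \<XX>"
  shows "2 * (D (D Z X) Y p f - D (D Z Y) X p f -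
      (D X (D Y Z) p f - D Y (D X Z) p f - D (lie_bracket A X Y) Z p f)) =
    symmetric_bracket D Y (symmetric_bracket D X Z) p f - symmetric_bracket D X (symmetric_bracket D Y Z) p f +
    symmetric_bracket D (lie_bracket A X Y) Z p f"
proof -
  note C = connectionD[OF D] and V = X Y Z
  have b: "lie_bracket A (lie_bracket A X Y) Z p f =
      D (lie_bracket A X Y) Z p f - (D Z (D X Y) p f - D Z (D Y X) p f)"
    if V: "X \<in> \<XX>" "Y \<in> \<XX>" "Z \<in> \<XX>" for X Y Z
  proof -
    have "D Z (lie_bracket A X Y) = D Z (D X Y) - D Z (D Y X)"
      unfolding torsion_freeD[OF V(1,2)] by (rule connection_diff(1)[OF V(3) C(1)[OF V(1,2)] C(1)[OF V(2,1)]])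
    then show ?thesis
      by (simp add: torsion_freeD[OF lie_bracket_vector_fields[OF V(1,2)] V(3)])
  qed
  have e: "D (lie_bracket A X Y) Z p f = D (D X Y) Z p f - D (D Y X) Z p f"
    if V: "X \<in> \<XX>" "Y \<in> \<XX>" "Z \<in> \<XX>" for X Y Z
    unfolding torsion_freeD[OF V(1,2)] connection_diff(2)[OF C(1)[OF V(1,2)] C(1)[OF V(2,1)] V(3)] by simp
  have s: "symmetric_bracket D Y (symmetric_bracket D X Z) p f =
      D Y (D X Z) p f + D Y (D Z X) p f + D (D X Z) Y p f + D (D Z X) Y p f"
    if V: "X \<in> \<XX>" "Y \<in> \<XX>" "Z \<in> \<XX>" for X Y Z
  proof -
    note W = C(1)[OF V(1,3)] C(1)[OF V(3,1)]
    have "D Y (D X Z + D Z X) = D Y (D X Z) + D Y (D Z X)" "D (D X Z + D Z X) Y = D (D X Z) Y + D (D Z X) Y"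
      by (rule C(3)[OF V(2) W], rule C(2)[OF W V(2)])
    then show ?thesis unfolding symmetric_bracket_def by simp
  qed
  have "symmetric_bracket D (lie_bracket A X Y) Z p f =
      D (lie_bracket A X Y) Z p f + (D Z (D X Y) p f - D Z (D Y X) p f)"
  proof -
    have "D Z (lie_bracket A X Y) = D Z (D X Y) - D Z (D Y X)"
      unfolding torsion_freeD[OF V(1,2)] by (rule connection_diff(1)[OF V(3) C(1)[OF V(1,2)] C(1)[OF V(2,1)]])
    then show ?thesis unfolding symmetric_bracket_def by simp
  qed
  moreover have "D (lie_bracket A X Y) Z p f - (D Z (D X Y) p f - D Z (D Y X) p f) +
      (D (D Y Z) X p f - D (D Z Y) X p f - (D X (D Y Z) p f - D X (D Z Y) p f)) +
      (D (D Z X) Y p f - D (D X Z) Y p f - (D Y (D Z X) p f - D Y (D X Z) p f)) = 0"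
    using lie_bracket_jacobi[OF V, of p f]
    unfolding b[OF V] b[OF V(2,3,1)] b[OF V(3,1,2)] e[OF V(2,3,1)] e[OF V(3,1,2)] .
  ultimately show ?thesis
    unfolding s[OF V] s[OF V(2,1,3)] by argo
qed

lemma module_endomorphism_nabla_nabla:
  assumes X: "X \<in> \<XX>" and Y: "Y \<in> \<XX>"
  shows "module_endomorphism (\<lambda>Z. D (D Z X) Y)"
  unfolding module_endomorphism_def
proof (intro conjI ballI)
  note C = connectionD[OF D]
  have lin: "D (vf_lin f Z g W) X = vf_lin f (D Z X) g (D W X)"
    if "f \<in> \<F>" "Z \<in> \<XX>" "g \<in> \<F>" "W \<in> \<XX>" "X \<in> \<XX>" for f Z g W X
    unfolding C(2)[OF vector_fields_scale[OF that(1,2)] vector_fields_scale[OF that(3,4)] that(5)]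
      C(4)[OF that(2,5,1)] C(4)[OF that(4,5,3)] ..
  show "D (D Z X) Y \<in> \<XX>" if "Z \<in> \<XX>" for Z by (rule C(1)[OF C(1)[OF that X] Y])
  show "D (D (vf_lin f Z g W) X) Y = vf_lin f (D (D Z X) Y) g (D (D W X) Y)"
    if "f \<in> \<F>" "Z \<in> \<XX>" "g \<in> \<F>" "W \<in> \<XX>" for f Z g W
    unfolding lin[OF that X] by (rule lin[OF that(1) C(1)[OF that(2) X] that(3) C(1)[OF that(4) X] Y])
qed

text \<open>In \<open>R(X, Y)(f Z)\<close> the terms with one derivative of \<open>f\<close> by \<open>X\<close> and one of \<open>Z\<close> by \<open>Y\<close>, or
  conversely, are symmetric in \<open>X\<close> and \<open>Y\<close> and cancel. The terms with second derivatives of \<open>f\<close>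
  add up to \<open>([X, Y] f) Z\<close>, which \<open>\<nabla>\<^bsub>[X, Y]\<^esub>(f Z)\<close> removes.\<close>

lemma module_endomorphism_curvature:
  assumes X: "X \<in> \<XX>" and Y: "Y \<in> \<XX>"
  shows "module_endomorphism (\<lambda>Z. D X (D Y Z) - D Y (D X Z) - D (lie_bracket A X Y) Z)"
  unfolding module_endomorphism_def
proof (intro conjI ballI)
  note C = connectionD[OF D] and L = lie_bracket_vector_fields[OF X Y]
  show "D X (D Y Z) - D Y (D X Z) - D (lie_bracket A X Y) Z \<in> \<XX>" if "Z \<in> \<XX>" for Z
    by (intro vector_fields_diff C(1) X Y that L)
  have lin: "D X (vf_lin f Z g W) p h = X p f * Z p h + f p * D X Z p h + (X p g * W p h + g p * D X W p h)"
    if V: "f \<in> \<F>" "Z \<in> \<XX>" "g \<in> \<F>" "W \<in> \<XX>" "X \<in> \<XX>" for f Z g W X p h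
    unfolding C(3)[OF V(5) vector_fields_scale[OF V(1,2)] vector_fields_scale[OF V(3,4)]]
      C(5)[OF V(5,2,1)] C(5)[OF V(5,4,3)] by (simp add: vf_scale_apply vf_apply_def)
  have DD: "D X (D Y (vf_scale f Z)) p h = X p (vf_apply Y f) * Z p h + Y p f * D X Z p h +
      (X p f * D Y Z p h + f p * D X (D Y Z) p h)"
    if V: "f \<in> \<F>" "Z \<in> \<XX>" "X \<in> \<XX>" "Y \<in> \<XX>" for f Z X Y p h
    unfolding C(5)[OF V(4,2,1)] lin[OF vf_apply_smooth[OF V(4,1)] V(2,1) C(1)[OF V(4,2)] V(3)]
    by (simp add: vf_apply_def)
  have DD_add: "D X (D Y (Z + W)) = D X (D Y Z) + D X (D Y W)"
    if V: "Z \<in> \<XX>" "W \<in> \<XX>" "X \<in> \<XX>" "Y \<in> \<XX>" for Z W X Y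
    unfolding C(3)[OF V(4,1,2)] by (rule C(3)[OF V(3) C(1)[OF V(4,1)] C(1)[OF V(4,2)]])
  fix f Z g W assume V: "f \<in> \<F>" "Z \<in> \<XX>" "g \<in> \<F>" "W \<in> \<XX>"
  note s = vector_fields_scale[OF V(1,2)] vector_fields_scale[OF V(3,4)]
  show "D X (D Y (vf_lin f Z g W)) - D Y (D X (vf_lin f Z g W)) - D (lie_bracket A X Y) (vf_lin f Z g W) =
      vf_lin f (D X (D Y Z) - D Y (D X Z) - D (lie_bracket A X Y) Z)
        g (D X (D Y W) - D Y (D X W) - D (lie_bracket A X Y) W)"
    unfolding DD_add[OF s X Y] DD_add[OF s Y X]
    by (intro ext) (simp add: lin[OF V L] DD[OF V(1,2) X Y] DD[OF V(1,2) Y X] DD[OF V(3,4) X Y] DD[OF V(3,4) Y X]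
        vf_scale_apply lie_bracket_apply[OF V(1)] lie_bracket_apply[OF V(3)] algebra_simps)
qed

lemma module_endomorphism_diff:
  assumes S: "module_endomorphism S" and T: "module_endomorphism T"
  shows "module_endomorphism (\<lambda>Z. S Z - T Z)"
  unfolding module_endomorphism_def
proof (intro conjI ballI)
  note S = module_endomorphismD[OF S] and T = module_endomorphismD[OF T]
  show "S Z - T Z \<in> \<XX>" if "Z \<in> \<XX>" for Z by (intro vector_fields_diff S T that)
  show "S (vf_lin f Z g W) - T (vf_lin f Z g W) = vf_lin f (S Z - T Z) g (S W - T W)"
    if "f \<in> \<F>" "Z \<in> \<XX>" "g \<in> \<F>" "W \<in> \<XX>" for f Z g W
    unfolding S(2)[OF that] T(2)[OF that] by (intro ext) (simp add: vf_scale_apply algebra_simps)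
qed

lemma module_endomorphism_double:
  assumes S: "module_endomorphism S"
  shows "module_endomorphism (\<lambda>Z. S Z + S Z)"
  unfolding module_endomorphism_def
proof (intro conjI ballI)
  note S = module_endomorphismD[OF S]
  show "S Z + S Z \<in> \<XX>" if "Z \<in> \<XX>" for Z by (intro vector_fields_add S that)
  show "S (vf_lin f Z g W) + S (vf_lin f Z g W) = vf_lin f (S Z + S Z) g (S W + S W)"
    if "f \<in> \<F>" "Z \<in> \<XX>" "g \<in> \<F>" "W \<in> \<XX>" for f Z g W
    unfolding S(2)[OF that] by (intro ext) (simp add: vf_scale_apply algebra_simps)
qed

text \<open>Both sides are tensors, so they may be compared on vector fields. There the commutator of the
  induced derivations differs from the one induced by the bracket by the insertion of \<open>Q\<close>.\<close>

lemma sym_lie_commutator: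
  assumes X: "X \<in> \<XX>" and Y: "Y \<in> \<XX>" and \<Phi>: "\<Phi> \<in> sym_tensors A"
  shows "commutator (sym_lie A D X) (sym_lie A D Y) \<Phi> =
    sym_lie A D (lie_bracket A X Y) \<Phi> +
    sym_contraction A 1 (2 * (nabla_nabla A D X Y - nabla_nabla A D Y X - curvature A D X Y)) \<Phi>"
proof -
  note C = connectionD[OF D] and L = lie_bracket_vector_fields[OF X Y] and sl = sym_lie[OF D]
  note T = tensorial_tensor_eval[OF \<Phi>]
  let ?\<sigma> = "2 * (nabla_nabla A D X Y - nabla_nabla A D Y X - curvature A D X Y)"
  define H where "H Z = D (D Z X) Y - D (D Z Y) X - (D X (D Y Z) - D Y (D X Z) - D (lie_bracket A X Y) Z)" for Z
  define Q where "Q Z = H Z + H Z" for Z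
  note n1 = module_endomorphism_nabla_nabla[OF X Y] and n2 = module_endomorphism_nabla_nabla[OF Y X]
    and c = module_endomorphism_curvature[OF X Y]
  have mQ: "module_endomorphism Q"
    unfolding Q_def[abs_def] H_def[abs_def]
    by (intro module_endomorphism_double module_endomorphism_diff n1 n2 c)
  note Q = module_endomorphismD[OF mQ]
  have \<sigma>: "?\<sigma> p [Z p] = Q Z p" if Z: "Z \<in> \<XX>" for Z p
  proof -
    have "nabla_nabla A D X Y p [Z p] = D (D Z X) Y p"
      unfolding nabla_nabla_def by (rule endo_of(2)[OF n1 Z])
    moreover have "nabla_nabla A D Y X p [Z p] = D (D Z Y) X p"
      unfolding nabla_nabla_def by (rule endo_of(2)[OF n2 Z])
    moreover have "curvature A D X Y p [Z p] = (D X (D Y Z) - D Y (D X Z) - D (lie_bracket A X Y) Z) p"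
      unfolding curvature_def by (rule endo_of(2)[OF c Z])
    ultimately show ?thesis by (intro ext) (simp add: Q_def H_def)
  qed
  have contr: "sym_contraction A 1 ?\<sigma> \<Phi> = insertion Q \<Phi>"
    by (rule sym_contraction_endomorphism[OF mQ \<sigma> \<Phi>])
  note ins = insertion[OF mQ \<Phi>]
  let ?L = "sym_lie A D" and ?E = "tensor_eval \<Phi>"
  note LX = sl[OF X \<Phi>] and LY = sl[OF Y \<Phi>]
  have comm: "commutator (?L X) (?L Y) \<Phi> = ?L X (?L Y \<Phi>) - ?L Y (?L X \<Phi>)" by (simp only: commutator_def)
  have "commutator (?L X) (?L Y) \<Phi> = ?L (lie_bracket A X Y) \<Phi> + insertion Q \<Phi>"
    unfolding comm
  proof (rule sym_tensors_eqI)
    show "?L X (?L Y \<Phi>) - ?L Y (?L X \<Phi>) \<in> sym_tensors A"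
      by (rule sym_tensors_diff[OF sl(1)[OF X LY(1)] sl(1)[OF Y LX(1)]])
    show "?L (lie_bracket A X Y) \<Phi> + insertion Q \<Phi> \<in> sym_tensors A"
      by (rule sym_tensors_add[OF sl(1)[OF L \<Phi>] ins(1)])
    fix Zs and p :: 'm assume Zs: "set Zs \<subseteq> \<XX>"
    let ?SX = "symmetric_bracket D X" and ?SY = "symmetric_bracket D Y"
      and ?SL = "symmetric_bracket D (lie_bracket A X Y)"
    note mX = module_derivation_symmetric_bracket[OF D X] and mY = module_derivation_symmetric_bracket[OF D Y]
      and mL = module_derivation_symmetric_bracket[OF D L]
    have 1: "tensor_eval (?L X (?L Y \<Phi>) - ?L Y (?L X \<Phi>)) Zs p =
        induced_derivation X ?SX (?L Y \<Phi>) Zs p - induced_derivation Y ?SY (?L X \<Phi>) Zs p"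
      using sl(2)[OF X LY(1) Zs, of p] sl(2)[OF Y LX(1) Zs, of p] by (simp add: tensor_eval_def)
    have 2: "induced_derivation X ?SX (?L Y \<Phi>) Zs p - induced_derivation Y ?SY (?L X \<Phi>) Zs p =
        X p (vf_apply Y (?E Zs)) - Y p (vf_apply X (?E Zs)) +
        (\<Sum>j<length Zs. ?E (Zs[j := ?SY (?SX (Zs ! j))]) p - ?E (Zs[j := ?SX (?SY (Zs ! j))]) p)"
      by (rule induced_derivation_commutator[OF mX mY \<Phi> LX LY Zs])
    have 3: "X p (vf_apply Y (?E Zs)) - Y p (vf_apply X (?E Zs)) = lie_bracket A X Y p (?E Zs)"
      by (simp add: lie_bracket_apply[OF tensorialD(1)[OF T Zs]])
    have 4: "(\<Sum>j<length Zs. ?E (Zs[j := ?SY (?SX (Zs ! j))]) p - ?E (Zs[j := ?SX (?SY (Zs ! j))]) p) =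
        (\<Sum>j<length Zs. ?E (Zs[j := Q (Zs ! j)]) p - ?E (Zs[j := ?SL (Zs ! j)]) p)"
    proof (rule sum.cong[OF refl])
      fix j assume j: "j \<in> {..<length Zs}"
      then have l: "j < length Zs" by simp
      have Z: "Zs ! j \<in> \<XX>" using Zs l nth_mem by blast
      have s: "?SY (?SX (Zs ! j)) \<in> \<XX>" "?SX (?SY (Zs ! j)) \<in> \<XX>" "?SL (Zs ! j) \<in> \<XX>"
        using module_derivationD(2)[OF mX] module_derivationD(2)[OF mY] module_derivationD(2)[OF mL] Z by blast+
      have eq: "?SY (?SX (Zs ! j)) - ?SX (?SY (Zs ! j)) = Q (Zs ! j) - ?SL (Zs ! j)"
      proof (intro ext)
        fix q f
        show "(?SY (?SX (Zs ! j)) - ?SX (?SY (Zs ! j))) q f = (Q (Zs ! j) - ?SL (Zs ! j)) q f"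
          using symmetric_bracket_commutator[OF X Y Z, of q f] by (simp add: Q_def H_def)
      qed
      show "?E (Zs[j := ?SY (?SX (Zs ! j))]) p - ?E (Zs[j := ?SX (?SY (Zs ! j))]) p =
          ?E (Zs[j := Q (Zs ! j)]) p - ?E (Zs[j := ?SL (Zs ! j)]) p"
        unfolding tensorial_update_diff[OF T Zs s(1,2) l, symmetric]
          tensorial_update_diff[OF T Zs Q(1)[OF Z] s(3) l, symmetric] eq ..
    qed
    have 5: "tensor_eval (?L (lie_bracket A X Y) \<Phi> + insertion Q \<Phi>) Zs p =
        lie_bracket A X Y p (?E Zs) - (\<Sum>j<length Zs. ?E (Zs[j := ?SL (Zs ! j)]) p) +
        (\<Sum>j<length Zs. ?E (Zs[j := Q (Zs ! j)]) p)"
      using sl(2)[OF L \<Phi> Zs, of p] ins(2)[OF Zs, of p] by (simp add: tensor_eval_def induced_derivation_def)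
    show "tensor_eval (?L X (?L Y \<Phi>) - ?L Y (?L X \<Phi>)) Zs p =
        tensor_eval (?L (lie_bracket A X Y) \<Phi> + insertion Q \<Phi>) Zs p"
      unfolding 1 2 3 4 5 by (simp add: sum_subtractf)
  qed
  then show ?thesis unfolding contr .
qed

end

end

theorem proposition3p2:
  fixes A :: "('m::{t2_space, second_countable_topology}, 'e::euclidean_space) chart set"
    and D :: "'m connection" and X Y :: "'m vfield"
  assumes "smooth_manifold A"
    and "is_connection A D" and "torsion_free A D"
    and "X \<in> vector_fields A" and "Y \<in> vector_fields A"
  shows "\<forall>\<Phi>\<in>sym_tensors A.
    commutator (sym_lie A D X) (sym_lie A D Y) \<Phi> =
      sym_lie A D (lie_bracket A X Y) \<Phi> +
      sym_contraction A 1 (2 * (nabla_nabla A D X Y - nabla_nabla A D Y X - curvature A D X Y)) \<Phi>"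
proof
  fix \<Phi> assume "\<Phi> \<in> sym_tensors A"
  with assms(2-) show "commutator (sym_lie A D X) (sym_lie A D Y) \<Phi> =
      sym_lie A D (lie_bracket A X Y) \<Phi> +
      sym_contraction A 1 (2 * (nabla_nabla A D X Y - nabla_nabla A D Y X - curvature A D X Y)) \<Phi>"
    by (rule smooth_manifold.sym_lie_commutator[OF assms(1)])
qed

end
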